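(* Let $G$ be a locally compact group with left Haar measure $m_G$, let $\mathbb F$ be $\mathbb R$ or $\mathbb C$, and take $p$ with $1\le p<\infty$. For $f\in\mathrm{L}^1(G,\mathbb F)$ and $g\in\mathrm{L}^p(G,\mathbb F)$, define $$(\pi_f g)(s):=\int_G f(t)g(t^{-1}s)\,dm_G(t)$$ for those $m_G$-almost all $s\in G$ for which the integral exists. Then $\pi_f g\in\mathrm{L}^p(G,\mathbb F)$ for all $f\in\mathrm{L}^1(G,\mathbb F)$ and $g\in\mathrm{L}^p(G,\mathbb F)$, $\pi_f$ is a regular operator on $\mathrm{L}^p(G,\mathbb F)$ for all $f\in\mathrm{L}^1(G,\mathbb F)$, and the map $f\mapsto\pi_f$ is an injective Banach lattice algebra homomorphism $\pi:\mathrm{L}^1(G,\mathbb F)\to\mathrm{L}_{\mathrm r}(\mathrm{L}^p(G,\mathbb F))$ (a complex Banach lattice algebra homomorphism if $\mathbb F=\mathbb C$).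
   Context: Locally compact groups are Hausdorff. $\mathrm{L}^p(G,\mathbb F)$ is the usual $\mathrm{L}^p$-space of $\mathbb F$-valued functions with respect to $m_G$, with the almost everywhere ordering for $\mathbb F=\mathbb R$; $\mathrm{L}^p(G,\mathbb C)$ is the complexification of $\mathrm{L}^p(G,\mathbb R)$. $\mathrm{L}^1(G,\mathbb F)$ has the convolution product $(f\star g)(s)=\int_G f(t)g(t^{-1}s)\,dm_G(t)$; $\mathrm{L}^1(G,\mathbb R)$ is a Banach lattice algebra, i.e. a Banach lattice that is a Banach algebra in which products of positive elements are positive. For a Dedekind complete Banach lattice $E$, $\mathrm{L}_{\mathrm r}(E)$ is the space of regular operators on $E$ (differences of two positive linear operators), ordered by $S\ge T$ iff $Sx\ge Tx$ for all $x\ge0$. It is a Dedekind complete Banach lattice algebra under the regular norm $\|T\|_{\mathrm r}=\|\,|T|\,\|$ (operator norm of the modulus of $T$ in $\mathrm{L}_{\mathrm r}(E)$). The complexification $E_{\mathbb C}$ of a Banach lattice $E$ has modulus $|x+iy|_{\mathbb C}=\sup\{x\cos\theta+y\sin\theta:0\le\theta\le2\pi\}\in E$ and norm $\|z\|_{\mathbb C}=\|\,|z|_{\mathbb C}\|$. $\mathrm{L}_{\mathrm r}(E_{\mathbb C})$ is the space of complex-linear operators $S_1+iS_2$ with $S_1,S_2\in\mathrm{L}_{\mathrm r}(E)$; it is identified with the complexification of $\mathrm{L}_{\mathrm r}(E)$, with the corresponding modulus and norm. A Banach lattice algebra homomorphism is a continuous algebra homomorphism $\pi$ between Banach lattice algebras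 that is also a lattice homomorphism ($|\pi(a)|=\pi(|a|)$ for all $a$). A complex Banach lattice algebra homomorphism is a continuous complex algebra homomorphism between complexifications of Banach lattice algebras with $|\pi(z)|_{\mathbb C}=\pi(|z|_{\mathbb C})$ for all $z$. *)

theory Defs
  imports "HOL-Analysis.Analysis" "HOL-Algebra.Lattice"
begin

section \<open>Left Haar measures\<close>

text \<open>
  Groups are written additively: the class \<^class>\<open>topological_group_add\<close> does not assume
  commutativity, and \<open>- t + s\<close> stands for \<open>t\<^sup>-\<^sup>1 s\<close>.
  A left Haar measure is a non-zero left invariant Radon measure on the Borel sets
  (finite on compact sets, outer regular on Borel sets, inner regular on open sets).
  No countability or sigma-finiteness is assumed.
\<close>

definition left_haar_measure :: "'g::{topological_group_add,t2_space} measure \<Rightarrow> bool" where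
  "left_haar_measure M \<longleftrightarrow>
     sets M = sets borel \<and>
     emeasure M UNIV \<noteq> 0 \<and>
     (\<forall>K. compact K \<longrightarrow> emeasure M K < \<infinity>) \<and>
     (\<forall>A\<in>sets borel. emeasure M A = (INF U\<in>{U. open U \<and> A \<subseteq> U}. emeasure M U)) \<and>
     (\<forall>U. open U \<longrightarrow> emeasure M U = (SUP K\<in>{K. compact K \<and> K \<subseteq> U}. emeasure M K)) \<and>
     (\<forall>a. \<forall>A\<in>sets borel. emeasure M ((\<lambda>x. a + x) ` A) = emeasure M A)"


section \<open>Banach lattices, their complexifications, and regular operators\<close>

text \<open>
  The records below only collect the operations of a Banach lattice (algebra); the order is
  that of \<^theory>\<open>HOL-Algebra.Order\<close>, so that \<open>\<Squnion>\<^bsub>E\<^esub>A\<close> is the supremum of \<open>A\<close> in \<open>E\<close>.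
  As for \<open>hom\<close> in HOL-Algebra, the homomorphism predicates further down speak about these
  operations and do not repeat the axioms for the domain and the codomain.
\<close>

record 'a normed_lattice = "'a gorder" +
  vadd :: "'a \<Rightarrow> 'a \<Rightarrow> 'a"
  vzero :: 'a
  vscale :: "real \<Rightarrow> 'a \<Rightarrow> 'a"
  vnorm :: "'a \<Rightarrow> real"

record 'a normed_lattice_algebra = "'a normed_lattice" +
  amult :: "'a \<Rightarrow> 'a \<Rightarrow> 'a"

definition modulus :: "('a, 'm) normed_lattice_scheme \<Rightarrow> 'a \<Rightarrow> 'a" where
  "modulus E x = \<Squnion>\<^bsub>E\<^esub>{x, vscale E (- 1) x}"

definition vdist :: "('a, 'm) normed_lattice_scheme \<Rightarrow> 'a \<Rightarrow> 'a \<Rightarrow> real" where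
  "vdist E x y = vnorm E (vadd E x (vscale E (- 1) y))"

text \<open>
  The complexification \<open>Z\<close> of the real structure \<open>E = real_lattice Z\<close>: \<open>inj_real Z\<close> is the embedding
  of \<open>E\<close>, and every \<open>z\<close> is \<open>inj_real Z x + \<i> inj_real Z y\<close> with \<open>x = re_part Z z\<close>, \<open>y = im_part Z z\<close>.
  Modulus and norm are not fields; they are determined by \<open>E\<close>.
\<close>

record ('z, 'a) complexified = "'z partial_object" +
  cadd :: "'z \<Rightarrow> 'z \<Rightarrow> 'z"
  cscale :: "complex \<Rightarrow> 'z \<Rightarrow> 'z"
  re_part :: "'z \<Rightarrow> 'a"
  im_part :: "'z \<Rightarrow> 'a"
  inj_real :: "'a \<Rightarrow> 'z"
  real_lattice :: "'a normed_lattice"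

record ('z, 'a) complexified_algebra = "('z, 'a) complexified" +
  cmult :: "'z \<Rightarrow> 'z \<Rightarrow> 'z"

definition cmodulus :: "('z, 'a, 'm) complexified_scheme \<Rightarrow> 'z \<Rightarrow> 'a" where
  "cmodulus Z z = (let E = real_lattice Z in
     \<Squnion>\<^bsub>E\<^esub>((\<lambda>\<theta>. vadd E (vscale E (cos \<theta>) (re_part Z z)) (vscale E (sin \<theta>) (im_part Z z)))
         ` {0..2 * pi}))"

definition cnorm :: "('z, 'a, 'm) complexified_scheme \<Rightarrow> 'z \<Rightarrow> real" where
  "cnorm Z z = vnorm (real_lattice Z) (cmodulus Z z)"

definition cdist :: "('z, 'a, 'm) complexified_scheme \<Rightarrow> 'z \<Rightarrow> 'z \<Rightarrow> real" where
  "cdist Z z w = cnorm Z (cadd Z z (cscale Z (- 1) w))"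

text \<open>
  Operators on \<open>E\<close> are functions on \<open>carrier E\<close>, taken to be \<open>undefined\<close> elsewhere so that
  equality of operators is equality of functions.
\<close>

definition linear_operator :: "'a normed_lattice \<Rightarrow> ('a \<Rightarrow> 'a) \<Rightarrow> bool" where
  "linear_operator E T \<longleftrightarrow>
     T \<in> carrier E \<rightarrow>\<^sub>E carrier E \<and>
     (\<forall>x\<in>carrier E. \<forall>y\<in>carrier E. T (vadd E x y) = vadd E (T x) (T y)) \<and>
     (\<forall>c. \<forall>x\<in>carrier E. T (vscale E c x) = vscale E c (T x))"

definition positive_operator :: "'a normed_lattice \<Rightarrow> ('a \<Rightarrow> 'a) \<Rightarrow> bool" where
  "positive_operator E T \<longleftrightarrow>
     linear_operator E T \<and> (\<forall>x\<in>carrier E. vzero E \<sqsubseteq>\<^bsub>E\<^esub> x \<longrightarrow> vzero E \<sqsubseteq>\<^bsub>E\<^esub> T x)"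

definition regular_operators :: "'a normed_lattice \<Rightarrow> ('a \<Rightarrow> 'a) set" where
  "regular_operators E =
     {T. \<exists>P Q. positive_operator E P \<and> positive_operator E Q \<and>
           T = (\<lambda>x\<in>carrier E. vadd E (P x) (vscale E (- 1) (Q x)))}"

definition regular_order :: "'a normed_lattice \<Rightarrow> ('a \<Rightarrow> 'a) gorder" where
  "regular_order E =
     \<lparr>carrier = regular_operators E, eq = (=),
      le = (\<lambda>S T. \<forall>x\<in>carrier E. vzero E \<sqsubseteq>\<^bsub>E\<^esub> x \<longrightarrow> S x \<sqsubseteq>\<^bsub>E\<^esub> T x)\<rparr>"

definition operator_norm :: "'a normed_lattice \<Rightarrow> ('a \<Rightarrow> 'a) \<Rightarrow> real" where
  "operator_norm E T = (SUP x\<in>{x \<in> carrier E. vnorm E x \<le> 1}. vnorm E (T x))"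

definition regular_norm :: "'a normed_lattice \<Rightarrow> ('a \<Rightarrow> 'a) \<Rightarrow> real" where
  "regular_norm E T =
     operator_norm E (\<Squnion>\<^bsub>regular_order E\<^esub>{T, \<lambda>x\<in>carrier E. vscale E (- 1) (T x)})"

definition regular_lattice :: "'a normed_lattice \<Rightarrow> ('a \<Rightarrow> 'a) normed_lattice" where
  "regular_lattice E =
     \<lparr>carrier = carrier (regular_order E), eq = eq (regular_order E), le = le (regular_order E),
      vadd = (\<lambda>S T. \<lambda>x\<in>carrier E. vadd E (S x) (T x)),
      vzero = (\<lambda>x\<in>carrier E. vzero E),
      vscale = (\<lambda>c T. \<lambda>x\<in>carrier E. vscale E c (T x)),
      vnorm = regular_norm E\<rparr>"

definition regular_algebra :: "'a normed_lattice \<Rightarrow> ('a \<Rightarrow> 'a) normed_lattice_algebra" where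
  "regular_algebra E =
     normed_lattice.extend (regular_lattice E)
       (normed_lattice_algebra.fields (compose (carrier E)))"

definition complexify_operator ::
    "('z, 'a, 'm) complexified_scheme \<Rightarrow> ('a \<Rightarrow> 'a) \<Rightarrow> 'z \<Rightarrow> 'z" where
  "complexify_operator Z S =
     (\<lambda>z\<in>carrier Z. cadd Z (inj_real Z (S (re_part Z z)))
                           (cscale Z \<i> (inj_real Z (S (im_part Z z)))))"

definition complex_regular_operators :: "('z, 'a) complexified \<Rightarrow> ('z \<Rightarrow> 'z) set" where
  "complex_regular_operators Z =
     {T. \<exists>S\<^sub>1\<in>regular_operators (real_lattice Z). \<exists>S\<^sub>2\<in>regular_operators (real_lattice Z).
           T = (\<lambda>z\<in>carrier Z. cadd Z (complexify_operator Z S\<^sub>1 z)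
                                     (cscale Z \<i> (complexify_operator Z S\<^sub>2 z)))}"

text \<open>
  The regular operators on \<open>Z\<close>, as the complexification of the regular operators on \<open>real_lattice Z\<close>:
  if \<open>T = S\<^sub>1 + \<i> S\<^sub>2\<close>, then \<open>S\<^sub>1\<close> and \<open>S\<^sub>2\<close> are read off from the values of \<open>T\<close> on the real elements.
\<close>

definition complex_regular_algebra ::
    "('z, 'a) complexified \<Rightarrow> ('z \<Rightarrow> 'z, 'a \<Rightarrow> 'a) complexified_algebra" where
  "complex_regular_algebra Z =
     \<lparr>carrier = complex_regular_operators Z,
      cadd = (\<lambda>S T. \<lambda>z\<in>carrier Z. cadd Z (S z) (T z)),
      cscale = (\<lambda>c T. \<lambda>z\<in>carrier Z. cscale Z c (T z)),
      re_part = (\<lambda>T. \<lambda>x\<in>carrier (real_lattice Z). re_part Z (T (inj_real Z x))),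
      im_part = (\<lambda>T. \<lambda>x\<in>carrier (real_lattice Z). im_part Z (T (inj_real Z x))),
      inj_real = complexify_operator Z,
      real_lattice = regular_lattice (real_lattice Z),
      cmult = compose (carrier Z)\<rparr>"


section \<open>Banach lattice algebra homomorphisms\<close>

definition dist_continuous_on ::
    "'a set \<Rightarrow> ('a \<Rightarrow> 'a \<Rightarrow> real) \<Rightarrow> ('b \<Rightarrow> 'b \<Rightarrow> real) \<Rightarrow> ('a \<Rightarrow> 'b) \<Rightarrow> bool" where
  "dist_continuous_on A d e f \<longleftrightarrow>
     (\<forall>x\<in>A. \<forall>\<epsilon>>0. \<exists>\<delta>>0. \<forall>y\<in>A. d y x < \<delta> \<longrightarrow> e (f y) (f x) < \<epsilon>)"

definition bla_hom ::
    "'a normed_lattice_algebra \<Rightarrow> 'b normed_lattice_algebra \<Rightarrow> ('a \<Rightarrow> 'b) \<Rightarrow> bool" where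
  "bla_hom A B \<phi> \<longleftrightarrow>
     \<phi> \<in> carrier A \<rightarrow> carrier B \<and>
     (\<forall>a\<in>carrier A. \<forall>b\<in>carrier A. \<phi> (vadd A a b) = vadd B (\<phi> a) (\<phi> b)) \<and>
     (\<forall>c. \<forall>a\<in>carrier A. \<phi> (vscale A c a) = vscale B c (\<phi> a)) \<and>
     (\<forall>a\<in>carrier A. \<forall>b\<in>carrier A. \<phi> (amult A a b) = amult B (\<phi> a) (\<phi> b)) \<and>
     dist_continuous_on (carrier A) (vdist A) (vdist B) \<phi> \<and>
     (\<forall>a\<in>carrier A. modulus B (\<phi> a) = \<phi> (modulus A a))"

text \<open>
  In the last clause the moduli are regarded as elements of the complexifications via the
  embeddings \<open>inj_real\<close>.
\<close>

definition complex_bla_hom ::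
    "('z, 'a) complexified_algebra \<Rightarrow> ('w, 'b) complexified_algebra \<Rightarrow> ('z \<Rightarrow> 'w) \<Rightarrow> bool" where
  "complex_bla_hom A B \<phi> \<longleftrightarrow>
     \<phi> \<in> carrier A \<rightarrow> carrier B \<and>
     (\<forall>a\<in>carrier A. \<forall>b\<in>carrier A. \<phi> (cadd A a b) = cadd B (\<phi> a) (\<phi> b)) \<and>
     (\<forall>c. \<forall>a\<in>carrier A. \<phi> (cscale A c a) = cscale B c (\<phi> a)) \<and>
     (\<forall>a\<in>carrier A. \<forall>b\<in>carrier A. \<phi> (cmult A a b) = cmult B (\<phi> a) (\<phi> b)) \<and>
     dist_continuous_on (carrier A) (cdist A) (cdist B) \<phi> \<and>
     (\<forall>a\<in>carrier A. inj_real B (cmodulus B (\<phi> a)) = \<phi> (inj_real A (cmodulus A a)))"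


section \<open>The spaces of p-integrable functions\<close>

text \<open>Elements are classes of Borel measurable functions modulo almost everywhere equality.\<close>

definition Lp_space ::
    "'a measure \<Rightarrow> real \<Rightarrow> ('a \<Rightarrow> 'b::{banach,second_countable_topology}) set set" where
  "Lp_space M p =
     {{h \<in> borel_measurable M. AE x in M. h x = f x} | f.
        f \<in> borel_measurable M \<and> integrable M (\<lambda>x. norm (f x) powr p)}"

definition ae_lift ::
    "'a measure \<Rightarrow> ('b \<Rightarrow> 'c) \<Rightarrow> ('a \<Rightarrow> 'b) set \<Rightarrow> ('a \<Rightarrow> 'c::topological_space) set" where
  "ae_lift M u F = {h \<in> borel_measurable M. \<exists>f\<in>F. AE x in M. h x = u (f x)}"

definition ae_lift2 ::
    "'a measure \<Rightarrow> ('b \<Rightarrow> 'c \<Rightarrow> 'd) \<Rightarrow> ('a \<Rightarrow> 'b) set \<Rightarrow> ('a \<Rightarrow> 'c) set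
      \<Rightarrow> ('a \<Rightarrow> 'd::topological_space) set" where
  "ae_lift2 M u F G = {h \<in> borel_measurable M. \<exists>f\<in>F. \<exists>g\<in>G. AE x in M. h x = u (f x) (g x)}"

definition Lp_norm :: "'a measure \<Rightarrow> real \<Rightarrow> ('a \<Rightarrow> 'b::real_normed_vector) set \<Rightarrow> real" where
  "Lp_norm M p F = (LINT x|M. norm ((SOME f. f \<in> F) x) powr p) powr (1 / p)"

definition Lp_lattice :: "'a measure \<Rightarrow> real \<Rightarrow> ('a \<Rightarrow> real) set normed_lattice" where
  "Lp_lattice M p =
     \<lparr>carrier = Lp_space M p, eq = (=),
      le = (\<lambda>F G. \<exists>f\<in>F. \<exists>g\<in>G. AE x in M. f x \<le> g x),
      vadd = ae_lift2 M (+),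
      vzero = {h \<in> borel_measurable M. AE x in M. h x = 0},
      vscale = (\<lambda>c. ae_lift M (\<lambda>y. c * y)),
      vnorm = Lp_norm M p\<rparr>"

definition complex_Lp ::
    "'a measure \<Rightarrow> real \<Rightarrow> (('a \<Rightarrow> complex) set, ('a \<Rightarrow> real) set) complexified" where
  "complex_Lp M p =
     \<lparr>carrier = Lp_space M p,
      cadd = ae_lift2 M (+),
      cscale = (\<lambda>c. ae_lift M (\<lambda>y. c * y)),
      re_part = ae_lift M Re,
      im_part = ae_lift M Im,
      inj_real = ae_lift M complex_of_real,
      real_lattice = Lp_lattice M p\<rparr>"


section \<open>Convolution\<close>

text \<open>
  The class of \<open>s \<mapsto> \<integral> f t * g (- t + s) dM\<close>, for all representatives \<open>f\<close>, \<open>g\<close>. Existence of the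
  integral is part of the condition: the set is empty, hence not an element of any \<open>Lp_space M p\<close>,
  unless the integral exists for almost all \<open>s\<close>.
\<close>

definition conv ::
    "'g::group_add measure \<Rightarrow> ('g \<Rightarrow> 'b) set \<Rightarrow> ('g \<Rightarrow> 'b) set
      \<Rightarrow> ('g \<Rightarrow> 'b::{real_normed_field,banach,second_countable_topology}) set" where
  "conv M F G =
     {h \<in> borel_measurable M. \<forall>f\<in>F. \<forall>g\<in>G. AE s in M.
        integrable M (\<lambda>t. f t * g (- t + s)) \<and> h s = (LINT t|M. f t * g (- t + s))}"

definition L1_algebra :: "'g::group_add measure \<Rightarrow> ('g \<Rightarrow> real) set normed_lattice_algebra" where
  "L1_algebra M =
     normed_lattice.extend (Lp_lattice M 1) (normed_lattice_algebra.fields (conv M))"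

definition complex_L1_algebra ::
    "'g::group_add measure \<Rightarrow> (('g \<Rightarrow> complex) set, ('g \<Rightarrow> real) set) complexified_algebra" where
  "complex_L1_algebra M =
     complexified.extend (complex_Lp M 1) (complexified_algebra.fields (conv M))"

definition conv_operator ::
    "'g::group_add measure \<Rightarrow> real \<Rightarrow> ('g \<Rightarrow> 'b) set \<Rightarrow> ('g \<Rightarrow> 'b) set
      \<Rightarrow> ('g \<Rightarrow> 'b::{real_normed_field,banach,second_countable_topology}) set" where
  "conv_operator M p F = (\<lambda>G\<in>Lp_space M p. conv M F G)"

end

theory Submission
  imports Defs
begin

text \<open>
  The essential point is that \<open>\<pi>\<^sub>f\<close> has modulus \<open>\<pi>\<^bsub>|f|\<^esub>\<close> among the regular operators. If \<open>T\<close> dominates the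
  operators \<open>\<plusminus> \<pi>\<^sub>f\<close> (or all \<open>Re (c \<pi>\<^sub>f)\<close> with \<open>|c| = 1\<close>), then \<open>|f \<star> g| \<le> T g\<close> for all \<open>g \<ge> 0\<close>. Approximate
  \<open>f\<close> in \<open>L\<^sup>1\<close> by a function \<open>\<phi>\<close> that is constant on each of finitely many disjoint compact sets and zero
  elsewhere, and cut \<open>g\<close> into countably many pieces \<open>g\<^sub>i\<close> supported in small translates \<open>V + x\<^sub>i\<close>. For given \<open>s\<close>,
  only one value of \<open>\<phi>\<close> contributes to \<open>(\<phi> \<star> g\<^sub>i) s\<close>, so \<open>|\<phi> \<star> g\<^sub>i| = |\<phi>| \<star> g\<^sub>i\<close>; summing over \<open>i\<close>
  yields \<open>|f| \<star> g \<le> T g + 2 |f - \<phi>| \<star> g\<close>, and the error term tends to zero almost everywhere along a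
  suitable sequence of \<open>\<phi>\<close>. Injectivity is a consequence: if \<open>\<pi>\<^sub>f = 0\<close>, then \<open>\<pi>\<^bsub>|f|\<^esub> = 0\<close>, and
  \<open>\<integral> |f| \<star> g = \<integral> |f| \<integral> g\<close>.

  The group is neither second countable nor sigma-compact, so \<open>(s, t) \<mapsto> g (- t + s)\<close> need not be measurable
  for the product sigma-algebra, and the measure need not be sigma-finite. Instead, Tonelli's theorem
  holds for Borel functions on the product space by reduction to open sets, and p-integrable functions
  vanish outside countable unions of compact sets.
\<close>

section \<open>Tonelli's theorem for Borel functions on a product of topological spaces\<close>

text \<open>Cutting \<open>g\<close> is forced by cancellation: for one fixed \<open>g\<close>,
  \<open>|f \<star> g|\<close> may lie far below \<open>|f| \<star> g\<close>. Cutting is legitimate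
  because an upper bound \<open>T\<close> is additive on positive functions; apart from this and the
  domination itself, which also makes \<open>T\<close> positive, nothing about \<open>T\<close>
  enters the comparison. The supremum of operators is thus found from the definition of a least
  upper bound, without the Riesz-Kantorovich formula. The sets \<open>V\<close> exist since for
  disjoint compact \<open>K\<close> and \<open>L\<close> the compact set \<open>- K + L\<close>
  misses 0, hence misses \<open>V - V\<close> for small \<open>V\<close>. The factor 2 collects one
  \<open>|f - \<phi>|\<close> from replacing \<open>|f|\<close> by \<open>|\<phi>|\<close>, and one
  from returning from \<open>\<phi> \<star> g\<close> to \<open>f \<star> g\<close> inside the norm.
  No modular function appears: values of integrals are compared under left translations only, and
  inversion is used only to preserve null sets, so that almost everywhere statements can be
  evaluated at \<open>- t + s\<close>.\<close>

text \<open>Kept apart from invariance because this property passes to the restriction of a Haar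
  measure to an open set of finite measure, where the results for finite measures apply.\<close>

definition inner_regular_on_open :: "'a::t2_space measure \<Rightarrow> bool" where
  "inner_regular_on_open M \<longleftrightarrow> sets M = sets borel \<and>
     (\<forall>U. open U \<longrightarrow> emeasure M U = (SUP K\<in>{K. compact K \<and> K \<subseteq> U}. emeasure M K))"

lemma inner_regular_on_open_approx:
  assumes "inner_regular_on_open M" "open U" "emeasure M U \<noteq> \<infinity>" "0 < (e::real)"
  obtains K where "compact K" "K \<subseteq> U" "emeasure M U < emeasure M K + ennreal e"
proof -
  have "emeasure M U = (SUP K\<in>{K. compact K \<and> K \<subseteq> U}. emeasure M K)"
    using assms by (simp add: inner_regular_on_open_def)
  moreover have "{K. compact K \<and> K \<subseteq> U} \<noteq> {}" by (auto intro: exI[of _ "{}"])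
  ultimately have "\<exists>K\<in>{K. compact K \<and> K \<subseteq> U}. emeasure M U < emeasure M K + ennreal e"
    using assms by (intro SUP_approx_ennreal) auto
  with that show ?thesis by blast
qed

lemma inner_regular_on_open_less:
  assumes "inner_regular_on_open M" "open U" "a < emeasure M U"
  obtains K where "compact K" "K \<subseteq> U" "a < emeasure M K"
  using assms by (auto simp: inner_regular_on_open_def less_SUP_iff)

lemma vimage_Pair_in_borel:
  assumes "E \<in> sets (borel :: ('a::topological_space \<times> 'b::topological_space) measure)"
  shows "Pair s -` E \<in> sets borel" "(\<lambda>s. (s, t)) -` E \<in> sets borel"
proof -
  have "Pair s \<in> borel \<rightarrow>\<^sub>M (borel :: ('a \<times> 'b) measure)"
    "(\<lambda>s. (s, t)) \<in> borel \<rightarrow>\<^sub>M (borel :: ('a \<times> 'b) measure)"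
    by (intro borel_measurable_continuous_onI continuous_intros)+
  from measurable_sets[OF this(1) assms] measurable_sets[OF this(2) assms]
  show "Pair s -` E \<in> sets borel" "(\<lambda>s. (s, t)) -` E \<in> sets borel" by auto
qed

lemma open_vimage_Pair:
  assumes "open (E :: ('a::topological_space \<times> 'b::topological_space) set)"
  shows "open (Pair s -` E)" "open ((\<lambda>s. (s, t)) -` E)"
  using assms by (auto intro!: open_vimage continuous_intros)

lemma prod_swap_borel:
  "prod.swap \<in> (borel :: ('a::topological_space \<times> 'b::topological_space) measure) \<rightarrow>\<^sub>M borel"
  by (rule borel_measurable_continuous_onI) (auto simp: prod.swap_def intro!: continuous_intros)

lemma tube_section:
  assumes "compact K" "open E" "K \<subseteq> Pair s -` E"
  obtains B where "s \<in> B" "open B" "B \<times> K \<subseteq> E"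
proof -
  have "{s} \<times> K \<subseteq> E" using assms by auto
  from Elementary_Topology.tube_lemma[OF assms(1,2) this] that show ?thesis by blast
qed

text \<open>A compact subset of one section with measure above \<open>a\<close> stays inside all
  neighbouring sections by the tube lemma. So the section measures of an open set are lower
  semicontinuous, hence Borel, without recourse to the product sigma-algebra.\<close>

lemma open_section_measure_gt:
  fixes E :: "('a::topological_space \<times> 'b::t2_space) set"
  assumes N: "inner_regular_on_open N" and E: "open E"
  shows "open {s. a < emeasure N (Pair s -` E)}"
proof (subst open_subopen, safe)
  fix s assume a: "a < emeasure N (Pair s -` E)"
  obtain K where K: "compact K" "K \<subseteq> Pair s -` E" "a < emeasure N K"
    using inner_regular_on_open_less[OF N open_vimage_Pair(1)[OF E] a] .
  obtain B where B: "s \<in> B" "open B" "B \<times> K \<subseteq> E"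
    using tube_section[OF K(1) E K(2)] .
  have "a < emeasure N (Pair s' -` E)" if "s' \<in> B" for s'
  proof -
    have "emeasure N K \<le> emeasure N (Pair s' -` E)"
      using B that N open_vimage_Pair(1)[OF E]
      by (intro emeasure_mono) (auto simp: inner_regular_on_open_def)
    with K show ?thesis by simp
  qed
  with B show "\<exists>T. open T \<and> s \<in> T \<and> T \<subseteq> {s. a < emeasure N (Pair s -` E)}" by blast
qed

section \<open>Layer sums, and Tonelli's theorem for open sets\<close>

text \<open>Every level \<open>(k + 1) * e\<close> exceeded by \<open>x\<close> contributes
  \<open>e\<close>. Rounding down to a level costs at most one further \<open>e\<close>; having only
  \<open>m\<close> levels costs the truncation by \<open>min\<close>.\<close>

lemma layer_sum_upper:
  fixes x e :: real assumes "0 \<le> e"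
  shows "min x (real (Suc m) * e) \<le> e + (\<Sum>k<m. if x > real (Suc k) * e then e else 0)"
proof (induction m)
  case (Suc m)
  show ?case
  proof (cases "x > real (Suc m) * e")
    case True
    then have "real (Suc m) * e \<le> e + (\<Sum>k<m. if x > real (Suc k) * e then e else 0)"
      using Suc by simp
    with True show ?thesis by (simp add: algebra_simps min_def)
  next
    case False
    with Suc show ?thesis by simp
  qed
qed simp

text \<open>The sets \<open>C k\<close> need not be nested: if \<open>s\<close> lies in the last
  one, then \<open>y\<close> already dominates as many copies of \<open>e\<close> as there are
  summands; otherwise the last summand vanishes.\<close>

lemma layer_sum_lower:
  fixes y e :: real
  assumes "0 \<le> e" "0 \<le> y" "\<And>k. k < m \<Longrightarrow> s \<in> C k \<Longrightarrow> real (Suc k) * e \<le> y"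
  shows "(\<Sum>k<m. if s \<in> C k then e else 0) \<le> y"
  using assms(3)
proof (induction m)
  case (Suc m)
  show ?case
  proof (cases "s \<in> C m")
    case True
    have "(\<Sum>k<Suc m. if s \<in> C k then e else 0) \<le> (\<Sum>k<Suc m. e)"
      using assms by (intro sum_mono) auto
    also have "\<dots> \<le> y" using Suc.prems[of m] True by simp
    finally show ?thesis .
  qed (use Suc in auto)
qed (use assms in auto)

text \<open>By inner regularity and the tube lemma, the left-hand side is approximated by the corresponding
  integral for a finite union of rectangles \<open>B \<times> K \<subseteq> E\<close>, which is measurable for the product
  sigma-algebra. The sets \<open>{s. k e < N (E\<^sub>s)}\<close> needed for this are open.\<close>

lemma measure_sections_open_le:
  fixes E :: "('a::t2_space \<times> 'b::t2_space) set"
  assumes M: "inner_regular_on_open M" "finite_measure M"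
    and N: "inner_regular_on_open N" "finite_measure N" and E: "open E"
  shows "(\<integral>\<^sup>+s. emeasure N (Pair s -` E) \<partial>M) \<le> (\<integral>\<^sup>+t. emeasure M ((\<lambda>s. (s, t)) -` E) \<partial>N)"
    (is "?L \<le> ?R")
proof (rule ennreal_le_epsilon)
  fix e' :: real assume e': "0 < e'"
  interpret M: finite_measure M by fact
  interpret N: finite_measure N by fact
  interpret pair_sigma_finite M N by standard
  have sM[measurable_cong, simp]: "sets M = sets borel" and sN[measurable_cong, simp]: "sets N = sets borel"
    using M N by (auto simp: inner_regular_on_open_def)
  have sp[simp]: "space M = UNIV" "space N = UNIV"
    using sets_eq_imp_space_eq[OF sM] sets_eq_imp_space_eq[OF sN] by auto
  \<comment> \<open>Layer sums cost \<open>e\<close> on the whole space, and each of the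
    \<open>m\<close> layers loses at most \<open>e / m\<close> when its open level set is replaced
    by a compact subset. The total is \<open>e * (measure M UNIV + 1) = e'\<close>.\<close>
  define e where "e = e' / (measure M UNIV + 1)"
  have e: "0 < e" using e' by (simp add: e_def add_nonneg_pos)
  \<comment> \<open>The levels reach as high as any section measure, so that the minimum in
    \<open>layer_sum_upper\<close> is the section measure itself.\<close>
  obtain m0 :: nat where m0: "measure N UNIV / e < real m0" using reals_Archimedean2 by blast
  define m where "m = Suc m0"
  have m: "0 < m" "measure N UNIV \<le> real m * e"
    using m0 e by (auto simp: m_def field_simps)
  let ?\<phi> = "\<lambda>s. measure N (Pair s -` E)"
  have \<phi>_le: "?\<phi> s \<le> real m * e" for s
    using N.bounded_measure[of "Pair s -` E"] m by simp
  have \<phi>_eq: "{s. ennreal a < emeasure N (Pair s -` E)} = {s. a < ?\<phi> s}" if "0 \<le> a" for a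
    using that by (auto simp: N.emeasure_eq_measure ennreal_less_iff)
  have op: "open {s. a < ?\<phi> s}" if "0 \<le> a" for a
    using open_section_measure_gt[OF N(1) E, of "ennreal a"] that by (simp add: \<phi>_eq)
  have "\<exists>C. compact C \<and> C \<subseteq> {s. real (Suc k) * e < ?\<phi> s} \<and>
          measure M {s. real (Suc k) * e < ?\<phi> s} \<le> measure M C + 1 / m" for k
  proof -
    let ?U = "{s. real (Suc k) * e < ?\<phi> s}"
    have "open ?U" using e by (intro op) auto
    then obtain C where C: "compact C" "C \<subseteq> ?U" "emeasure M ?U < emeasure M C + ennreal (1 / m)"
      using inner_regular_on_open_approx[OF M(1), of ?U "1 / m"] m by auto
    then have "measure M ?U < measure M C + 1 / m"
      by (simp add: M.emeasure_eq_measure ennreal_plus[symmetric] ennreal_less_iff del: ennreal_plus)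
    with C show ?thesis by (intro exI[of _ C]) auto
  qed
  then obtain C where C: "\<And>k. compact (C k)" "\<And>k. C k \<subseteq> {s. real (Suc k) * e < ?\<phi> s}"
    "\<And>k. measure M {s. real (Suc k) * e < ?\<phi> s} \<le> measure M (C k) + 1 / m" by metis
  have "\<exists>D. D \<in> sets (M \<Otimes>\<^sub>M N) \<and> D \<subseteq> E \<and> (\<forall>s\<in>C k. real (Suc k) * e \<le> measure N (Pair s -` D))"
    for k
  proof -
    have "\<exists>B K. s \<in> B \<and> open B \<and> compact K \<and> B \<times> K \<subseteq> E \<and> real (Suc k) * e < measure N K"
      if "s \<in> C k" for s
    proof -
      have "ennreal (real (Suc k) * e) < emeasure N (Pair s -` E)"
        using C(2)[of k] that e by (auto simp: N.emeasure_eq_measure ennreal_less_iff)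
      then obtain K where K: "compact K" "K \<subseteq> Pair s -` E" "ennreal (real (Suc k) * e) < emeasure N K"
        using inner_regular_on_open_less[OF N(1) open_vimage_Pair(1)[OF E]] by metis
      obtain B where "s \<in> B" "open B" "B \<times> K \<subseteq> E"
        using tube_section[OF K(1) E K(2)] .
      with K show ?thesis using e by (auto simp: N.emeasure_eq_measure ennreal_less_iff)
    qed
    then obtain B K where BK: "\<And>s. s \<in> C k \<Longrightarrow> s \<in> B s \<and> open (B s) \<and> compact (K s) \<and>
        B s \<times> K s \<subseteq> E \<and> real (Suc k) * e < measure N (K s)" by metis
    obtain F where F: "F \<subseteq> C k" "finite F" "C k \<subseteq> (\<Union>s\<in>F. B s)"
      by (rule compactE_image[OF C(1)[of k], of "C k" B]) (use BK in auto)
    let ?D = "\<Union>s\<in>F. B s \<times> K s"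
    have D: "?D \<in> sets (M \<Otimes>\<^sub>M N)"
      using F BK by (intro sets.finite_UN pair_measureI) (auto intro: borel_compact)
    have "real (Suc k) * e \<le> measure N (Pair s -` ?D)" if sC: "s \<in> C k" for s
    proof -
      obtain s' where s': "s' \<in> F" "s \<in> B s'" using F sC by auto
      have "measure N (K s') \<le> measure N (Pair s -` ?D)"
        using s' D sets_Pair1[OF D, of s] by (intro N.finite_measure_mono) auto
      then show ?thesis using BK[of s'] s' F by force
    qed
    with D BK F show ?thesis by (intro exI[of _ ?D]) auto
  qed
  then obtain D where D: "\<And>k. D k \<in> sets (M \<Otimes>\<^sub>M N)" "\<And>k. D k \<subseteq> E"
    "\<And>k s. s \<in> C k \<Longrightarrow> real (Suc k) * e \<le> measure N (Pair s -` D k)"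
    by metis
  define R where "R = (\<Union>k<m. D k)"
  have R[measurable]: "R \<in> sets (M \<Otimes>\<^sub>M N)" and RE: "R \<subseteq> E"
    using D(1,2) by (auto simp: R_def)
  have R_ge: "real (Suc k) * e \<le> measure N (Pair s -` R)" if "k < m" "s \<in> C k" for k s
  proof -
    have "measure N (Pair s -` D k) \<le> measure N (Pair s -` R)"
      using that sets_Pair1[OF R, of s] by (intro N.finite_measure_mono) (auto simp: R_def)
    with D(3)[OF that(2)] show ?thesis by linarith
  qed
  have Cb[measurable]: "C k \<in> sets borel" for k using C(1) by (simp add: borel_compact)
  have Ub[measurable]: "{s. real (Suc k) * e < ?\<phi> s} \<in> sets borel" for k
    using op[of "real (Suc k) * e"] e by (intro borel_open) auto
  have int_sum: "integrable M (\<lambda>s. \<Sum>k<m. e * indicator (A k) s)"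
    "(\<integral>s. (\<Sum>k<m. e * indicator (A k) s) \<partial>M) = (\<Sum>k<m. e * measure M (A k))"
    if "\<And>k. A k \<in> sets borel" for A
  proof -
    have i: "integrable M (\<lambda>s. e * indicator (A k) s)" for k
      using that by (intro integrable_mult_right integrable_real_indicator)
        (auto simp: M.emeasure_eq_measure)
    show "integrable M (\<lambda>s. \<Sum>k<m. e * indicator (A k) s)"
      by (rule Bochner_Integration.integrable_sum) (rule i)
    have "(\<integral>s. (\<Sum>k<m. e * indicator (A k) s) \<partial>M) = (\<Sum>k<m. \<integral>s. e * indicator (A k) s \<partial>M)"
      by (rule Bochner_Integration.integral_sum) (rule i)
    then show "(\<integral>s. (\<Sum>k<m. e * indicator (A k) s) \<partial>M) = (\<Sum>k<m. e * measure M (A k))"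
      by simp
  qed
  have "?L \<le> (\<integral>\<^sup>+s. ennreal (e + (\<Sum>k<m. if ?\<phi> s > real (Suc k) * e then e else 0)) \<partial>M)"
  proof (rule nn_integral_mono)
    fix s
    have "?\<phi> s \<le> e + (\<Sum>k<m. if ?\<phi> s > real (Suc k) * e then e else 0)"
      using layer_sum_upper[of e "?\<phi> s" m] \<phi>_le[of s] e
      by (auto simp: min_def algebra_simps split: if_splits)
    then show "emeasure N (Pair s -` E) \<le> ennreal (e + (\<Sum>k<m. if ?\<phi> s > real (Suc k) * e then e else 0))"
      by (simp add: N.emeasure_eq_measure ennreal_leI)
  qed
  also have "\<dots> = ennreal (\<integral>s. e + (\<Sum>k<m. e * indicator {s. real (Suc k) * e < ?\<phi> s} s) \<partial>M)"
  proof (subst nn_integral_eq_integral[symmetric])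
    show "integrable M (\<lambda>s. e + (\<Sum>k<m. e * indicator {s. real (Suc k) * e < ?\<phi> s} s))"
      using Ub by (intro Bochner_Integration.integrable_add M.integrable_const int_sum)
    have "(if ?\<phi> s > real (Suc k) * e then e else 0) = e * indicator {s. real (Suc k) * e < ?\<phi> s} s"
      for s k by (simp add: indicator_def)
    then show "(\<integral>\<^sup>+s. ennreal (e + (\<Sum>k<m. if ?\<phi> s > real (Suc k) * e then e else 0)) \<partial>M) =
        (\<integral>\<^sup>+s. ennreal (e + (\<Sum>k<m. e * indicator {s. real (Suc k) * e < ?\<phi> s} s)) \<partial>M)"
      by simp
  qed (use e in \<open>auto intro!: add_nonneg_nonneg sum_nonneg\<close>)
  also have "(\<integral>s. e + (\<Sum>k<m. e * indicator {s. real (Suc k) * e < ?\<phi> s} s) \<partial>M) =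
      e * measure M UNIV + (\<Sum>k<m. e * measure M {s. real (Suc k) * e < ?\<phi> s})"
    unfolding Bochner_Integration.integral_add[OF M.integrable_const int_sum(1)[OF Ub]]
      int_sum(2)[OF Ub] by (simp add: mult.commute)
  also have "\<dots> \<le> e * measure M UNIV + (\<Sum>k<m. e * (measure M (C k) + 1 / m))"
    using C(3) e by (intro add_mono sum_mono mult_left_mono) auto
  also have "\<dots> = e' + (\<Sum>k<m. e * measure M (C k))"
  proof -
    have "e * measure M UNIV + e = e * (measure M UNIV + 1)" by (simp add: algebra_simps)
    also have "\<dots> = e'" by (simp add: e_def add_nonneg_pos less_imp_neq[symmetric])
    finally show ?thesis using m by (simp add: algebra_simps sum.distrib)
  qed
  also have "(\<Sum>k<m. e * measure M (C k)) = (\<integral>s. (\<Sum>k<m. e * indicator (C k) s) \<partial>M)"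
    by (rule int_sum(2)[OF Cb, symmetric])
  also have "\<dots> \<le> (\<integral>s. measure N (Pair s -` R) \<partial>M)"
  proof (rule integral_mono)
    show "integrable M (\<lambda>s. measure N (Pair s -` R))"
    proof (rule M.integrable_const_bound[where B="measure N UNIV"])
      have "(\<lambda>s. emeasure N (Pair s -` R)) \<in> borel_measurable M" by measurable
      then show "(\<lambda>s. measure N (Pair s -` R)) \<in> borel_measurable M"
        unfolding measure_def by measurable
    qed (use N.bounded_measure in auto)
    have "(\<Sum>k<m. e * indicator (C k) s) = (\<Sum>k<m. if s \<in> C k then e else 0)" for s
      by (intro sum.cong) (auto simp: indicator_def)
    moreover have "(\<Sum>k<m. if s \<in> C k then e else 0) \<le> measure N (Pair s -` R)" for s
      using e R_ge by (intro layer_sum_lower) auto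
    ultimately show "(\<Sum>k<m. e * indicator (C k) s) \<le> measure N (Pair s -` R)" for s
      by (rule ord_eq_le_trans)
  qed (rule int_sum(1)[OF Cb])
  also have "ennreal (e' + (\<integral>s. measure N (Pair s -` R) \<partial>M)) =
      ennreal e' + (\<integral>\<^sup>+s. emeasure N (Pair s -` R) \<partial>M)"
  proof -
    have "(\<lambda>s. emeasure N (Pair s -` R)) \<in> borel_measurable M" by measurable
    then have m: "(\<lambda>s. measure N (Pair s -` R)) \<in> borel_measurable M"
      unfolding measure_def by measurable
    have "integrable M (\<lambda>s. measure N (Pair s -` R))"
      by (rule M.integrable_const_bound[where B="measure N UNIV"]) (use N.bounded_measure m in auto)
    then show ?thesis
      using e' by (simp add: nn_integral_eq_integral N.emeasure_eq_measure)
  qed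
  \<comment> \<open>\<open>R\<close> lies in the product sigma-algebra, so the classical theorem
    interchanges the integrals here.\<close>
  also have "(\<integral>\<^sup>+s. emeasure N (Pair s -` R) \<partial>M) = (\<integral>\<^sup>+t. emeasure M ((\<lambda>s. (s, t)) -` R) \<partial>N)"
    using R by (simp add: N.emeasure_pair_measure_alt[symmetric] emeasure_pair_measure_alt2)
  also have "\<dots> \<le> ?R"
    using RE open_vimage_Pair(2)[OF E] by (intro nn_integral_mono emeasure_mono) auto
  finally show "?L \<le> ?R + ennreal e'" by (simp add: add.commute e' ennreal_leI)
qed

lemma measure_sections_open:
  fixes E :: "('a::t2_space \<times> 'b::t2_space) set"
  assumes M: "inner_regular_on_open M" "finite_measure M"
    and N: "inner_regular_on_open N" "finite_measure N" and E: "open E"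
  shows "(\<integral>\<^sup>+s. emeasure N (Pair s -` E) \<partial>M) = (\<integral>\<^sup>+t. emeasure M ((\<lambda>s. (s, t)) -` E) \<partial>N)"
proof (rule antisym[OF measure_sections_open_le[OF assms]])
  have o: "open (prod.swap -` E :: ('b \<times> 'a) set)"
    using E by (intro open_vimage) (auto simp: prod.swap_def intro!: continuous_intros)
  have [simp]: "Pair t -` prod.swap -` E = (\<lambda>s. (s, t)) -` E"
    "(\<lambda>t. (t, s)) -` prod.swap -` E = Pair s -` E" for s t by auto
  show "(\<integral>\<^sup>+t. emeasure M ((\<lambda>s. (s, t)) -` E) \<partial>N) \<le> (\<integral>\<^sup>+s. emeasure N (Pair s -` E) \<partial>M)"
    using measure_sections_open_le[OF N M o] by simp
qed

section \<open>From open sets to Borel sets\<close>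

text \<open>Dynkin's argument, started from the open sets as an intersection-stable generator of the
  Borel sets. Finiteness of \<open>N\<close> allows passing to complements.\<close>

lemma measurable_section_measure:
  fixes E :: "('a::topological_space \<times> 'b::t2_space) set"
  assumes N: "inner_regular_on_open N" "finite_measure N" and E: "E \<in> sets borel"
  shows "(\<lambda>s. emeasure N (Pair s -` E)) \<in> borel_measurable borel"
proof -
  interpret N: finite_measure N by fact
  have sN: "sets N = sets borel" using N by (simp add: inner_regular_on_open_def)
  note sec = vimage_Pair_in_borel(1)
  have "Int_stable {S :: ('a \<times> 'b) set. open S}" by (auto simp: Int_stable_def)
  moreover have "{S :: ('a \<times> 'b) set. open S} \<subseteq> Pow UNIV" by simp
  moreover have "E \<in> sigma_sets UNIV {S. open S}" using E by (simp add: borel_def)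
  ultimately show ?thesis
  proof (induction E rule: sigma_sets_induct_disjoint)
    case (basic A)
    then show ?case
      using open_section_measure_gt[OF N(1)]
      by (intro borel_measurableI_greater) (auto intro!: borel_open)
  next
    case (compl A)
    then have A: "A \<in> sets borel" by (simp add: borel_def)
    have "emeasure N (Pair s -` (UNIV - A)) = emeasure N UNIV - emeasure N (Pair s -` A)" for s
      using sec[OF A, of s] sN sets_eq_imp_space_eq[OF sN]
      by (subst emeasure_Diff[symmetric]) (auto simp: vimage_Diff)
    with compl show ?case by simp
  next
    case (union A)
    then have A: "A i \<in> sets borel" for i by (auto simp: borel_def)
    have "emeasure N (Pair s -` (\<Union>i. A i)) = (\<Sum>i. emeasure N (Pair s -` A i))" for s
      using sec[OF A] union(1) sN
      by (subst suminf_emeasure) (auto simp: vimage_UN disjoint_family_on_def, blast)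
    with union show ?case by simp
  qed auto
qed

lemma measure_sections_borel:
  fixes E :: "('a::t2_space \<times> 'b::t2_space) set"
  assumes M: "inner_regular_on_open M" "finite_measure M"
    and N: "inner_regular_on_open N" "finite_measure N" and E: "E \<in> sets borel"
  shows "(\<integral>\<^sup>+s. emeasure N (Pair s -` E) \<partial>M) = (\<integral>\<^sup>+t. emeasure M ((\<lambda>s. (s, t)) -` E) \<partial>N)"
proof -
  interpret M: finite_measure M by fact
  interpret N: finite_measure N by fact
  have sM[measurable_cong]: "sets M = sets borel" and sN[measurable_cong]: "sets N = sets borel"
    using M N by (auto simp: inner_regular_on_open_def)
  have sp: "space M = UNIV" "space N = UNIV"
    using sets_eq_imp_space_eq[OF sM] sets_eq_imp_space_eq[OF sN] by auto
  note sec = vimage_Pair_in_borel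
  have mN[measurable]: "(\<lambda>s. emeasure N (Pair s -` A)) \<in> borel_measurable borel"
    if "A \<in> sets (borel :: ('a \<times> 'b) measure)" for A
    using measurable_section_measure[OF N that] .
  have mM[measurable]: "(\<lambda>t. emeasure M ((\<lambda>s. (s, t)) -` A)) \<in> borel_measurable borel"
    if A: "A \<in> sets (borel :: ('a \<times> 'b) measure)" for A
  proof -
    have "prod.swap -` A \<in> sets (borel :: ('b \<times> 'a) measure)"
      using measurable_sets[OF prod_swap_borel A] by simp
    from measurable_section_measure[OF M this] show ?thesis
      by (simp add: vimage_def)
  qed
  have "Int_stable {S :: ('a \<times> 'b) set. open S}" by (auto simp: Int_stable_def)
  moreover have "{S :: ('a \<times> 'b) set. open S} \<subseteq> Pow UNIV" by simp
  moreover have "E \<in> sigma_sets UNIV {S. open S}" using E by (simp add: borel_def)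
  ultimately show ?thesis
  proof (induction E rule: sigma_sets_induct_disjoint)
    case (basic A)
    then show ?case using measure_sections_open[OF M N] by simp
  next
    case (compl A)
    then have A[measurable]: "A \<in> sets borel" by (simp add: borel_def)
    have 1: "emeasure N (Pair s -` (UNIV - A)) = emeasure N UNIV - emeasure N (Pair s -` A)" for s
      using sec(1)[OF A, of s] sN sp by (subst emeasure_Diff[symmetric]) (auto simp: vimage_Diff)
    have 2: "emeasure M ((\<lambda>s. (s, t)) -` (UNIV - A)) = emeasure M UNIV - emeasure M ((\<lambda>s. (s, t)) -` A)" for t
      using sec(2)[OF A, of t] sM sp by (subst emeasure_Diff[symmetric]) (auto simp: vimage_Diff)
    \<comment> \<open>Subtraction of integrals in \<open>ennreal\<close> requires the subtracted one
      to be finite; the induction hypothesis carries this over to the other order of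
      integration.\<close>
    have fin: "(\<integral>\<^sup>+s. emeasure N (Pair s -` A) \<partial>M) \<noteq> \<infinity>"
    proof -
      have "(\<integral>\<^sup>+s. emeasure N (Pair s -` A) \<partial>M) \<le> (\<integral>\<^sup>+s. emeasure N UNIV \<partial>M)"
        using sN by (intro nn_integral_mono emeasure_mono) auto
      also have "\<dots> < \<infinity>"
        by (simp add: ennreal_mult_less_top M.emeasure_eq_measure N.emeasure_eq_measure)
      finally show ?thesis by simp
    qed
    have "(\<integral>\<^sup>+s. emeasure N (Pair s -` (UNIV - A)) \<partial>M)
        = emeasure N UNIV * emeasure M UNIV - (\<integral>\<^sup>+s. emeasure N (Pair s -` A) \<partial>M)"
      unfolding 1 using fin sN sp
      by (subst nn_integral_diff) (auto intro!: emeasure_mono)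
    also have "\<dots> = (\<integral>\<^sup>+t. emeasure M ((\<lambda>s. (s, t)) -` (UNIV - A)) \<partial>N)"
      unfolding 2 using fin sM sp compl(2)
      by (subst nn_integral_diff) (auto intro!: emeasure_mono simp: mult.commute)
    finally show ?case .
  next
    case (union A)
    then have A[measurable]: "A i \<in> sets borel" for i by (auto simp: borel_def)
    have 1: "emeasure N (Pair s -` (\<Union>i. A i)) = (\<Sum>i. emeasure N (Pair s -` A i))" for s
      using sec(1)[OF A] union(1) sN
      by (subst suminf_emeasure) (auto simp: vimage_UN disjoint_family_on_def, blast)
    have 2: "emeasure M ((\<lambda>s. (s, t)) -` (\<Union>i. A i)) = (\<Sum>i. emeasure M ((\<lambda>s. (s, t)) -` A i))" for t
      using sec(2)[OF A] union(1) sM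
      by (subst suminf_emeasure) (auto simp: vimage_UN disjoint_family_on_def, blast)
    show ?case
      unfolding 1 2 by (subst (1 2) nn_integral_suminf) (auto simp: union.IH)
  qed auto
qed

section \<open>From Borel sets to nonnegative Borel functions\<close>

lemma borel_measurable_Pair:
  assumes "f \<in> borel_measurable (borel :: ('a::topological_space \<times> 'b::topological_space) measure)"
  shows "(\<lambda>t. f (s, t)) \<in> borel_measurable borel" "(\<lambda>s. f (s, t)) \<in> borel_measurable borel"
proof -
  have "Pair s \<in> borel \<rightarrow>\<^sub>M (borel :: ('a \<times> 'b) measure)"
    "(\<lambda>s. (s, t)) \<in> borel \<rightarrow>\<^sub>M (borel :: ('a \<times> 'b) measure)"
    by (intro borel_measurable_continuous_onI continuous_intros)+
  from measurable_compose[OF this(1) assms] measurable_compose[OF this(2) assms]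
  show "(\<lambda>t. f (s, t)) \<in> borel_measurable borel" "(\<lambda>s. f (s, t)) \<in> borel_measurable borel" .
qed

lemma nn_integral_section_indicator:
  fixes A :: "('a::topological_space \<times> 'b::topological_space) set"
  assumes "A \<in> sets borel"
  shows "sets N = sets borel \<Longrightarrow> (\<integral>\<^sup>+t. indicator A (s, t) \<partial>N) = emeasure N (Pair s -` A)"
    and "sets M = sets borel \<Longrightarrow> (\<integral>\<^sup>+s. indicator A (s, t) \<partial>M) = emeasure M ((\<lambda>s. (s, t)) -` A)"
proof -
  have 1: "indicator A (s, t) = (indicator (Pair s -` A) t :: ennreal)"
    and 2: "indicator A (s, t) = (indicator ((\<lambda>s. (s, t)) -` A) s :: ennreal)" for s t
    by (auto simp: indicator_def)
  show "sets N = sets borel \<Longrightarrow> (\<integral>\<^sup>+t. indicator A (s, t) \<partial>N) = emeasure N (Pair s -` A)"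
    unfolding 1 using vimage_Pair_in_borel[OF assms] by (simp add: nn_integral_indicator)
  show "sets M = sets borel \<Longrightarrow> (\<integral>\<^sup>+s. indicator A (s, t) \<partial>M) = emeasure M ((\<lambda>s. (s, t)) -` A)"
    unfolding 2 using vimage_Pair_in_borel[OF assms] by (simp add: nn_integral_indicator)
qed

lemma borel_measurable_nn_integral_section:
  fixes f :: "'a::topological_space \<times> 'b::t2_space \<Rightarrow> ennreal"
  assumes N: "inner_regular_on_open N" "finite_measure N" and f: "f \<in> borel_measurable borel"
  shows "(\<lambda>s. \<integral>\<^sup>+t. f (s, t) \<partial>N) \<in> borel_measurable borel"
proof -
  have sN[measurable_cong]: "sets N = sets borel" using N by (simp add: inner_regular_on_open_def)
  note [measurable] = borel_measurable_Pair(1)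
  show ?thesis
    using f
  proof (induction f rule: borel_measurable_induct)
    case (cong f g)
    then show ?case by (simp cong: measurable_cong)
  next
    case (set A)
    have "(\<integral>\<^sup>+t. indicator A (s, t) \<partial>N) = emeasure N (Pair s -` A)" for s
      using nn_integral_section_indicator(1)[OF set sN] .
    with measurable_section_measure[OF N set] show ?case by simp
  next
    case (mult u c)
    then show ?case by (simp add: nn_integral_cmult)
  next
    case (add u v)
    then show ?case by (simp add: nn_integral_add)
  next
    case (seq U)
    have "(\<integral>\<^sup>+t. (SUP i. U i) (s, t) \<partial>N) = (SUP i. \<integral>\<^sup>+t. U i (s, t) \<partial>N)" for s
      using seq by (subst nn_integral_monotone_convergence_SUP[symmetric])
        (auto simp: incseq_def le_fun_def image_comp)
    with seq show ?case by simp
  qed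
qed

lemma nn_integral_sections_swap:
  fixes f :: "'a::t2_space \<times> 'b::t2_space \<Rightarrow> ennreal"
  assumes M: "inner_regular_on_open M" "finite_measure M"
    and N: "inner_regular_on_open N" "finite_measure N" and f: "f \<in> borel_measurable borel"
  shows "(\<integral>\<^sup>+s. \<integral>\<^sup>+t. f (s, t) \<partial>N \<partial>M) = (\<integral>\<^sup>+t. \<integral>\<^sup>+s. f (s, t) \<partial>M \<partial>N)"
proof -
  have sM[measurable_cong]: "sets M = sets borel" and sN[measurable_cong]: "sets N = sets borel"
    using M N by (auto simp: inner_regular_on_open_def)
  note [measurable] = borel_measurable_Pair
  have [measurable]: "(\<lambda>s. \<integral>\<^sup>+t. g (s, t) \<partial>N) \<in> borel_measurable borel"
    "(\<lambda>t. \<integral>\<^sup>+s. g (s, t) \<partial>M) \<in> borel_measurable borel"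
    if g: "g \<in> borel_measurable (borel :: ('a \<times> 'b) measure)" for g :: "'a \<times> 'b \<Rightarrow> ennreal"
    using borel_measurable_nn_integral_section[OF N g]
      borel_measurable_nn_integral_section[OF M measurable_compose[OF prod_swap_borel g]]
    by simp_all
  show ?thesis
    using f
  proof (induction f rule: borel_measurable_induct)
    case (cong f g)
    then show ?case by simp
  next
    case (set A)
    have "(\<integral>\<^sup>+t. indicator A (s, t) \<partial>N) = emeasure N (Pair s -` A)" for s
      using nn_integral_section_indicator(1)[OF set sN] .
    moreover have "(\<integral>\<^sup>+s. indicator A (s, t) \<partial>M) = emeasure M ((\<lambda>s. (s, t)) -` A)" for t
      using nn_integral_section_indicator(2)[OF set sM] .
    ultimately show ?case using measure_sections_borel[OF M N set] by simp
  next
    case (mult u c)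
    then show ?case by (simp add: nn_integral_cmult)
  next
    case (add u v)
    then show ?case by (simp add: nn_integral_add)
  next
    case (seq U)
    have "(\<integral>\<^sup>+t. (SUP i. U i) (s, t) \<partial>N) = (SUP i. \<integral>\<^sup>+t. U i (s, t) \<partial>N)" for s
      using seq by (subst nn_integral_monotone_convergence_SUP[symmetric])
        (auto simp: incseq_def le_fun_def image_comp)
    moreover have "(\<integral>\<^sup>+s. (SUP i. U i) (s, t) \<partial>M) = (SUP i. \<integral>\<^sup>+s. U i (s, t) \<partial>M)" for t
      using seq by (subst nn_integral_monotone_convergence_SUP[symmetric])
        (auto simp: incseq_def le_fun_def image_comp)
    moreover have "(\<integral>\<^sup>+s. (SUP i. \<integral>\<^sup>+t. U i (s, t) \<partial>N) \<partial>M) = (SUP i. \<integral>\<^sup>+s. \<integral>\<^sup>+t. U i (s, t) \<partial>N \<partial>M)"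
      using seq by (intro nn_integral_monotone_convergence_SUP)
        (auto simp: incseq_def le_fun_def intro!: nn_integral_mono)
    moreover have "(\<integral>\<^sup>+t. (SUP i. \<integral>\<^sup>+s. U i (s, t) \<partial>M) \<partial>N) = (SUP i. \<integral>\<^sup>+t. \<integral>\<^sup>+s. U i (s, t) \<partial>M \<partial>N)"
      using seq by (intro nn_integral_monotone_convergence_SUP)
        (auto simp: incseq_def le_fun_def intro!: nn_integral_mono)
    ultimately show ?case using seq by simp
  qed
qed

section \<open>Sets covered by countably many compact sets\<close>

text \<open>Containment in a sigma-compact set, rather than sigma-compactness, so that the property
  passes to arbitrary subsets; supports \<open>{x. f x \<noteq> 0}\<close> are the main
  instances.\<close>

definition sigma_bounded :: "'a::topological_space set \<Rightarrow> bool" where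
  "sigma_bounded A \<longleftrightarrow> (\<exists>\<K>. countable \<K> \<and> (\<forall>K\<in>\<K>. compact K) \<and> A \<subseteq> \<Union>\<K>)"

lemma sigma_bounded_subset: "sigma_bounded B \<Longrightarrow> A \<subseteq> B \<Longrightarrow> sigma_bounded A"
  unfolding sigma_bounded_def by (meson subset_trans)

lemma sigma_bounded_compact: "compact K \<Longrightarrow> sigma_bounded K"
  unfolding sigma_bounded_def by (rule exI[of _ "{K}"]) auto

lemma sigma_bounded_UN:
  assumes "countable I" "\<And>i. i \<in> I \<Longrightarrow> sigma_bounded (A i)"
  shows "sigma_bounded (\<Union>i\<in>I. A i)"
proof -
  from assms(2) obtain \<K> where
    "\<And>i. i \<in> I \<Longrightarrow> countable (\<K> i) \<and> (\<forall>K\<in>\<K> i. compact K) \<and> A i \<subseteq> \<Union>(\<K> i)"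
    unfolding sigma_bounded_def by metis
  with assms(1) show ?thesis
    unfolding sigma_bounded_def by (intro exI[of _ "\<Union>i\<in>I. \<K> i"]) fastforce
qed

lemma sigma_bounded_Un: "sigma_bounded A \<Longrightarrow> sigma_bounded B \<Longrightarrow> sigma_bounded (A \<union> B)"
  using sigma_bounded_UN[of "{A, B}" "\<lambda>X. X"] by auto

lemma sigma_bounded_continuous_image2:
  assumes "sigma_bounded A" "sigma_bounded B" "continuous_on UNIV (\<lambda>z. f (fst z) (snd z))"
  shows "sigma_bounded {f a b |a b. a \<in> A \<and> b \<in> B}"
proof -
  obtain \<K> where K: "countable \<K>" "\<forall>K\<in>\<K>. compact K" "A \<subseteq> \<Union>\<K>"
    using assms(1) unfolding sigma_bounded_def by blast
  obtain \<L> where L: "countable \<L>" "\<forall>L\<in>\<L>. compact L" "B \<subseteq> \<Union>\<L>"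
    using assms(2) unfolding sigma_bounded_def by blast
  let ?C = "\<lambda>(K, L). (\<lambda>z. f (fst z) (snd z)) ` (K \<times> L)"
  have "compact (?C KL)" if "KL \<in> \<K> \<times> \<L>" for KL
    using that K L by (auto intro!: compact_continuous_image continuous_on_subset[OF assms(3)] compact_Times)
  moreover have "{f a b |a b. a \<in> A \<and> b \<in> B} \<subseteq> \<Union>(?C ` (\<K> \<times> \<L>))"
    using K(3) L(3) by (auto simp: image_iff) (metis UnionE fst_conv snd_conv subsetD SigmaI)
  ultimately show ?thesis
    using K(1) L(1) unfolding sigma_bounded_def by (intro exI[of _ "?C ` (\<K> \<times> \<L>)"]) blast
qed

lemma sigma_bounded_continuous_image:
  assumes "sigma_bounded A" "continuous_on UNIV f"
  shows "sigma_bounded (f ` A)"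
proof -
  obtain \<K> where K: "countable \<K>" "\<forall>K\<in>\<K>. compact K" "A \<subseteq> \<Union>\<K>"
    using assms(1) unfolding sigma_bounded_def by blast
  then show ?thesis
    unfolding sigma_bounded_def
    by (intro exI[of _ "(`) f ` \<K>"])
      (fastforce intro!: compact_continuous_image continuous_on_subset[OF assms(2)])
qed

section \<open>Haar measure\<close>

lemma open_translation_group:
  fixes U :: "'g::topological_group_add set"
  assumes "open U" shows "open ((\<lambda>x. a + x) ` U)"
proof -
  have "(\<lambda>x. a + x) ` U = (\<lambda>x. - a + x) -` U"
    by (auto simp: image_iff add.assoc[symmetric] intro!: bexI[of _ "- a + _"])
  then show ?thesis using assms by (auto intro!: open_vimage continuous_intros)
qed

locale haar_measure =
  fixes M :: "'g::{topological_group_add,t2_space} measure"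
  assumes locally_compact: "locally_compact_space (euclidean :: 'g topology)"
    and haar: "left_haar_measure M"
begin

lemma sets_M[simp, measurable_cong]: "sets M = sets borel"
  by (rule haar[unfolded left_haar_measure_def, THEN conjunct1])

lemma space_M[simp]: "space M = UNIV"
  using sets_eq_imp_space_eq[OF sets_M] by simp

lemma measurable_M[simp]: "borel_measurable M = borel_measurable borel"
  by (simp cong: measurable_cong_sets)

lemma emeasure_compact_less_top: "compact K \<Longrightarrow> emeasure M K < \<infinity>"
  by (rule haar[unfolded left_haar_measure_def, THEN conjunct2, THEN conjunct2, THEN conjunct1, rule_format])

lemma inner_regular: "inner_regular_on_open M"
  unfolding inner_regular_on_open_def
  by (rule conjI[OF sets_M haar[unfolded left_haar_measure_def, THEN conjunct2, THEN conjunct2, THEN conjunct2, THEN conjunct2, THEN conjunct1]])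

lemma emeasure_translate_image: "A \<in> sets borel \<Longrightarrow> emeasure M ((\<lambda>x. a + x) ` A) = emeasure M A"
  by (rule haar[unfolded left_haar_measure_def, THEN conjunct2, THEN conjunct2, THEN conjunct2, THEN conjunct2, THEN conjunct2, rule_format])

lemma emeasure_UNIV_pos: "0 < emeasure M UNIV"
  unfolding zero_less_iff_neq_zero by (rule haar[unfolded left_haar_measure_def, THEN conjunct2, THEN conjunct1])

lemma outer_regular:
  "A \<in> sets borel \<Longrightarrow> emeasure M A = (INF U\<in>{U. open U \<and> A \<subseteq> U}. emeasure M U)"
  by (rule haar[unfolded left_haar_measure_def, THEN conjunct2, THEN conjunct2, THEN conjunct2, THEN conjunct1, rule_format])

lemma outer_regular_less:
  assumes "A \<in> sets borel" "emeasure M A < c"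
  obtains U where "open U" "A \<subseteq> U" "emeasure M U < c"
proof -
  have "(INF U\<in>{U. open U \<and> A \<subseteq> U}. emeasure M U) < c"
    using outer_regular[OF assms(1)] assms(2) by simp
  with that show ?thesis by (auto simp: INF_less_iff)
qed

lemma borel_measurable_add_left[measurable]: "(\<lambda>x. a + x) \<in> borel_measurable (borel :: 'g measure)"
  by (intro borel_measurable_continuous_onI continuous_intros)

lemma distr_translate: "distr M borel (\<lambda>x. a + x) = M"
proof (rule measure_eqI)
  fix A assume "A \<in> sets (distr M borel (\<lambda>x. a + x))"
  then have A[measurable]: "A \<in> sets borel" by simp
  have "(\<lambda>x. a + x) -` A = (\<lambda>x. - a + x) ` A"
    by (auto simp: image_iff add.assoc[symmetric] intro!: bexI[of _ "a + _"])
  moreover have "emeasure (distr M borel (\<lambda>x. a + x)) A = emeasure M ((\<lambda>x. a + x) -` A)"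
    by (subst emeasure_distr) simp_all
  ultimately show "emeasure (distr M borel (\<lambda>x. a + x)) A = emeasure M A"
    by (simp only: emeasure_translate_image[OF A])
qed simp

lemma nn_integral_translate:
  assumes [measurable]: "f \<in> borel_measurable borel"
  shows "(\<integral>\<^sup>+x. f (a + x) \<partial>M) = (\<integral>\<^sup>+x. f x \<partial>M)"
proof -
  have "(\<integral>\<^sup>+x. f x \<partial>M) = (\<integral>\<^sup>+x. f x \<partial>distr M borel (\<lambda>x. a + x))"
    by (simp add: distr_translate)
  then show ?thesis by (simp add: nn_integral_distr)
qed

lemma AE_translate:
  assumes "AE x in M. P x" shows "AE x in M. P (a + x)"
proof -
  have "AE x in distr M borel (\<lambda>x. a + x). P x"
    unfolding distr_translate by fact
  then show ?thesis by (rule AE_distrD[rotated]) simp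
qed

lemma integral_translate:
  fixes f :: "'g \<Rightarrow> 'b::{banach, second_countable_topology}"
  assumes f: "f \<in> borel_measurable borel"
  shows "(LINT x|M. f (a + x)) = (LINT x|M. f x)"
proof -
  have "(LINT x|distr M borel (\<lambda>x. a + x). f x) = (LINT x|M. f (a + x))"
    by (rule integral_distr[OF _ f]) simp
  then show ?thesis by (simp only: distr_translate)
qed

lemma symmetric_compact_neighbourhood:
  obtains V W :: "'g set" where "compact V" "open W" "0 \<in> W" "W \<subseteq> V" "\<And>v. v \<in> V \<Longrightarrow> - v \<in> V"
proof -
  obtain U K :: "'g set" where UK: "open U" "compact K" "0 \<in> U" "U \<subseteq> K"
  proof -
    have "\<exists>U K :: 'g set. openin euclidean U \<and> compactin euclidean K \<and> 0 \<in> U \<and> U \<subseteq> K"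
      using locally_compact unfolding locally_compact_space_def by (rule bspec) simp
    then show thesis using that by auto
  qed
  show thesis
  proof
    show "compact (K \<union> uminus ` K)"
      using UK by (intro compact_Un compact_continuous_image continuous_intros)
  qed (use UK in \<open>auto intro: continuous_intros\<close>)
qed

section \<open>Open sets, and sets of finite measure\<close>

text \<open>Finitely many translates of \<open>U\<close> cover a given compact set. If
  \<open>U\<close> were null, all compact sets would be null, and by inner regularity so would be
  the whole group.\<close>

lemma emeasure_open_pos:
  assumes U: "open U" "U \<noteq> {}"
  shows "emeasure M U \<noteq> 0"
proof
  assume 0: "emeasure M U = 0"
  obtain x where x: "x \<in> U" using U by auto
  obtain K where K: "compact K" "0 < emeasure M K"
    using inner_regular_on_open_less[OF inner_regular open_UNIV emeasure_UNIV_pos] by metis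
  let ?U = "\<lambda>k. (\<lambda>y. k - x + y) ` U"
  have "k \<in> ?U k" for k
    using x by (auto simp: image_iff intro!: bexI[of _ x])
  then have cov: "K \<subseteq> (\<Union>k\<in>K. ?U k)" by auto
  obtain F where F: "F \<subseteq> K" "finite F" "K \<subseteq> (\<Union>k\<in>F. ?U k)"
  proof (rule compactE_image[OF K(1), of K ?U])
    show "open (?U k)" for k by (rule open_translation_group[OF U(1)])
  qed (use cov in auto)
  have "?U k \<in> null_sets M" for k
    using 0 U open_translation_group[OF U(1)] by (auto simp: emeasure_translate_image null_sets_def)
  then have "(\<Union>k\<in>F. ?U k) \<in> null_sets M"
    using F by (intro null_sets_UN' countable_finite) auto
  then have "emeasure M K = 0"
    using emeasure_mono[OF F(3), of M] by (metis le_zero_eq null_setsD1 null_setsD2)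
  with K show False by simp
qed

lemma sigma_bounded_sum: "sigma_bounded A \<Longrightarrow> sigma_bounded B \<Longrightarrow> sigma_bounded {a + b |a b. a \<in> A \<and> b \<in> (B :: 'g set)}"
  by (rule sigma_bounded_continuous_image2) (auto intro!: continuous_intros)

lemma sigma_bounded_uminus: "sigma_bounded A \<Longrightarrow> sigma_bounded (uminus ` (A :: 'g set))"
  by (rule sigma_bounded_continuous_image) (auto intro!: continuous_intros)

text \<open>The hull is the union of the sets \<open>A + V + ... + V\<close> for a symmetric compact
  neighbourhood \<open>V\<close> of 0, that is \<open>A + H\<close> for the open subgroup
  \<open>H\<close> generated by \<open>V\<close>. It is open because every point has a translate of
  \<open>W\<close> in the next set of the sequence; it is closed because, by symmetry of
  \<open>V\<close>, a point \<open>x\<close> for which \<open>x + W\<close> meets the union belongs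
  to it.\<close>

lemma sigma_bounded_clopen_hull:
  assumes "sigma_bounded (A :: 'g set)"
  obtains Q where "sigma_bounded Q" "open Q" "closed Q" "A \<subseteq> Q"
proof -
  obtain V W :: "'g set" where V: "compact V" "open W" "0 \<in> W" "W \<subseteq> V" "\<And>v. v \<in> V \<Longrightarrow> - v \<in> V"
    using symmetric_compact_neighbourhood by blast
  define q where "q n = ((\<lambda>B. {a + b |a b. a \<in> B \<and> b \<in> V}) ^^ n) A" for n
  have q: "q 0 = A" "q (Suc n) = {a + b |a b. a \<in> q n \<and> b \<in> V}" for n
    by (auto simp: q_def)
  have sb: "sigma_bounded (q n)" for n
  proof (induction n)
    case (Suc n)
    show ?case unfolding q by (rule sigma_bounded_sum[OF Suc sigma_bounded_compact[OF V(1)]])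
  qed (simp add: q assms)
  show thesis
  proof
    show "sigma_bounded (\<Union>n. q n)" using sb by (intro sigma_bounded_UN) auto
    show "A \<subseteq> (\<Union>n. q n)" using q(1) by auto
    show "open (\<Union>n. q n)"
    proof (subst open_subopen, safe)
      fix x n assume x: "x \<in> q n"
      have "(\<lambda>w. x + w) ` W \<subseteq> q (Suc n)" using x V by (auto simp: q)
      moreover have "x \<in> (\<lambda>w. x + w) ` W" using V by (auto simp: image_iff intro!: bexI[of _ 0])
      ultimately show "\<exists>T. open T \<and> x \<in> T \<and> T \<subseteq> (\<Union>n. q n)"
        using open_translation_group[OF V(2)] by blast
    qed
    show "closed (\<Union>n. q n)"
      unfolding closed_def
    proof (subst open_subopen, safe)
      fix x assume x: "x \<notin> (\<Union>n. q n)"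
      have "x + w \<notin> q n" if "w \<in> W" for w n
      proof
        assume "x + w \<in> q n"
        moreover have "- w \<in> V" using V that by auto
        ultimately have "(x + w) + - w \<in> q (Suc n)" unfolding q by blast
        with x show False by (auto simp: add.assoc)
      qed
      then have "(\<lambda>w. x + w) ` W \<subseteq> - (\<Union>n. q n)" by auto
      moreover have "x \<in> (\<lambda>w. x + w) ` W" using V by (auto simp: image_iff intro!: bexI[of _ 0])
      ultimately show "\<exists>T. open T \<and> x \<in> T \<and> T \<subseteq> - (\<Union>n. q n)"
        using open_translation_group[OF V(2)] by blast
    qed
  qed
qed

text \<open>An open set of finite measure has a sigma-compact subset of full measure. What it has outside the
  clopen hull of that subset is open and null, hence empty.\<close>

lemma finite_measure_imp_sigma_bounded:
  assumes A: "A \<in> sets borel" "emeasure M A < \<infinity>"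
  shows "sigma_bounded A"
proof -
  obtain U where U: "open U" "A \<subseteq> U" "emeasure M U < \<infinity>"
    using outer_regular_less[OF A] .
  have "\<exists>K. compact K \<and> K \<subseteq> U \<and> emeasure M U < emeasure M K + ennreal (1 / real (Suc n))" for n
    using inner_regular_on_open_approx[OF inner_regular U(1), of "1 / real (Suc n)"] U(3)
    by (metis less_irrefl of_nat_0_less_iff zero_less_Suc zero_less_divide_1_iff)
  then obtain K where K: "\<And>n. compact (K n)" "\<And>n. K n \<subseteq> U"
    "\<And>n. emeasure M U < emeasure M (K n) + ennreal (1 / real (Suc n))" by metis
  have "sigma_bounded (\<Union>n. K n)" by (intro sigma_bounded_UN sigma_bounded_compact K) auto
  then obtain Q where Q: "sigma_bounded Q" "open Q" "closed Q" "(\<Union>n. K n) \<subseteq> Q"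
    by (rule sigma_bounded_clopen_hull)
  have "emeasure M (U - Q) \<le> ennreal (1 / real (Suc n))" for n
  proof -
    have "emeasure M (U - Q) \<le> emeasure M (U - K n)"
      using Q U K(1)[of n] by (intro emeasure_mono) (auto simp: borel_compact)
    also have "\<dots> = emeasure M U - emeasure M (K n)"
      using emeasure_compact_less_top[OF K(1)[of n]] K(1,2)[of n] U
      by (intro emeasure_Diff) (auto simp: borel_compact)
    also have "\<dots> \<le> ennreal (1 / real (Suc n))"
      using K(3)[of n] emeasure_compact_less_top[OF K(1)[of n]]
      by (auto simp: ennreal_minus_le_iff order_less_imp_le)
    finally show ?thesis .
  qed
  moreover have "(\<lambda>n. ennreal (1 / real (Suc n))) \<longlonglongrightarrow> ennreal 0"
    using LIMSEQ_Suc[OF lim_1_over_n[where 'a=real]] by (intro tendsto_ennrealI) simp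
  ultimately have "emeasure M (U - Q) \<le> 0"
    by (intro LIMSEQ_le_const[of "\<lambda>n. ennreal (1 / real (Suc n))"]) auto
  moreover have "open (U - Q)" using U Q by auto
  ultimately have "U - Q = {}" using emeasure_open_pos[of "U - Q"] by auto
  with U(2) Q(1) show ?thesis by (auto intro: sigma_bounded_subset)
qed

text \<open>Compact sets have finite measure, hence open neighbourhoods of finite measure by outer
  regularity; finite unions make these increasing. They exhaust the part of the group that matters
  for a given integrand.\<close>

lemma sigma_bounded_open_cover:
  assumes "sigma_bounded A"
  obtains U :: "nat \<Rightarrow> 'g set"
  where "incseq U" "\<And>n. open (U n)" "\<And>n. emeasure M (U n) < \<infinity>" "A \<subseteq> (\<Union>n. U n)"
proof -
  obtain \<K> where K: "countable \<K>" "\<forall>K\<in>\<K>. compact K" "A \<subseteq> \<Union>\<K>"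
    using assms unfolding sigma_bounded_def by blast
  \<comment> \<open>The empty set is added because only a non-empty countable set is the range of
    its enumeration.\<close>
  define K' where "K' = from_nat_into (insert {} \<K>)"
  have K': "compact (K' n)" for n
    using K from_nat_into[of "insert {} \<K>" n] by (auto simp: K'_def)
  have cov: "A \<subseteq> (\<Union>n. K' n)"
    using K range_from_nat_into[of "insert {} \<K>"] by (auto simp: K'_def)
  have "\<exists>U. open U \<and> K' n \<subseteq> U \<and> emeasure M U < \<infinity>" for n
    using outer_regular_less[of "K' n" \<infinity>] K'[of n] emeasure_compact_less_top[of "K' n"]
    by (metis borel_compact)
  then obtain U where U: "\<And>n. open (U n)" "\<And>n. K' n \<subseteq> U n" "\<And>n. emeasure M (U n) < \<infinity>"
    by metis
  show thesis
  proof
    show "incseq (\<lambda>n. \<Union>i\<le>n. U i)" by (intro monoI UN_mono) auto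
    show "open (\<Union>i\<le>n. U i)" for n using U by auto
    show "A \<subseteq> (\<Union>n. \<Union>i\<le>n. U i)"
    proof
      fix x assume "x \<in> A"
      with cov obtain n where "x \<in> K' n" by auto
      with U(2) show "x \<in> (\<Union>n. \<Union>i\<le>n. U i)" by (intro UN_I[of n]) auto
    qed
    fix n
    have "emeasure M (\<Union>i\<le>n. U i) \<le> (\<Sum>i\<le>n. emeasure M (U i))"
      using U by (intro emeasure_subadditive_finite) auto
    also have "\<dots> < \<infinity>" using U(3) by simp
    finally show "emeasure M (\<Union>i\<le>n. U i) < \<infinity>" .
  qed
qed

section \<open>Tonelli's theorem for Haar measure\<close>

text \<open>For open \<open>V\<close> the set \<open>U \<inter> V\<close> is open again, so inner
  regularity of \<open>M\<close> supplies the compact sets inside it.\<close>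

lemma finite_inner_regular_restriction:
  assumes "open U" "emeasure M U < \<infinity>"
  shows "inner_regular_on_open (density M (indicator U))" "finite_measure (density M (indicator U))"
proof -
  have U: "U \<in> sets M" using assms by auto
  show "inner_regular_on_open (density M (indicator U))"
    unfolding inner_regular_on_open_def
  proof (intro conjI allI impI)
    fix V :: "'g set" assume V: "open V"
    have 1: "emeasure (density M (indicator U)) A = emeasure M (U \<inter> A)" if "A \<in> sets borel" for A
      using U that by (intro emeasure_restricted) auto
    show "emeasure (density M (indicator U)) V =
        (SUP K\<in>{K. compact K \<and> K \<subseteq> V}. emeasure (density M (indicator U)) K)"
    proof (rule antisym)
      have "emeasure (density M (indicator U)) V = (SUP K\<in>{K. compact K \<and> K \<subseteq> U \<inter> V}. emeasure M K)"
        using inner_regular V assms by (simp add: 1 inner_regular_on_open_def open_Int)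
      also have "\<dots> \<le> (SUP K\<in>{K. compact K \<and> K \<subseteq> V}. emeasure (density M (indicator U)) K)"
      proof (rule SUP_mono)
        fix K assume "K \<in> {K. compact K \<and> K \<subseteq> U \<inter> V}"
        moreover from this have "emeasure (density M (indicator U)) K = emeasure M K"
          by (subst 1) (auto simp: borel_compact Int_absorb1)
        ultimately show "\<exists>L\<in>{K. compact K \<and> K \<subseteq> V}. emeasure M K \<le> emeasure (density M (indicator U)) L"
          by (intro bexI[of _ K]) auto
      qed
      finally show "emeasure (density M (indicator U)) V \<le>
        (SUP K\<in>{K. compact K \<and> K \<subseteq> V}. emeasure (density M (indicator U)) K)" .
      show "(SUP K\<in>{K. compact K \<and> K \<subseteq> V}. emeasure (density M (indicator U)) K) \<le>
          emeasure (density M (indicator U)) V"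
        using V by (intro SUP_least emeasure_mono) auto
    qed
  qed simp
  show "finite_measure (density M (indicator U))"
    using assms U by (intro finite_measureI) (auto simp: emeasure_restricted)
qed

lemma SUP_indicator_mult:
  assumes "incseq U" "x \<notin> (\<Union>n. U n) \<Longrightarrow> c = 0"
  shows "(SUP n. indicator (U n) x * (c::ennreal)) = c"
proof (cases "x \<in> (\<Union>n. U n)")
  case True
  then obtain n where "x \<in> U n" by auto
  then show ?thesis
    by (intro antisym SUP_least SUP_upper2[of n]) (auto simp: indicator_def)
qed (use assms in auto)

lemma incseq_indicator_mult:
  assumes "incseq U"
  shows "incseq (\<lambda>n x. indicator (U n) x * (f x :: ennreal))"
proof (intro monoI le_funI mult_right_mono)
  fix m n :: nat and x assume "m \<le> n"
  from monoD[OF assms this] show "indicator (U m) x \<le> (indicator (U n) x :: ennreal)"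
    by (auto simp: indicator_def)
qed simp

text \<open>\<open>M\<close> need not be sigma-finite, but an integrand that vanishes for
  \<open>t\<close> outside a sigma-bounded set has as integral the increasing limit of its integrals
  over open sets of finite measure.\<close>

lemma borel_measurable_nn_integral_M:
  fixes F :: "'a::topological_space \<times> 'g \<Rightarrow> ennreal"
  assumes F[measurable]: "F \<in> borel_measurable borel"
    and A: "sigma_bounded A" "\<And>s t. t \<notin> A \<Longrightarrow> F (s, t) = 0"
  shows "(\<lambda>s. \<integral>\<^sup>+t. F (s, t) \<partial>M) \<in> borel_measurable borel"
proof -
  obtain U :: "nat \<Rightarrow> 'g set" where U: "incseq U" "\<And>n. open (U n)" "\<And>n. emeasure M (U n) < \<infinity>" "A \<subseteq> (\<Union>n. U n)"
    by (rule sigma_bounded_open_cover[OF A(1)], rule that)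
  note [measurable] = borel_measurable_Pair[OF F]
  have [measurable]: "U n \<in> sets borel" for n using U(2) by auto
  have "(\<integral>\<^sup>+t. F (s, t) \<partial>M) = (SUP n. \<integral>\<^sup>+t. F (s, t) \<partial>density M (indicator (U n)))" for s
  proof -
    have "(\<integral>\<^sup>+t. F (s, t) \<partial>M) = (\<integral>\<^sup>+t. (SUP n. indicator (U n) t * F (s, t)) \<partial>M)"
      by (intro nn_integral_cong SUP_indicator_mult[symmetric] U(1)) (rule A(2), use U(4) in blast)
    also have "\<dots> = (SUP n. \<integral>\<^sup>+t. indicator (U n) t * F (s, t) \<partial>M)"
      by (intro nn_integral_monotone_convergence_SUP incseq_indicator_mult U) simp
    finally show ?thesis by (simp add: nn_integral_density)
  qed
  moreover have "(\<lambda>s. \<integral>\<^sup>+t. F (s, t) \<partial>density M (indicator (U n))) \<in> borel_measurable borel" for n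
    using finite_inner_regular_restriction[OF U(2,3)] F by (intro borel_measurable_nn_integral_section)
  ultimately show ?thesis by simp
qed

text \<open>Both variables are confined to \<open>A \<union> B\<close>, which is covered by
  increasing open sets \<open>U n\<close> of finite measure. The finite case applies on each
  \<open>U n\<close>, and monotone convergence does the rest.\<close>

lemma tonelli:
  fixes F :: "'g \<times> 'g \<Rightarrow> ennreal"
  assumes F[measurable]: "F \<in> borel_measurable borel"
    and A: "sigma_bounded A" "\<And>s t. s \<notin> A \<Longrightarrow> F (s, t) = 0"
    and B: "sigma_bounded B" "\<And>s t. t \<notin> B \<Longrightarrow> F (s, t) = 0"
  shows "(\<integral>\<^sup>+s. \<integral>\<^sup>+t. F (s, t) \<partial>M \<partial>M) = (\<integral>\<^sup>+t. \<integral>\<^sup>+s. F (s, t) \<partial>M \<partial>M)"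
proof -
  obtain U :: "nat \<Rightarrow> 'g set" where U: "incseq U" "\<And>n. open (U n)" "\<And>n. emeasure M (U n) < \<infinity>" "A \<union> B \<subseteq> (\<Union>n. U n)"
    by (rule sigma_bounded_open_cover[OF sigma_bounded_Un[OF A(1) B(1)]], rule that)
  have [measurable]: "U n \<in> sets borel" for n using U(2) by auto
  define N where "N n = density M (indicator (U n))" for n
  have N: "inner_regular_on_open (N n)" "finite_measure (N n)" for n
    using finite_inner_regular_restriction[OF U(2,3)] by (simp_all add: N_def)
  have Nint: "(\<integral>\<^sup>+t. g t \<partial>N n) = (\<integral>\<^sup>+t. indicator (U n) t * g t \<partial>M)"
    if "g \<in> borel_measurable borel" for g n
    using that by (simp add: nn_integral_density N_def)
  have U_mono: "indicator (U m) x \<le> (indicator (U n) x :: ennreal)" if "m \<le> n" for m n x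
    using incseqD[OF U(1) that] by (auto simp: indicator_def)
  have main: "(\<integral>\<^sup>+s. \<integral>\<^sup>+t. F (s, t) \<partial>M \<partial>M) = (SUP n. \<integral>\<^sup>+s. \<integral>\<^sup>+t. F (s, t) \<partial>N n \<partial>N n)"
    if F[measurable]: "F \<in> borel_measurable borel"
      and AB: "\<And>s t. s \<notin> A \<union> B \<Longrightarrow> F (s, t) = 0" "\<And>s t. t \<notin> A \<union> B \<Longrightarrow> F (s, t) = 0"
    for F :: "'g \<times> 'g \<Rightarrow> ennreal"
  proof -
    note [measurable] = borel_measurable_Pair[OF F] borel_measurable_nn_integral_section[OF N F]
    have inner: "(\<integral>\<^sup>+t. F (s, t) \<partial>M) = (SUP n. \<integral>\<^sup>+t. F (s, t) \<partial>N n)" for s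
    proof -
      have "(\<integral>\<^sup>+t. F (s, t) \<partial>M) = (\<integral>\<^sup>+t. (SUP n. indicator (U n) t * F (s, t)) \<partial>M)"
        by (intro nn_integral_cong SUP_indicator_mult[symmetric] U(1)) (rule AB(2), use U(4) in blast)
      also have "\<dots> = (SUP n. \<integral>\<^sup>+t. indicator (U n) t * F (s, t) \<partial>M)"
        by (intro nn_integral_monotone_convergence_SUP incseq_indicator_mult U) simp
      finally show ?thesis by (simp only: Nint[OF borel_measurable_Pair(1)[OF F]])
    qed
    have inc: "incseq (\<lambda>n. \<integral>\<^sup>+t. F (s, t) \<partial>N n)" for s
    proof (rule monoI)
      fix m n :: nat assume "m \<le> n"
      then show "(\<integral>\<^sup>+t. F (s, t) \<partial>N m) \<le> (\<integral>\<^sup>+t. F (s, t) \<partial>N n)"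
        unfolding Nint[OF borel_measurable_Pair(1)[OF F]]
        by (intro nn_integral_mono mult_right_mono U_mono) simp_all
    qed
    have "(\<integral>\<^sup>+s. \<integral>\<^sup>+t. F (s, t) \<partial>M \<partial>M) = (\<integral>\<^sup>+s. (SUP n. indicator (U n) s * (\<integral>\<^sup>+t. F (s, t) \<partial>N n)) \<partial>M)"
    proof (rule nn_integral_cong)
      fix s
      show "(\<integral>\<^sup>+t. F (s, t) \<partial>M) = (SUP n. indicator (U n) s * (\<integral>\<^sup>+t. F (s, t) \<partial>N n))"
      proof (cases "s \<in> (\<Union>n. U n)")
        case True
        then obtain m where m: "s \<in> U m" by auto
        show ?thesis
          unfolding inner
        proof (intro antisym SUP_mono)
          fix n
          \<comment> \<open>The truncations of the inner and the outer integral are merged into one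
            index: from \<open>max m n\<close> on, the outer indicator is 1 and the inner integral
            has reached its \<open>n\<close>-th value.\<close>
          have "s \<in> U (max m n)" using m incseqD[OF U(1), of m "max m n"] by auto
          moreover have "(\<integral>\<^sup>+t. F (s, t) \<partial>N n) \<le> (\<integral>\<^sup>+t. F (s, t) \<partial>N (max m n))"
            by (rule incseqD[OF inc]) simp
          ultimately show "\<exists>k\<in>UNIV. (\<integral>\<^sup>+t. F (s, t) \<partial>N n) \<le> indicator (U k) s * (\<integral>\<^sup>+t. F (s, t) \<partial>N k)"
            by (intro bexI[of _ "max m n"]) auto
          show "\<exists>k\<in>UNIV. indicator (U n) s * (\<integral>\<^sup>+t. F (s, t) \<partial>N n) \<le> (\<integral>\<^sup>+t. F (s, t) \<partial>N k)"
            by (intro bexI[of _ n]) (auto simp: indicator_def)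
        qed
      next
        case False
        then have "F (s, t) = 0" for t by (intro AB(1)) (use U(4) in blast)
        then show ?thesis using False by simp
      qed
    qed
    also have "\<dots> = (SUP n. \<integral>\<^sup>+s. indicator (U n) s * (\<integral>\<^sup>+t. F (s, t) \<partial>N n) \<partial>M)"
    proof (rule nn_integral_monotone_convergence_SUP)
      show "incseq (\<lambda>n s. indicator (U n) s * (\<integral>\<^sup>+t. F (s, t) \<partial>N n))"
      proof (intro monoI le_funI mult_mono)
        fix m n :: nat and s assume mn: "m \<le> n"
        show "indicator (U m) s \<le> (indicator (U n) s :: ennreal)" by (rule U_mono[OF mn])
        show "(\<integral>\<^sup>+t. F (s, t) \<partial>N m) \<le> (\<integral>\<^sup>+t. F (s, t) \<partial>N n)"
          using incseqD[OF inc mn] .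
      qed simp_all
    qed simp
    finally show ?thesis by (simp only: Nint[OF borel_measurable_nn_integral_section[OF N F]])
  qed
  have "(\<integral>\<^sup>+s. \<integral>\<^sup>+t. F (s, t) \<partial>M \<partial>M) = (SUP n. \<integral>\<^sup>+s. \<integral>\<^sup>+t. F (s, t) \<partial>N n \<partial>N n)"
    by (rule main[OF F]) (use A(2) B(2) in blast)+
  also have "\<dots> = (SUP n. \<integral>\<^sup>+t. \<integral>\<^sup>+s. F (s, t) \<partial>N n \<partial>N n)"
    by (simp only: nn_integral_sections_swap[OF N N F])
  also have "\<dots> = (\<integral>\<^sup>+t. \<integral>\<^sup>+s. F (s, t) \<partial>M \<partial>M)"
  proof -
    \<comment> \<open>The conditions of \<open>main\<close> are symmetric in the two variables, so
      it applies to the swapped function as well.\<close>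
    define G where "G z = F (prod.swap z)" for z
    have "G \<in> borel_measurable borel"
      unfolding G_def by (rule measurable_compose[OF prod_swap_borel F])
    moreover have G: "G (s, t) = F (t, s)" for s t by (simp add: G_def)
    ultimately have "(\<integral>\<^sup>+s. \<integral>\<^sup>+t. G (s, t) \<partial>M \<partial>M) = (SUP n. \<integral>\<^sup>+s. \<integral>\<^sup>+t. G (s, t) \<partial>N n \<partial>N n)"
      by (intro main) (use A(2) B(2) in \<open>simp_all add: G\<close>)
    then show ?thesis by (simp only: G)
  qed
  finally show ?thesis .
qed

lemma borel_measurable_conv_arg[measurable]:
  "(\<lambda>z. - snd z + fst z) \<in> borel_measurable (borel :: ('g \<times> 'g) measure)"
  "(\<lambda>t. - t + s) \<in> borel_measurable (borel :: 'g measure)"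
  "fst \<in> borel_measurable (borel :: ('g \<times> 'g) measure)"
  "snd \<in> borel_measurable (borel :: ('g \<times> 'g) measure)"
  by (intro borel_measurable_continuous_onI continuous_intros)+

text \<open>By Tonelli's theorem, \<open>\<integral>\<^sub>V m((s - N) \<inter> D) ds = \<integral>\<^sub>D m((t + N) \<inter> V) dt = 0\<close>,
  and \<open>(s - N) \<inter> D\<close> contains a translate of \<open>- N \<inter> K\<close> for every \<open>s \<in> V\<close> if \<open>D = V + K\<close>.\<close>

lemma null_sets_uminus:
  assumes N: "N \<in> null_sets M"
  shows "uminus -` N \<in> null_sets M"
proof -
  have Nb[measurable]: "N \<in> sets borel" and N0: "emeasure M N = 0" using N by auto
  have mb[measurable]: "uminus \<in> borel_measurable (borel :: 'g measure)"
    by (intro borel_measurable_continuous_onI continuous_intros)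
  have uN[measurable]: "uminus -` N \<in> sets borel" using measurable_sets[OF mb Nb] by simp
  have compact_null: "uminus -` N \<inter> K \<in> null_sets M" if K: "compact K" for K
  proof -
    obtain V W :: "'g set" where V: "compact V" "open W" "0 \<in> W" "W \<subseteq> V"
      using symmetric_compact_neighbourhood by metis
    define D where "D = (\<lambda>z. fst z + snd z) ` (V \<times> K)"
    have D: "compact D" using V K unfolding D_def
      by (intro compact_continuous_image compact_Times continuous_intros) auto
    have [measurable]: "V \<in> sets borel" "D \<in> sets borel" "K \<in> sets borel"
      using V D K by (auto simp: borel_compact)
    define F :: "'g \<times> 'g \<Rightarrow> ennreal"
      where "F z = indicator V (fst z) * (indicator D (snd z) * indicator N (- snd z + fst z))" for z
    have [measurable]: "F \<in> borel_measurable borel" unfolding F_def by measurable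
    have "(\<integral>\<^sup>+s. F (s, t) \<partial>M) = 0" for t
    proof -
      have "(\<integral>\<^sup>+s. F (s, t) \<partial>M) \<le> (\<integral>\<^sup>+s. indicator N (- t + s) \<partial>M)"
        by (intro nn_integral_mono) (auto simp: F_def indicator_def)
      also have "\<dots> = 0" by (subst nn_integral_translate) (auto simp: N0)
      finally show ?thesis by simp
    qed
    then have "(\<integral>\<^sup>+s. \<integral>\<^sup>+t. F (s, t) \<partial>M \<partial>M) = 0"
      by (subst tonelli[of F V D]) (auto simp: F_def intro: sigma_bounded_compact V D)
    moreover have "(\<lambda>s. \<integral>\<^sup>+t. F (s, t) \<partial>M) \<in> borel_measurable borel"
      by (rule borel_measurable_nn_integral_M[of F D]) (auto simp: F_def intro: sigma_bounded_compact V D)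
    ultimately have "AE s in M. (\<integral>\<^sup>+t. F (s, t) \<partial>M) = 0"
      by (subst (asm) nn_integral_0_iff_AE) auto
    \<comment> \<open>The open set \<open>W\<close> is not null, so a property valid almost
      everywhere holds at some \<open>s\<close> in \<open>W\<close>, hence in
      \<open>V\<close>.\<close>
    moreover have "\<not> (AE s in M. s \<notin> W)"
      using emeasure_open_pos[of W] V AE_iff_measurable[of W M "\<lambda>s. s \<notin> W"] by auto
    ultimately obtain s where s: "s \<in> W" "(\<integral>\<^sup>+t. F (s, t) \<partial>M) = 0"
      by (metis (mono_tags, lifting) eventually_mono)
    have "(\<integral>\<^sup>+t. F (s, s + t) \<partial>M) = 0"
      using s(2) borel_measurable_Pair(1)[of F s] by (subst nn_integral_translate) auto
    moreover have "emeasure M (uminus -` N \<inter> K) = (\<integral>\<^sup>+t. indicator (uminus -` N \<inter> K) t \<partial>M)"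
      by simp
    moreover have "(\<integral>\<^sup>+t. indicator (uminus -` N \<inter> K) t \<partial>M) \<le> (\<integral>\<^sup>+t. F (s, s + t) \<partial>M)"
    proof (rule nn_integral_mono)
      fix t
      show "indicator (uminus -` N \<inter> K) t \<le> F (s, s + t)"
      proof (cases "t \<in> uminus -` N \<inter> K")
        case True
        \<comment> \<open>For \<open>t\<close> in \<open>K\<close> with \<open>- t\<close> in
          \<open>N\<close>, the point \<open>s + t\<close> lies in \<open>D = V + K\<close> and
          satisfies \<open>- (s + t) + s = - t\<close>, so all three indicators in \<open>F\<close>
          are 1.\<close>
        then have "s + t \<in> D" using V s by (force simp: D_def)
        then show ?thesis using True V s
          by (auto simp: F_def indicator_def minus_add add.assoc)
      qed auto
    qed
    ultimately have "emeasure M (uminus -` N \<inter> K) = 0" by auto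
    then show ?thesis by (intro null_setsI) auto
  qed
  \<comment> \<open>A null set has finite measure, so countably many compact sets cover it and also
    its image under inversion; this reduces the claim to compact pieces.\<close>
  have "sigma_bounded N" by (rule finite_measure_imp_sigma_bounded) (auto simp: N0)
  then have "sigma_bounded (uminus ` N)" by (rule sigma_bounded_uminus)
  then obtain \<K> where K: "countable \<K>" "\<forall>K\<in>\<K>. compact K" "uminus ` N \<subseteq> \<Union>\<K>"
    unfolding sigma_bounded_def by blast
  have "uminus -` N = (\<Union>K\<in>\<K>. uminus -` N \<inter> K)"
  proof safe
    fix x assume "- x \<in> N"
    then have "x \<in> uminus ` N" by force
    with K(3) \<open>- x \<in> N\<close> show "x \<in> (\<Union>K\<in>\<K>. uminus -` N \<inter> K)" by auto
  qed
  moreover have "(\<Union>K\<in>\<K>. uminus -` N \<inter> K) \<in> null_sets M"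
    using K compact_null by (intro null_sets_UN') auto
  ultimately show ?thesis by simp
qed

text \<open>\<open>- t + s\<close> is the inverse of \<open>- s + t\<close>, and both inversion and
  left translation preserve null sets. Therefore changing representatives does not affect a
  convolution at any single point \<open>s\<close>.\<close>

lemma AE_conv_arg:
  assumes "AE x in M. P x"
  shows "AE t in M. P (- t + s)"
proof -
  obtain N where N: "N \<in> null_sets M" "{x. \<not> P x} \<subseteq> N"
    using assms by (auto simp: eventually_ae_filter)
  have "{x. \<not> P (- x)} \<subseteq> uminus -` N" using N by auto
  then have "AE x in M. P (- x)"
    using null_sets_uminus[OF N(1)] by (auto simp: eventually_ae_filter)
  from AE_translate[OF this, of "- s"] show ?thesis by (simp add: minus_add)
qed

end

section \<open>Fubini's theorem for Haar measure\<close>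

context haar_measure
begin

text \<open>Vector-valued integrals are reduced to real ones by coordinates; the sort
  \<^class>\<open>euclidean_space\<close> covers the real and the complex numbers.\<close>

lemma borel_measurable_integral_M:
  fixes K :: "'a::topological_space \<times> 'g \<Rightarrow> 'b::euclidean_space"
  assumes K[measurable]: "K \<in> borel_measurable borel"
    and A: "sigma_bounded A" "\<And>s t. t \<notin> A \<Longrightarrow> K (s, t) = 0"
  shows "(\<lambda>s. LINT t|M. K (s, t)) \<in> borel_measurable borel"
proof -
  note [measurable] = borel_measurable_Pair[OF K]
  have [measurable]: "(\<lambda>s. \<integral>\<^sup>+t. ennreal (norm (K (s, t))) \<partial>M) \<in> borel_measurable borel"
    "(\<lambda>s. \<integral>\<^sup>+t. ennreal (K (s, t) \<bullet> b) \<partial>M) \<in> borel_measurable borel"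
    "(\<lambda>s. \<integral>\<^sup>+t. ennreal (- (K (s, t) \<bullet> b)) \<partial>M) \<in> borel_measurable borel" for b
    using A by (auto intro!: borel_measurable_nn_integral_M[of _ A])
  \<comment> \<open>The formula must hold for every \<open>s\<close>; the second branch is the
    default value 0 of the integral of a non-integrable function.\<close>
  have eq: "(LINT t|M. K (s, t)) \<bullet> b =
      (if (\<integral>\<^sup>+t. ennreal (norm (K (s, t))) \<partial>M) < \<infinity>
       then enn2real (\<integral>\<^sup>+t. ennreal (K (s, t) \<bullet> b) \<partial>M) - enn2real (\<integral>\<^sup>+t. ennreal (- (K (s, t) \<bullet> b)) \<partial>M)
       else 0)" for s b
  proof (cases "integrable M (\<lambda>t. K (s, t))")
    case True
    then have "(LINT t|M. K (s, t)) \<bullet> b = (LINT t|M. K (s, t) \<bullet> b)" by simp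
    also have "\<dots> = enn2real (\<integral>\<^sup>+t. ennreal (K (s, t) \<bullet> b) \<partial>M) - enn2real (\<integral>\<^sup>+t. ennreal (- (K (s, t) \<bullet> b)) \<partial>M)"
      using True by (intro real_lebesgue_integral_def) simp
    finally show ?thesis using True by (simp add: integrable_iff_bounded)
  next
    case False
    then show ?thesis by (simp add: not_integrable_integral_eq integrable_iff_bounded)
  qed
  show ?thesis
    by (subst borel_measurable_euclidean_space) (auto simp: eq)
qed

text \<open>Expresses an iterated integral through nonnegative ones, to which \<open>tonelli\<close>
  applies. The inner integrals of the positive and negative parts can be infinite only on a null set
  of \<open>s\<close>, where the value given by \<open>enn2real\<close> is harmless.\<close>

lemma integral_integral_eq_nn_integral:
  fixes K :: "'g \<times> 'g \<Rightarrow> real"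
  assumes K[measurable]: "K \<in> borel_measurable borel"
    and B: "sigma_bounded B" "\<And>s t. t \<notin> B \<Longrightarrow> K (s, t) = 0"
    and fin: "(\<integral>\<^sup>+s. \<integral>\<^sup>+t. ennreal (norm (K (s, t))) \<partial>M \<partial>M) < \<infinity>"
  shows "(LINT s|M. LINT t|M. K (s, t)) =
    enn2real (\<integral>\<^sup>+s. \<integral>\<^sup>+t. ennreal (K (s, t)) \<partial>M \<partial>M) - enn2real (\<integral>\<^sup>+s. \<integral>\<^sup>+t. ennreal (- K (s, t)) \<partial>M \<partial>M)"
proof -
  note [measurable] = borel_measurable_Pair[OF K]
  define P where "P s = (\<integral>\<^sup>+t. ennreal (K (s, t)) \<partial>M)" for s
  define Q where "Q s = (\<integral>\<^sup>+t. ennreal (- K (s, t)) \<partial>M)" for s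
  define R where "R s = (\<integral>\<^sup>+t. ennreal (norm (K (s, t))) \<partial>M)" for s
  have PQ[measurable]: "P \<in> borel_measurable borel" "Q \<in> borel_measurable borel" "R \<in> borel_measurable borel"
    using B unfolding P_def Q_def R_def by (auto intro!: borel_measurable_nn_integral_M[of _ B])
  have PR: "P s \<le> R s" "Q s \<le> R s" for s
    by (auto simp: P_def Q_def R_def intro!: nn_integral_mono ennreal_leI)
  have Rfin: "AE s in M. R s < \<infinity>"
    using fin[folded R_def] nn_integral_PInf_AE[of R M] by (auto simp: less_top)
  have le: "(\<integral>\<^sup>+s. P s \<partial>M) < \<infinity>" "(\<integral>\<^sup>+s. Q s \<partial>M) < \<infinity>"
    using fin[folded R_def] PR by (auto intro: nn_integral_mono order_le_less_trans)
  have int: "integrable M (\<lambda>s. enn2real (H s)) \<and> (LINT s|M. enn2real (H s)) = enn2real (\<integral>\<^sup>+s. H s \<partial>M)"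
    if [measurable]: "H \<in> borel_measurable borel" and H: "\<And>s. H s \<le> R s" "(\<integral>\<^sup>+s. H s \<partial>M) < \<infinity>" for H
  proof -
    have "(\<integral>\<^sup>+s. ennreal (enn2real (H s)) \<partial>M) = (\<integral>\<^sup>+s. H s \<partial>M)"
    proof (rule nn_integral_cong_AE)
      show "AE s in M. ennreal (enn2real (H s)) = H s"
        using Rfin
      proof eventually_elim
        case (elim s)
        with H(1) have "H s < \<infinity>" by (rule order_le_less_trans)
        then show ?case by simp
      qed
    qed
    with H(2) show ?thesis
      by (auto simp: integrable_iff_bounded integral_eq_nn_integral)
  qed
  have "(LINT s|M. LINT t|M. K (s, t)) = (LINT s|M. enn2real (P s) - enn2real (Q s))"
  proof (rule integral_cong_AE)
    show "(\<lambda>s. LINT t|M. K (s, t)) \<in> borel_measurable M"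
      using borel_measurable_integral_M[OF K B] by simp
    show "AE s in M. (LINT t|M. K (s, t)) = enn2real (P s) - enn2real (Q s)"
      using Rfin
    proof eventually_elim
      case (elim s)
      then have "integrable M (\<lambda>t. K (s, t))" by (simp add: R_def integrable_iff_bounded)
      then show ?case by (simp add: real_lebesgue_integral_def P_def Q_def)
    qed
  qed simp
  also have "\<dots> = (LINT s|M. enn2real (P s)) - (LINT s|M. enn2real (Q s))"
    using int[OF PQ(1) PR(1) le(1)] int[OF PQ(2) PR(2) le(2)]
    by (intro Bochner_Integration.integral_diff) simp_all
  finally show ?thesis
    using int[OF PQ(1) PR(1) le(1)] int[OF PQ(2) PR(2) le(2)]
    by (simp only: P_def[symmetric] Q_def[symmetric])
qed

lemma fubini_real:
  fixes K :: "'g \<times> 'g \<Rightarrow> real"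
  assumes K[measurable]: "K \<in> borel_measurable borel"
    and A: "sigma_bounded A" "\<And>s t. s \<notin> A \<Longrightarrow> K (s, t) = 0"
    and B: "sigma_bounded B" "\<And>s t. t \<notin> B \<Longrightarrow> K (s, t) = 0"
    and fin: "(\<integral>\<^sup>+s. \<integral>\<^sup>+t. ennreal (norm (K (s, t))) \<partial>M \<partial>M) < \<infinity>"
  shows "(LINT s|M. LINT t|M. K (s, t)) = (LINT t|M. LINT s|M. K (s, t))"
proof -
  have swap: "(\<integral>\<^sup>+s. \<integral>\<^sup>+t. ennreal (f (K (s, t))) \<partial>M \<partial>M) = (\<integral>\<^sup>+t. \<integral>\<^sup>+s. ennreal (f (K (s, t))) \<partial>M \<partial>M)"
    if [measurable]: "f \<in> borel_measurable borel" and "f 0 = 0" for f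
    by (rule tonelli[of "\<lambda>z. ennreal (f (K z))" A B]) (use A B that in auto)
  define L where "L z = K (prod.swap z)" for z
  have L: "L (t, s) = K (s, t)" for s t by (simp add: L_def)
  have "L \<in> borel_measurable borel"
    unfolding L_def by (rule measurable_compose[OF prod_swap_borel K])
  then have "(LINT t|M. LINT s|M. L (t, s)) =
    enn2real (\<integral>\<^sup>+t. \<integral>\<^sup>+s. ennreal (L (t, s)) \<partial>M \<partial>M) - enn2real (\<integral>\<^sup>+t. \<integral>\<^sup>+s. ennreal (- L (t, s)) \<partial>M \<partial>M)"
    by (rule integral_integral_eq_nn_integral[OF _ A(1)]) (use A(2) fin swap[of norm] in \<open>auto simp: L\<close>)
  with integral_integral_eq_nn_integral[OF K B fin] show ?thesis
    using swap[of "\<lambda>x. x"] swap[of uminus] by (simp add: L)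
qed

lemma integrable_integral_M:
  fixes K :: "'g \<times> 'g \<Rightarrow> 'b::euclidean_space"
  assumes K[measurable]: "K \<in> borel_measurable borel"
    and B: "sigma_bounded B" "\<And>s t. t \<notin> B \<Longrightarrow> K (s, t) = 0"
    and fin: "(\<integral>\<^sup>+s. \<integral>\<^sup>+t. ennreal (norm (K (s, t))) \<partial>M \<partial>M) < \<infinity>"
  shows "integrable M (\<lambda>s. LINT t|M. K (s, t))"
    and "AE s in M. integrable M (\<lambda>t. K (s, t))"
proof -
  note [measurable] = borel_measurable_Pair[OF K]
  define R where "R s = (\<integral>\<^sup>+t. ennreal (norm (K (s, t))) \<partial>M)" for s
  have [measurable]: "R \<in> borel_measurable borel"
    using B unfolding R_def by (auto intro!: borel_measurable_nn_integral_M[of _ B])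
  have "AE s in M. R s < \<infinity>"
    using fin nn_integral_PInf_AE[of R M] by (auto simp: R_def[symmetric] less_top)
  then show "AE s in M. integrable M (\<lambda>t. K (s, t))"
    by eventually_elim (simp add: R_def integrable_iff_bounded)
  have "(\<integral>\<^sup>+s. ennreal (norm (LINT t|M. K (s, t))) \<partial>M) \<le> (\<integral>\<^sup>+s. R s \<partial>M)"
  proof (rule nn_integral_mono)
    show "ennreal (norm (LINT t|M. K (s, t))) \<le> R s" for s
      unfolding R_def
      by (cases "integrable M (\<lambda>t. K (s, t))") (auto simp: integral_norm_bound_ennreal not_integrable_integral_eq)
  qed
  with fin show "integrable M (\<lambda>s. LINT t|M. K (s, t))"
    using borel_measurable_integral_M[OF K B] by (simp add: integrable_iff_bounded R_def order_le_less_trans)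
qed

lemma fubini:
  fixes K :: "'g \<times> 'g \<Rightarrow> 'b::euclidean_space"
  assumes K[measurable]: "K \<in> borel_measurable borel"
    and A: "sigma_bounded A" "\<And>s t. s \<notin> A \<Longrightarrow> K (s, t) = 0"
    and B: "sigma_bounded B" "\<And>s t. t \<notin> B \<Longrightarrow> K (s, t) = 0"
    and fin: "(\<integral>\<^sup>+s. \<integral>\<^sup>+t. ennreal (norm (K (s, t))) \<partial>M \<partial>M) < \<infinity>"
  shows "(LINT s|M. LINT t|M. K (s, t)) = (LINT t|M. LINT s|M. K (s, t))"
proof (rule euclidean_eqI)
  fix b :: 'b assume b: "b \<in> Basis"
  have coord: "(LINT s|M. LINT t|M. J (s, t)) \<bullet> b = (LINT s|M. LINT t|M. J (s, t) \<bullet> b)"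
    if J[measurable]: "J \<in> borel_measurable borel" and C: "sigma_bounded C" "\<And>s t. t \<notin> C \<Longrightarrow> J (s, t) = 0"
      and Jfin: "(\<integral>\<^sup>+s. \<integral>\<^sup>+t. ennreal (norm (J (s, t))) \<partial>M \<partial>M) < \<infinity>" for J :: "'g \<times> 'g \<Rightarrow> 'b" and C
  proof -
    have m: "(\<lambda>z. J z \<bullet> b) \<in> borel_measurable borel" by measurable
    have "(LINT s|M. LINT t|M. J (s, t)) \<bullet> b = (LINT s|M. (LINT t|M. J (s, t)) \<bullet> b)"
      using integrable_integral_M(1)[OF J C Jfin] by simp
    also have "\<dots> = (LINT s|M. LINT t|M. J (s, t) \<bullet> b)"
      using integrable_integral_M(2)[OF J C Jfin] borel_measurable_integral_M[OF J C]
        borel_measurable_integral_M[OF m C(1)] C(2)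
      by (intro integral_cong_AE) auto
    finally show ?thesis .
  qed
  have swap: "(\<integral>\<^sup>+s. \<integral>\<^sup>+t. ennreal (norm (K (s, t))) \<partial>M \<partial>M) = (\<integral>\<^sup>+t. \<integral>\<^sup>+s. ennreal (norm (K (s, t))) \<partial>M \<partial>M)"
    by (rule tonelli[of "\<lambda>z. ennreal (norm (K z))" A B]) (use A B in auto)
  define L where "L z = K (prod.swap z)" for z
  have L: "L (t, s) = K (s, t)" for s t by (simp add: L_def)
  have Lm: "L \<in> borel_measurable borel"
    unfolding L_def by (rule measurable_compose[OF prod_swap_borel K])
  have m: "(\<lambda>z. K z \<bullet> b) \<in> borel_measurable borel" by measurable
  have "(LINT s|M. LINT t|M. K (s, t)) \<bullet> b = (LINT s|M. LINT t|M. K (s, t) \<bullet> b)"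
    by (rule coord[OF K B fin])
  also have "\<dots> = (LINT t|M. LINT s|M. K (s, t) \<bullet> b)"
  proof (rule fubini_real[OF m A(1) _ B(1)])
    have "(\<integral>\<^sup>+s. \<integral>\<^sup>+t. ennreal (norm (K (s, t) \<bullet> b)) \<partial>M \<partial>M) \<le> (\<integral>\<^sup>+s. \<integral>\<^sup>+t. ennreal (norm (K (s, t))) \<partial>M \<partial>M)"
      using b by (intro nn_integral_mono ennreal_leI) (simp add: Basis_le_norm)
    with fin show "(\<integral>\<^sup>+s. \<integral>\<^sup>+t. ennreal (norm (K (s, t) \<bullet> b)) \<partial>M \<partial>M) < \<infinity>" by simp
  qed (use A(2) B(2) in auto)
  also have "\<dots> = (LINT t|M. LINT s|M. K (s, t)) \<bullet> b"
    using coord[OF Lm A(1)] A(2) fin swap by (simp add: L)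
  finally show "(LINT s|M. LINT t|M. K (s, t)) \<bullet> b = (LINT t|M. LINT s|M. K (s, t)) \<bullet> b" .
qed

end

section \<open>Functions with integrable p-th power\<close>

text \<open>All estimates are made for functions; the classes in \<open>Lp_space\<close> are reached
  through \<open>Lp_space_eq\<close>.\<close>

definition LP :: "'a measure \<Rightarrow> real \<Rightarrow> ('a \<Rightarrow> 'b::{banach,second_countable_topology}) set" where
  "LP M p = {f \<in> borel_measurable M. integrable M (\<lambda>x. norm (f x) powr p)}"

lemma LP_measurable: "f \<in> LP M p \<Longrightarrow> f \<in> borel_measurable M"
  by (simp add: LP_def)

lemma LP_one_iff: "f \<in> LP M 1 \<longleftrightarrow> integrable M f"
  by (auto simp: LP_def integrable_norm_iff)

lemma LP_bound:
  assumes "f \<in> LP M p" "g \<in> borel_measurable M" "AE x in M. norm (g x) \<le> norm (f x)" "0 \<le> p"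
  shows "g \<in> LP M p"
  unfolding LP_def
proof (intro CollectI conjI)
  have "integrable M (\<lambda>x. norm (f x) powr p)" using assms by (simp add: LP_def)
  then show "integrable M (\<lambda>x. norm (g x) powr p)"
    by (rule Bochner_Integration.integrable_bound)
      (use assms in \<open>auto elim!: eventually_mono intro!: powr_mono2\<close>)
qed fact

lemma LP_add:
  assumes f: "f \<in> LP M p" and g: "g \<in> LP M p" and p: "0 \<le> p"
  shows "(\<lambda>x. f x + g x) \<in> LP M p"
  unfolding LP_def
proof (intro CollectI conjI)
  have [measurable]: "f \<in> borel_measurable M" "g \<in> borel_measurable M"
    using f g by (auto simp: LP_def)
  show "(\<lambda>x. f x + g x) \<in> borel_measurable M" by simp
  have "integrable M (\<lambda>x. 2 powr p * (norm (f x) powr p + norm (g x) powr p))"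
    using f g by (simp add: LP_def)
  then show "integrable M (\<lambda>x. norm (f x + g x) powr p)"
  proof (rule Bochner_Integration.integrable_bound)
    have "norm (f x + g x) powr p \<le> 2 powr p * (norm (f x) powr p + norm (g x) powr p)" for x
    proof -
      have "norm (f x + g x) powr p \<le> (2 * max (norm (f x)) (norm (g x))) powr p"
        using norm_triangle_ineq[of "f x" "g x"] p by (intro powr_mono2) auto
      also have "\<dots> = 2 powr p * (max (norm (f x)) (norm (g x)) powr p)"
        by (simp add: powr_mult)
      also have "\<dots> \<le> 2 powr p * (norm (f x) powr p + norm (g x) powr p)"
        by (intro mult_left_mono) (auto simp: max_def)
      finally show ?thesis .
    qed
    then show "AE x in M. norm (norm (f x + g x) powr p) \<le> norm (2 powr p * (norm (f x) powr p + norm (g x) powr p))"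
      by simp
  qed simp
qed

lemma LP_mult:
  fixes f :: "'a \<Rightarrow> 'b::{real_normed_field,banach,second_countable_topology}"
  assumes "f \<in> LP M p" shows "(\<lambda>x. c * f x) \<in> LP M p"
  using assms by (auto simp: LP_def norm_mult powr_mult)

lemma LP_norm: "f \<in> LP M p \<Longrightarrow> (\<lambda>x. norm (f x)) \<in> LP M p"
  by (auto simp: LP_def)

lemma LP_indicator:
  assumes "f \<in> LP M p" "0 \<le> p" "A \<in> sets M" shows "(\<lambda>x. indicator A x *\<^sub>R f x) \<in> LP M p"
proof -
  have [measurable]: "f \<in> borel_measurable M" "A \<in> sets M" using assms by (auto simp: LP_def)
  show ?thesis by (rule LP_bound[OF assms(1)]) (use assms in \<open>auto simp: indicator_def\<close>)
qed

text \<open>Convexity of the power on the open half-line. At \<open>y = 0\<close>, outside that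
  half-line, the claim is \<open>(1 - p) * c powr p \<le> 0\<close>.\<close>

lemma powr_above_tangent:
  fixes y c p :: real
  assumes "0 \<le> y" "0 < c" "1 \<le> p"
  shows "c powr p + p * c powr (p - 1) * (y - c) \<le> y powr p"
proof (cases "y = 0")
  case True
  have "c powr p = c powr (p - 1) * c" using assms by (simp add: powr_mult_base' powr_diff)
  then show ?thesis using True assms
    by (simp add: algebra_simps mult_right_mono)
next
  case False
  have "p * c powr (p - 1) * (y - c) \<le> y powr p - c powr p"
  proof (rule convex_on_imp_above_tangent[of "{0<..}"])
    show "convex_on {0<..} (\<lambda>x. x powr p)" using assms by (intro powr_convex)
    show "((\<lambda>x. x powr p) has_real_derivative p * c powr (p - 1)) (at c within {0<..})"
      using assms by (auto intro!: derivative_eq_intros)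
  qed (use assms False in \<open>auto simp: interior_open\<close>)
  then show ?thesis by simp
qed

text \<open>Integrate the tangent of \<open>y\<^sup>p\<close> at \<open>c = \<integral> u v / \<integral> u\<close>.\<close>

lemma integral_powr_jensen:
  fixes u v :: "'a \<Rightarrow> real"
  assumes u: "integrable M u" "\<And>x. 0 \<le> u x" and v: "v \<in> borel_measurable M" "\<And>x. 0 \<le> v x" and p: "1 \<le> p"
    and uv: "integrable M (\<lambda>x. u x * v x powr p)"
  shows "integrable M (\<lambda>x. u x * v x)"
    and "(LINT x|M. u x * v x) powr p \<le> (LINT x|M. u x) powr (p - 1) * (LINT x|M. u x * v x powr p)"
proof -
  have [measurable]: "u \<in> borel_measurable M" "v \<in> borel_measurable M" using u v by auto
  have le: "v x \<le> 1 + v x powr p" for x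
  proof (cases "v x \<le> 1")
    case False
    then have "v x powr 1 \<le> v x powr p" using p by (intro powr_mono) auto
    then show ?thesis using False by simp
  qed (simp add: add_increasing2)
  have "integrable M (\<lambda>x. u x + u x * v x powr p)" using u uv by simp
  then show int: "integrable M (\<lambda>x. u x * v x)"
  proof (rule Bochner_Integration.integrable_bound)
    have "u x * v x \<le> u x + u x * v x powr p" for x
      using mult_left_mono[OF le[of x] u(2)[of x]] by (simp add: algebra_simps)
    then show "AE x in M. norm (u x * v x) \<le> norm (u x + u x * v x powr p)"
      using u(2) v(2) by (auto simp: abs_of_nonneg)
  qed simp
  define C where "C = (LINT x|M. u x)"
  define N where "N = (LINT x|M. u x * v x)"
  have C0: "0 \<le> C" "0 \<le> N" using u v by (auto simp: C_def N_def intro!: integral_nonneg_AE)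
  show "N powr p \<le> C powr (p - 1) * (LINT x|M. u x * v x powr p)"
  \<comment> \<open>If \<open>C = 0\<close>, then \<open>u\<close> vanishes almost everywhere and
    \<open>N = 0\<close> too. In both degenerate cases the left side is 0 and the right side is
    nonnegative, also for \<open>p = 1\<close>, where \<open>0 powr 0 = 0\<close>.\<close>
  proof (cases "N = 0 \<or> C = 0")
    case True
    have "N = 0" if "C = 0"
    proof -
      have "AE x in M. u x = 0"
        using that u integral_nonneg_eq_0_iff_AE[of M u] by (simp add: C_def)
      then have "(LINT x|M. u x * v x) = (LINT x|M. 0)" by (intro integral_cong_AE) auto
      then show ?thesis by (simp add: N_def)
    qed
    with True show ?thesis using u v by (auto intro!: mult_nonneg_nonneg integral_nonneg_AE)
  next
    case False
    then have pos: "0 < N" "0 < C" using C0 by auto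
    define c where "c = N / C"
    have c: "0 < c" "c * C = N" using pos by (auto simp: c_def)
    have "c powr p * C = c powr p * C + p * c powr (p - 1) * (N - c * C)" using c by simp
    also have "\<dots> = (LINT x|M. c powr p * u x + p * c powr (p - 1) * (u x * v x - c * u x))"
      using u(1) int by (simp add: C_def N_def)
    also have "\<dots> \<le> (LINT x|M. u x * v x powr p)"
    proof (rule integral_mono)
      show "integrable M (\<lambda>x. c powr p * u x + p * c powr (p - 1) * (u x * v x - c * u x))"
        using u(1) int by simp
      show "c powr p * u x + p * c powr (p - 1) * (u x * v x - c * u x) \<le> u x * v x powr p" for x
        using mult_left_mono[OF powr_above_tangent[OF v(2)[of x] c(1) p] u(2)[of x]]
        by (simp add: algebra_simps)
    qed (rule uv)
    finally have "C powr (p - 1) * (c powr p * C) \<le> C powr (p - 1) * (LINT x|M. u x * v x powr p)"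
      by (intro mult_left_mono) auto
    moreover have "N powr p = C powr (p - 1) * (c powr p * C)"
      using c pos by (simp add: c(2)[symmetric] powr_mult powr_diff)
    ultimately show ?thesis by simp
  qed
qed

section \<open>Convolution of functions\<close>

text \<open>Convolution of representatives as a total function, with value 0 where the integral does
  not exist; \<open>conv_class\<close> ties it to \<open>conv\<close>.\<close>

definition cv :: "'g::group_add measure \<Rightarrow> ('g \<Rightarrow> 'b) \<Rightarrow> ('g \<Rightarrow> 'b) \<Rightarrow> 'g
    \<Rightarrow> 'b::{real_normed_field,banach,second_countable_topology}" where
  "cv M f g s = (LINT t|M. f t * g (- t + s))"

context haar_measure
begin

text \<open>By Markov's inequality the sets where \<open>norm (f x) powr p\<close> is at least
  \<open>1 / Suc n\<close> have finite measure, hence are sigma-bounded. This opens the way to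
  Tonelli and Fubini for p-integrable functions.\<close>

lemma LP_sigma_bounded:
  assumes f: "f \<in> LP M p" shows "sigma_bounded {x. f x \<noteq> 0}"
proof -
  have i: "integrable M (\<lambda>x. norm (f x) powr p)" and [measurable]: "f \<in> borel_measurable borel"
    using f by (auto simp: LP_def)
  have "sigma_bounded {x. norm (f x) powr p \<ge> 1 / Suc n}" for n
  proof (rule finite_measure_imp_sigma_bounded)
    have "emeasure M {x\<in>space M. norm (f x) powr p \<ge> 1 / Suc n} \<le>
        (1 / (1 / Suc n)) * (LINT x|M. norm (f x) powr p)"
      by (rule integral_Markov_inequality[OF i]) auto
    then show "emeasure M {x. norm (f x) powr p \<ge> 1 / Suc n} < \<infinity>"
      by (simp add: order_le_less_trans[OF _ ennreal_less_top])
  qed measurable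
  then have "sigma_bounded (\<Union>n. {x. norm (f x) powr p \<ge> 1 / Suc n})"
    by (intro sigma_bounded_UN) auto
  moreover have "{x. f x \<noteq> 0} \<subseteq> (\<Union>n. {x. norm (f x) powr p \<ge> 1 / Suc n})"
  proof safe
    fix x assume "f x \<noteq> 0"
    then have "0 < norm (f x) powr p" by simp
    then obtain n where "1 / Suc n < norm (f x) powr p" using nat_approx_posE by blast
    then show "x \<in> (\<Union>n. {x. norm (f x) powr p \<ge> 1 / Suc n})" by (auto intro!: exI[of _ n])
  qed
  ultimately show ?thesis by (rule sigma_bounded_subset)
qed

section \<open>Existence, norm bound and associativity of convolutions\<close>

text \<open>After the interchange, left invariance makes the integral over \<open>s\<close>
  independent of \<open>t\<close>. The support condition for \<open>s\<close> holds because a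
  non-zero integrand forces \<open>s = t + (- t + s)\<close> into the sum of the two
  supports.\<close>

lemma nn_integral_convolution:
  fixes f g :: "'g \<Rightarrow> ennreal"
  assumes [measurable]: "f \<in> borel_measurable borel" "g \<in> borel_measurable borel"
    and f: "sigma_bounded {x. f x \<noteq> 0}" and g: "sigma_bounded {x. g x \<noteq> 0}"
  shows "(\<integral>\<^sup>+s. \<integral>\<^sup>+t. f t * g (- t + s) \<partial>M \<partial>M) = (\<integral>\<^sup>+t. f t \<partial>M) * (\<integral>\<^sup>+t. g t \<partial>M)"
    and "(\<lambda>s. \<integral>\<^sup>+t. f t * g (- t + s) \<partial>M) \<in> borel_measurable borel"
proof -
  have m: "(\<lambda>z. f (snd z) * g (- snd z + fst z)) \<in> borel_measurable (borel :: ('g \<times> 'g) measure)"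
    by measurable
  let ?A = "{a + b |a b. a \<in> {x. f x \<noteq> 0} \<and> b \<in> {x. g x \<noteq> 0}}"
  have sup: "f t * g (- t + s) = 0" if "s \<notin> ?A" for s t
  proof (rule ccontr)
    assume "f t * g (- t + s) \<noteq> 0"
    then have "t + (- t + s) \<in> ?A" by fastforce
    moreover have "t + (- t + s) = s" by (simp add: add.assoc[symmetric])
    ultimately show False using that by (simp only:)
  qed
  have "(\<integral>\<^sup>+s. \<integral>\<^sup>+t. f t * g (- t + s) \<partial>M \<partial>M) = (\<integral>\<^sup>+t. \<integral>\<^sup>+s. f t * g (- t + s) \<partial>M \<partial>M)"
    using tonelli[OF m sigma_bounded_sum[OF f g] _ f] sup by simp
  also have "\<dots> = (\<integral>\<^sup>+t. f t * (\<integral>\<^sup>+s. g s \<partial>M) \<partial>M)"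
    by (simp add: nn_integral_cmult nn_integral_translate)
  also have "\<dots> = (\<integral>\<^sup>+t. f t \<partial>M) * (\<integral>\<^sup>+t. g t \<partial>M)"
    by (simp add: nn_integral_multc)
  finally show "(\<integral>\<^sup>+s. \<integral>\<^sup>+t. f t * g (- t + s) \<partial>M \<partial>M) = (\<integral>\<^sup>+t. f t \<partial>M) * (\<integral>\<^sup>+t. g t \<partial>M)" .
  show "(\<lambda>s. \<integral>\<^sup>+t. f t * g (- t + s) \<partial>M) \<in> borel_measurable borel"
    using borel_measurable_nn_integral_M[OF m f] by simp
qed

lemma cv_measurable:
  fixes f g :: "'g \<Rightarrow> 'b::{real_normed_field,euclidean_space}"
  assumes f: "f \<in> LP M p" and [measurable]: "g \<in> borel_measurable borel"
  shows "cv M f g \<in> borel_measurable borel"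
proof -
  have [measurable]: "f \<in> borel_measurable borel" using LP_measurable[OF f] by simp
  have "(\<lambda>z. f (snd z) * g (- snd z + fst z)) \<in> borel_measurable (borel :: ('g \<times> 'g) measure)"
    by measurable
  from borel_measurable_integral_M[OF this LP_sigma_bounded[OF f]] show ?thesis
    by (simp add: cv_def[abs_def])
qed

text \<open>Young's inequality. Jensen's inequality with weight \<open>|f|\<close> and total mass
  \<open>C\<close> bounds the p-th power of \<open>|f \<star> g|\<close> pointwise by
  \<open>C powr (p - 1)\<close> times the convolution of \<open>|f|\<close> with the p-th power of
  \<open>|g|\<close>, whose integral is known. The cases \<open>p = 1\<close> and
  \<open>p > 1\<close> are treated alike.\<close>

lemma cv_powr_bound:
  fixes f g :: "'g \<Rightarrow> 'b::{real_normed_field,euclidean_space}"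
  assumes f: "f \<in> LP M 1" and g: "g \<in> LP M p" and p: "1 \<le> p"
  shows "AE s in M. integrable M (\<lambda>t. f t * g (- t + s))" (is ?int)
    and "cv M f g \<in> LP M p"
    and "(LINT s|M. norm (cv M f g s) powr p) \<le>
      (LINT t|M. norm (f t)) powr p * (LINT t|M. norm (g t) powr p)"
proof -
  have [measurable]: "f \<in> borel_measurable borel" "g \<in> borel_measurable borel"
    using LP_measurable[OF f] LP_measurable[OF g] by simp_all
  have fi: "integrable M (\<lambda>t. norm (f t))" and gi: "integrable M (\<lambda>t. norm (g t) powr p)"
    using f g by (auto simp: LP_one_iff LP_def)
  define C where "C = (LINT t|M. norm (f t))"
  define D where "D = (LINT t|M. norm (g t) powr p)"
  have CD: "0 \<le> C" "0 \<le> D" by (auto simp: C_def D_def)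
  define R where "R s = (\<integral>\<^sup>+t. ennreal (norm (f t)) * ennreal (norm (g (- t + s)) powr p) \<partial>M)" for s
  note conv = nn_integral_convolution[of "\<lambda>t. ennreal (norm (f t))" "\<lambda>t. ennreal (norm (g t) powr p)"]
  have sb: "sigma_bounded {x. ennreal (norm (f x)) \<noteq> 0}" "sigma_bounded {x. ennreal (norm (g x) powr p) \<noteq> 0}"
    using LP_sigma_bounded[OF f] LP_sigma_bounded[OF g] by simp_all
  have Rm[measurable]: "R \<in> borel_measurable borel" and Rint: "(\<integral>\<^sup>+s. R s \<partial>M) = ennreal (C * D)"
    using conv sb fi gi CD by (simp_all add: R_def[abs_def] nn_integral_eq_integral C_def D_def ennreal_mult)
  have Rfin: "AE s in M. R s < \<infinity>"
    using Rint nn_integral_PInf_AE[of R M] by (auto simp: less_top)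
  have fin: "integrable M (\<lambda>t. f t * g (- t + s)) \<and>
      ennreal (norm (cv M f g s) powr p) \<le> ennreal (C powr (p - 1)) * R s" if "R s < \<infinity>" for s
  proof -
    have i: "integrable M (\<lambda>t. norm (f t) * norm (g (- t + s)) powr p)"
      using that by (simp add: R_def integrable_iff_bounded ennreal_mult)
    note J = integral_powr_jensen[OF fi _ _ _ p i]
    have i2: "integrable M (\<lambda>t. norm (f t * g (- t + s)))"
      using J(1) by (simp add: norm_mult)
    then have i3: "integrable M (\<lambda>t. f t * g (- t + s))"
      by (subst (asm) integrable_norm_iff) simp_all
    have "norm (cv M f g s) powr p \<le> (LINT t|M. norm (f t) * norm (g (- t + s))) powr p"
      using integral_norm_bound[of M "\<lambda>t. f t * g (- t + s)"] p
      by (intro powr_mono2) (auto simp: cv_def norm_mult)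
    also have "\<dots> \<le> C powr (p - 1) * (LINT t|M. norm (f t) * norm (g (- t + s)) powr p)"
      using J(2) by (simp add: C_def)
    finally have "ennreal (norm (cv M f g s) powr p) \<le>
        ennreal (C powr (p - 1)) * ennreal (LINT t|M. norm (f t) * norm (g (- t + s)) powr p)"
      by (simp add: ennreal_mult'[symmetric] ennreal_leI)
    also have "ennreal (LINT t|M. norm (f t) * norm (g (- t + s)) powr p) = R s"
      using i by (simp add: R_def nn_integral_eq_integral[symmetric] ennreal_mult)
    finally show ?thesis using i3 by simp
  qed
  show ?int using Rfin by eventually_elim (simp add: fin)
  have [measurable]: "cv M f g \<in> borel_measurable borel" by (rule cv_measurable[OF f]) simp
  have "(\<integral>\<^sup>+s. ennreal (norm (cv M f g s) powr p) \<partial>M) \<le> (\<integral>\<^sup>+s. ennreal (C powr (p - 1)) * R s \<partial>M)"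
    using Rfin by (intro nn_integral_mono_AE) (auto elim!: eventually_mono simp: fin)
  also have "\<dots> = ennreal (C powr (p - 1) * (C * D))"
    using CD by (simp add: nn_integral_cmult Rint ennreal_mult')
  also have "C powr (p - 1) * (C * D) = C powr p * D"
    using CD by (cases "C = 0") (simp_all add: powr_diff)
  finally have le: "(\<integral>\<^sup>+s. ennreal (norm (cv M f g s) powr p) \<partial>M) \<le> ennreal (C powr p * D)" .
  then have i: "integrable M (\<lambda>s. norm (cv M f g s) powr p)"
    by (simp add: integrable_iff_bounded order_le_less_trans[OF _ ennreal_less_top])
  then show "cv M f g \<in> LP M p" by (simp add: LP_def)
  show "(LINT s|M. norm (cv M f g s) powr p) \<le> C powr p * D"
    using le i CD by (simp add: nn_integral_eq_integral ennreal_le_iff)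
qed

lemma cv_cong_AE:
  fixes f g :: "'g \<Rightarrow> 'b::{real_normed_field,euclidean_space}"
  assumes [measurable]: "f \<in> borel_measurable borel" "g \<in> borel_measurable borel"
    "f' \<in> borel_measurable borel" "g' \<in> borel_measurable borel"
    and "AE x in M. f' x = f x" "AE x in M. g' x = g x"
  shows "cv M f' g' s = cv M f g s"
    and "integrable M (\<lambda>t. f' t * g' (- t + s)) \<longleftrightarrow> integrable M (\<lambda>t. f t * g (- t + s))"
proof -
  have "AE t in M. g' (- t + s) = g (- t + s)" using AE_conv_arg[OF assms(6)] .
  then have AE: "AE t in M. f' t * g' (- t + s) = f t * g (- t + s)"
    using assms(5) by eventually_elim simp
  show "cv M f' g' s = cv M f g s"
    unfolding cv_def by (rule integral_cong_AE) (use AE in auto)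
  show "integrable M (\<lambda>t. f' t * g' (- t + s)) \<longleftrightarrow> integrable M (\<lambda>t. f t * g (- t + s))"
    by (rule integrable_cong_AE) (use AE in auto)
qed

text \<open>Fubini's theorem for \<open>f t * g (- t + u) * h (- u + s)\<close> in \<open>t\<close>
  and \<open>u\<close>, after a translation of the inner variable by \<open>t\<close>. Absolute
  integrability holds at each \<open>s\<close> where the convolution of \<open>|f|\<close> with
  \<open>k = |g| \<star> |h|\<close> exists, that is, almost everywhere.\<close>

lemma cv_assoc:
  fixes f g h :: "'g \<Rightarrow> 'b::{real_normed_field,euclidean_space}"
  assumes f: "f \<in> LP M 1" and g: "g \<in> LP M 1" and h: "h \<in> LP M p" and p: "1 \<le> p"
  shows "AE s in M. cv M f (cv M g h) s = cv M (cv M f g) h s"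
proof -
  have [measurable]: "f \<in> borel_measurable borel" "g \<in> borel_measurable borel" "h \<in> borel_measurable borel"
    using LP_measurable[OF f] LP_measurable[OF g] LP_measurable[OF h] by simp_all
  define k where "k = cv M (\<lambda>x. norm (g x)) (\<lambda>x. norm (h x))"
  have k: "k \<in> LP M p"
    unfolding k_def by (rule cv_powr_bound(2)[OF LP_norm[OF g] LP_norm[OF h] p])
  \<comment> \<open>This holds only almost everywhere in \<open>x\<close>; it is evaluated at
    \<open>- t + s\<close> by \<open>AE_conv_arg\<close>.\<close>
  have AEk: "AE x in M. ennreal (k x) = (\<integral>\<^sup>+u. ennreal (norm (g u) * norm (h (- u + x))) \<partial>M)"
    using cv_powr_bound(1)[OF LP_norm[OF g] LP_norm[OF h] p]
    by eventually_elim (simp add: k_def cv_def nn_integral_eq_integral)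
  show ?thesis
    using cv_powr_bound(1)[OF LP_norm[OF f] k p]
  proof eventually_elim
    case (elim s)
    define K where "K z = f (fst z) * g (- fst z + snd z) * h (- snd z + s)" for z
    have [measurable]: "(\<lambda>z. - fst z + snd z) \<in> borel_measurable (borel :: ('g \<times> 'g) measure)"
      by (intro borel_measurable_continuous_onI continuous_intros)
    have Km: "K \<in> borel_measurable borel" unfolding K_def by measurable
    let ?A = "{x. f x \<noteq> 0}"
    let ?B = "{a + b |a b. a \<in> ?A \<and> b \<in> {x. g x \<noteq> 0}}"
    have sup: "K (t, u) = 0" if "u \<notin> ?B" for t u
    proof (rule ccontr)
      assume "K (t, u) \<noteq> 0"
      then have "t + (- t + u) \<in> ?B" by (fastforce simp: K_def)
      moreover have "t + (- t + u) = u" by (simp add: add.assoc[symmetric])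
      ultimately show False using that by (simp only:)
    qed
    have tr: "(LINT u|M. g u * h (- u + (- t + s))) = (LINT u|M. g (- t + u) * h (- u + s))" for t
      using integral_translate[of "\<lambda>u. g (- t + u) * h (- u + s)" t]
      by (simp add: add.assoc[symmetric] minus_add)
    have trn: "(\<integral>\<^sup>+u. ennreal (norm (g u) * norm (h (- u + (- t + s)))) \<partial>M) =
        (\<integral>\<^sup>+u. ennreal (norm (g (- t + u)) * norm (h (- u + s))) \<partial>M)" for t
      using nn_integral_translate[of "\<lambda>u. ennreal (norm (g (- t + u)) * norm (h (- u + s)))" t]
      by (simp add: add.assoc[symmetric] minus_add)
    have "(\<integral>\<^sup>+t. \<integral>\<^sup>+u. ennreal (norm (K (t, u))) \<partial>M \<partial>M) =
        (\<integral>\<^sup>+t. ennreal (norm (f t)) * (\<integral>\<^sup>+u. ennreal (norm (g u) * norm (h (- u + (- t + s)))) \<partial>M) \<partial>M)"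
      by (simp only: trn) (simp add: K_def norm_mult mult.assoc ennreal_mult nn_integral_cmult)
    also have "\<dots> = (\<integral>\<^sup>+t. ennreal (norm (f t)) * ennreal (k (- t + s)) \<partial>M)"
      using AE_conv_arg[OF AEk, of s] by (intro nn_integral_cong_AE) (auto elim!: eventually_mono)
    also have "\<dots> = (\<integral>\<^sup>+t. ennreal (norm (norm (f t) * k (- t + s))) \<partial>M)"
    proof (rule nn_integral_cong)
      have "0 \<le> k x" for x by (auto simp: k_def cv_def)
      then show "ennreal (norm (f t)) * ennreal (k (- t + s)) = ennreal (norm (norm (f t) * k (- t + s)))" for t
        by (simp add: ennreal_mult)
    qed
    also have "\<dots> < \<infinity>" using elim by (simp add: integrable_iff_bounded)
    finally have fin: "(\<integral>\<^sup>+t. \<integral>\<^sup>+u. ennreal (norm (K (t, u))) \<partial>M \<partial>M) < \<infinity>" .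
    have "cv M f (cv M g h) s = (LINT t|M. f t * (LINT u|M. g (- t + u) * h (- u + s)))"
      by (simp add: cv_def tr)
    also have "\<dots> = (LINT t|M. LINT u|M. K (t, u))"
      by (simp add: K_def mult.assoc)
    also have "\<dots> = (LINT u|M. LINT t|M. K (t, u))"
      by (rule fubini[OF Km LP_sigma_bounded[OF f] _ sigma_bounded_sum[OF LP_sigma_bounded[OF f] LP_sigma_bounded[OF g]] sup fin])
        (auto simp: K_def)
    also have "\<dots> = cv M (cv M f g) h s"
      by (simp add: K_def cv_def)
    finally show ?case .
  qed
qed

end

section \<open>The modulus of a convolution operator\<close>

lemma LP_of_real:
  fixes g :: "'a \<Rightarrow> real"
  assumes "g \<in> LP M p"
  shows "(\<lambda>x. of_real (g x) :: 'b::{real_normed_field,euclidean_space}) \<in> LP M p"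
  using assms by (auto simp: LP_def)

context haar_measure
begin

lemma cv_add_right:
  fixes f g h :: "'g \<Rightarrow> 'b::{real_normed_field,euclidean_space}"
  assumes "f \<in> LP M 1" "g \<in> LP M p" "h \<in> LP M p" "1 \<le> p"
  shows "AE s in M. cv M f (\<lambda>x. g x + h x) s = cv M f g s + cv M f h s"
  using cv_powr_bound(1)[OF assms(1,2,4)] cv_powr_bound(1)[OF assms(1,3,4)]
  by eventually_elim (simp add: cv_def distrib_left)

lemma cv_add_left:
  fixes f g h :: "'g \<Rightarrow> 'b::{real_normed_field,euclidean_space}"
  assumes "f \<in> LP M 1" "g \<in> LP M 1" "h \<in> LP M p" "1 \<le> p"
  shows "AE s in M. cv M (\<lambda>x. f x + g x) h s = cv M f h s + cv M g h s"
  using cv_powr_bound(1)[OF assms(1,3,4)] cv_powr_bound(1)[OF assms(2,3,4)]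
  by eventually_elim (simp add: cv_def distrib_right)

lemma cv_mult_left: "cv M (\<lambda>x. c * f x) g s = c * cv M f g s"
  by (simp add: cv_def mult.assoc)

lemma cv_mult_right: "cv M f (\<lambda>x. c * g x) s = c * cv M f g s"
  by (simp add: cv_def mult.left_commute)

lemma cv_mono:
  fixes f g f' g' :: "'g \<Rightarrow> real"
  assumes "f \<in> LP M 1" "g \<in> LP M p" "f' \<in> LP M 1" "g' \<in> LP M p" "1 \<le> p"
    and "\<And>x. 0 \<le> f x" "\<And>x. f x \<le> f' x" "\<And>x. 0 \<le> g x" "\<And>x. g x \<le> g' x"
  shows "AE s in M. cv M f g s \<le> cv M f' g' s"
  using cv_powr_bound(1)[OF assms(1,2,5)] cv_powr_bound(1)[OF assms(3,4,5)]
proof eventually_elim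
  case (elim s)
  then show ?case
    unfolding cv_def using assms(6-9) by (intro integral_mono mult_mono) (auto intro: order_trans)
qed

lemma norm_cv_le:
  fixes f g :: "'g \<Rightarrow> 'b::{real_normed_field,euclidean_space}"
  shows "norm (cv M f g s) \<le> cv M (\<lambda>x. norm (f x)) (\<lambda>x. norm (g x)) s"
  using integral_norm_bound[of M "\<lambda>t. f t * g (- t + s)"] by (simp add: cv_def norm_mult)

section \<open>Approximation by separated functions\<close>

text \<open>The measure is inner regular on open sets, and \<open>A\<close> is arbitrary. Take an
  open \<open>U\<close> around \<open>A\<close>, a compact \<open>K\<close> in \<open>U\<close> of
  almost full measure, and an open \<open>W\<close> of small measure around \<open>U - A\<close>;
  then \<open>K - W\<close> is compact and lies in \<open>A\<close>.\<close>

lemma inner_regular_finite: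
  assumes A: "A \<in> sets borel" "emeasure M A < \<infinity>" and e: "0 < (e::real)"
  obtains K where "compact K" "K \<subseteq> A" "emeasure M (A - K) < ennreal e"
proof -
  \<comment> \<open>Two errors of size \<open>d\<close> occur, from \<open>U - K\<close> and from
    \<open>W\<close>; the remaining third keeps the final inequality strict.\<close>
  define d where "d = e / 3"
  have d: "0 < d" "d + d < e" using e by (auto simp: d_def)
  have Afin: "emeasure M A \<noteq> \<infinity>" using A by auto
  have "emeasure M A < emeasure M A + ennreal d"
    using A d by (cases "emeasure M A") (auto simp: ennreal_plus[symmetric] ennreal_less_iff simp del: ennreal_plus)
  then obtain U where U: "open U" "A \<subseteq> U" "emeasure M U < emeasure M A + ennreal d"
    using outer_regular_less[OF A(1)] by metis
  have Ub: "U \<in> sets borel" using U by auto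
  have "emeasure M A + ennreal d < \<infinity>" using A by (simp add: less_top)
  with U(3) have Ufin: "emeasure M U \<noteq> \<infinity>" by (metis order_less_trans less_irrefl)
  have "emeasure M (U - A) = emeasure M U - emeasure M A"
    using A U Ub Afin by (intro emeasure_Diff) auto
  also have "\<dots> < ennreal d"
    using U Afin A Ub by (subst minus_less_iff_ennreal) (auto simp: less_top add.commute intro!: emeasure_mono)
  finally have "emeasure M (U - A) < ennreal d" .
  moreover have "U - A \<in> sets borel" using A Ub by auto
  ultimately obtain W where W: "open W" "U - A \<subseteq> W" "emeasure M W < ennreal d"
    using outer_regular_less by metis
  obtain K where K: "compact K" "K \<subseteq> U" "emeasure M U < emeasure M K + ennreal d"
    using inner_regular_on_open_approx[OF inner_regular U(1) Ufin d(1)] .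
  have "emeasure M (U - K) = emeasure M U - emeasure M K"
    using K U emeasure_compact_less_top[OF K(1)] by (intro emeasure_Diff) (auto simp: borel_compact)
  also have "\<dots> < ennreal d"
    using K U emeasure_compact_less_top[OF K(1)]
    by (subst minus_less_iff_ennreal) (auto simp: less_top add.commute intro!: emeasure_mono)
  finally have UK: "emeasure M (U - K) < ennreal d" .
  show thesis
  proof
    show "compact (K - W)" using K W by (intro compact_diff) auto
    show "K - W \<subseteq> A" using K W by auto
    have m: "U - K \<in> sets M" "W \<in> sets M" using Ub W(1) K(1) by (auto simp: borel_compact)
    have "emeasure M (A - (K - W)) \<le> emeasure M ((U - K) \<union> W)"
      using U by (intro emeasure_mono sets.Un m) auto
    also have "\<dots> \<le> emeasure M (U - K) + emeasure M W"
      by (rule emeasure_subadditive[OF m])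
    also have "\<dots> \<le> ennreal d + ennreal d"
      using UK W(3) by (intro add_mono) auto
    also have "\<dots> < ennreal e"
      using d by (simp add: ennreal_plus[symmetric] ennreal_less_iff del: ennreal_plus)
    finally show "emeasure M (A - (K - W)) < ennreal e" .
  qed
qed

text \<open>For \<open>y \<noteq> z\<close> the set \<open>- K y + K z\<close> is compact and misses
  0 by disjointness. There are finitely many such sets, so continuity of \<open>v - w\<close> at the
  origin gives one \<open>V\<close> with \<open>V - V\<close> disjoint from all of them.\<close>

lemma separate_compact_family:
  fixes K :: "'i \<Rightarrow> 'g set"
  assumes Y: "finite Y" and K: "\<And>y. y \<in> Y \<Longrightarrow> compact (K y)"
    and disj: "\<And>y z. y \<in> Y \<Longrightarrow> z \<in> Y \<Longrightarrow> y \<noteq> z \<Longrightarrow> K y \<inter> K z = {}"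
  obtains V where "open V" "0 \<in> V"
    "\<And>y z s t v w. y \<in> Y \<Longrightarrow> z \<in> Y \<Longrightarrow> s \<in> K y \<Longrightarrow> t \<in> K z \<Longrightarrow> v \<in> V \<Longrightarrow> w \<in> V \<Longrightarrow> - s + t = v - w \<Longrightarrow> y = z"
proof -
  define D where "D = (\<lambda>(y, z). (\<lambda>x. - fst x + snd x) ` (K y \<times> K z))"
  define P where "P = {(y, z) \<in> Y \<times> Y. y \<noteq> z}"
  define N where "N = (\<Inter>i\<in>P. - D i)"
  have "compact (D i)" if "i \<in> P" for i
    using that K by (auto simp: D_def P_def intro!: compact_continuous_image compact_Times continuous_intros)
  moreover have "finite P"
    by (rule finite_subset[OF _ finite_cartesian_product[OF Y Y]]) (auto simp: P_def)
  ultimately have "open N"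
    unfolding N_def by (intro open_INT) (auto simp: compact_imp_closed)
  then have "open ((\<lambda>z. fst z - snd z) -` N)"
    by (intro open_vimage continuous_intros)
  moreover have "(0, 0) \<in> (\<lambda>z. fst z - snd z) -` N"
  proof -
    have "0 \<notin> D i" if i: "i \<in> P" for i
    proof
      assume "0 \<in> D i"
      then obtain y z s t where *: "i = (y, z)" "s \<in> K y" "t \<in> K z" "0 = - s + t"
        by (cases i) (auto simp: D_def)
      then have "s = t" by (metis add.right_neutral add_minus_cancel)
      with * i disj[of y z] show False by (auto simp: P_def)
    qed
    then show ?thesis by (auto simp: N_def)
  qed
  ultimately obtain A B where AB: "open A" "open B" "(0, 0) \<in> A \<times> B" "A \<times> B \<subseteq> (\<lambda>z. fst z - snd z) -` N"
    by (rule open_prod_elim)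
  show thesis
  proof
    show "open (A \<inter> B)" "0 \<in> A \<inter> B" using AB by auto
    fix y z s t v w
    assume *: "y \<in> Y" "z \<in> Y" "s \<in> K y" "t \<in> K z" "v \<in> A \<inter> B" "w \<in> A \<inter> B" "- s + t = v - w"
    show "y = z"
    proof (rule ccontr)
      assume "y \<noteq> z"
      with * have "(y, z) \<in> P" by (auto simp: P_def)
      moreover have "- s + t \<in> D (y, z)" using * by (force simp: D_def)
      moreover have "v - w \<in> N" using AB * by auto
      ultimately show False using * by (auto simp: N_def)
    qed
  qed
qed

text \<open>A simple function close to \<open>f\<close> has finitely many level sets with non-zero
  value. Shrinking them to compact sets changes little in norm and makes
  \<open>separate_compact_family\<close> applicable.\<close>

lemma approx_separated:
  fixes f :: "'g \<Rightarrow> 'b::{real_normed_field,euclidean_space}"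
  assumes f: "f \<in> LP M 1" and e: "0 < (e::real)"
  obtains \<phi> V where "\<phi> \<in> LP M 1" "(\<integral>\<^sup>+x. ennreal (norm (f x - \<phi> x)) \<partial>M) < ennreal e" "open V" "0 \<in> V"
    "\<And>s t v w. \<phi> s \<noteq> 0 \<Longrightarrow> \<phi> t \<noteq> 0 \<Longrightarrow> v \<in> V \<Longrightarrow> w \<in> V \<Longrightarrow> - s + t = v - w \<Longrightarrow> \<phi> s = \<phi> t"
proof -
  have [measurable]: "f \<in> borel_measurable borel" using LP_measurable[OF f] by simp
  have "integrable M f" using f by (simp add: LP_one_iff)
  then obtain x where "has_bochner_integral M f x" by (auto simp: integrable.simps)
  \<comment> \<open>The definition of the integral provides simple functions, with supports of
    finite measure, that converge to \<open>f\<close> in the norm of the integrable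
    functions.\<close>
  then obtain S where S: "\<And>i. Bochner_Integration.simple_bochner_integrable M (S i)"
    "(\<lambda>i. \<integral>\<^sup>+x. ennreal (norm (f x - S i x)) \<partial>M) \<longlonglongrightarrow> 0"
    by (auto elim!: has_bochner_integral.cases)
  have "0 < ennreal (e / 2)" using e by simp
  then have "eventually (\<lambda>i. (\<integral>\<^sup>+x. ennreal (norm (f x - S i x)) \<partial>M) < ennreal (e / 2)) sequentially"
    by (rule order_tendstoD(2)[OF S(2)])
  then obtain i where i: "(\<integral>\<^sup>+x. ennreal (norm (f x - S i x)) \<partial>M) < ennreal (e / 2)"
    by (auto simp: eventually_sequentially)
  define u where "u = S i"
  have u: "simple_function M u" "emeasure M {x. u x \<noteq> 0} \<noteq> \<infinity>"
    using S(1)[of i] by (auto simp: u_def elim: Bochner_Integration.simple_bochner_integrable.cases)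
  have um[measurable]: "u \<in> borel_measurable borel"
    using borel_measurable_simple_function[OF u(1)] by simp
  \<comment> \<open>The value 0 is left out: its level set may have infinite measure.\<close>
  define Y where "Y = range u - {0}"
  have Y: "finite Y" using simple_functionD(1)[OF u(1)] by (simp add: Y_def)
  \<comment> \<open>Half of \<open>e\<close> is shared among the values in \<open>Y\<close>. Losing
    a set from the level \<open>y\<close> costs \<open>norm y\<close> times its measure, hence the
    tolerance \<open>d / norm y\<close> below. The added 1 covers empty \<open>Y\<close>.\<close>
  define d where "d = e / (2 * (real (card Y) + 1))"
  have d: "0 < d" "real (card Y) * d \<le> e / 2" using e by (auto simp: d_def field_simps)
  have ub: "u -` {y} \<in> sets borel" for y
    using measurable_sets[OF um, of "{y}"] by simp
  have "\<exists>K. compact K \<and> K \<subseteq> u -` {y} \<and> emeasure M (u -` {y} - K) < ennreal (d / norm y)"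
    if y: "y \<in> Y" for y
  proof -
    have "emeasure M (u -` {y}) \<le> emeasure M {x. u x \<noteq> 0}"
      using y um by (intro emeasure_mono) (auto simp: Y_def)
    then have fin: "emeasure M (u -` {y}) < \<infinity>" using u(2) by (simp add: less_top top_unique)
    have "0 < d / norm y" using d y by (auto simp: Y_def)
    from inner_regular_finite[OF ub fin this] show ?thesis by metis
  qed
  then obtain K where K: "\<And>y. y \<in> Y \<Longrightarrow> compact (K y)" "\<And>y. y \<in> Y \<Longrightarrow> K y \<subseteq> u -` {y}"
    "\<And>y. y \<in> Y \<Longrightarrow> emeasure M (u -` {y} - K y) < ennreal (d / norm y)" by metis
  have "K y \<inter> K z = {}" if "y \<in> Y" "z \<in> Y" "y \<noteq> z" for y z
    using K(2)[OF that(1)] K(2)[OF that(2)] that(3) by auto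
  with Y K(1) obtain V where V: "open V" "0 \<in> V"
    "\<And>y z s t v w. y \<in> Y \<Longrightarrow> z \<in> Y \<Longrightarrow> s \<in> K y \<Longrightarrow> t \<in> K z \<Longrightarrow> v \<in> V \<Longrightarrow> w \<in> V \<Longrightarrow> - s + t = v - w \<Longrightarrow> y = z"
    by (rule separate_compact_family[of Y K]) metis+
  define \<phi> where "\<phi> x = (if x \<in> (\<Union>y\<in>Y. K y) then u x else 0)" for x
  have Kb: "K y \<in> sets borel" if "y \<in> Y" for y using K(1)[OF that] by (simp add: borel_compact)
  have Lb[measurable]: "(\<Union>y\<in>Y. K y) \<in> sets borel" using Y Kb by (intro sets.finite_UN) auto
  have \<phi>m[measurable]: "\<phi> \<in> borel_measurable borel" unfolding \<phi>_def by measurable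
  have \<phi>: "u t \<in> Y \<and> t \<in> K (u t) \<and> \<phi> t = u t" if "\<phi> t \<noteq> 0" for t
  proof -
    from that obtain y where "y \<in> Y" "t \<in> K y" "\<phi> t = u t" by (auto simp: \<phi>_def split: if_splits)
    with K(2)[of y] show ?thesis by auto
  qed
  have "ennreal (norm (u x - \<phi> x)) \<le> (\<Sum>y\<in>Y. ennreal (norm y) * indicator (u -` {y} - K y) x)" for x
  proof (cases "u x \<in> Y \<and> x \<notin> K (u x)")
    case True
    then have "\<phi> x = 0" using \<phi>[of x] by auto
    then have "ennreal (norm (u x - \<phi> x)) = (\<Sum>y\<in>{u x}. ennreal (norm y) * indicator (u -` {y} - K y) x)"
      using True by simp
    also have "\<dots> \<le> (\<Sum>y\<in>Y. ennreal (norm y) * indicator (u -` {y} - K y) x)"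
      using True Y by (intro sum_mono2) auto
    finally show ?thesis .
  next
    case False
    then have "\<phi> x = u x" by (auto simp: \<phi>_def Y_def)
    then show ?thesis by simp
  qed
  then have "(\<integral>\<^sup>+x. ennreal (norm (u x - \<phi> x)) \<partial>M) \<le>
      (\<integral>\<^sup>+x. (\<Sum>y\<in>Y. ennreal (norm y) * indicator (u -` {y} - K y) x) \<partial>M)"
    by (intro nn_integral_mono) auto
  also have "\<dots> = (\<Sum>y\<in>Y. ennreal (norm y) * emeasure M (u -` {y} - K y))"
    using ub Kb by (subst nn_integral_sum) (auto intro!: sum.cong nn_integral_cmult_indicator)
  also have "\<dots> \<le> (\<Sum>y\<in>Y. ennreal d)"
  proof (rule sum_mono)
    fix y assume y: "y \<in> Y"
    have "ennreal (norm y) * emeasure M (u -` {y} - K y) \<le> ennreal (norm y) * ennreal (d / norm y)"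
      using K(3)[OF y] by (intro mult_left_mono) auto
    also have "\<dots> = ennreal d" using y by (simp add: ennreal_mult'[symmetric] Y_def)
    finally show "ennreal (norm y) * emeasure M (u -` {y} - K y) \<le> ennreal d" .
  qed
  also have "\<dots> = ennreal (real (card Y) * d)" using d by (simp add: ennreal_mult ennreal_of_nat_eq_real_of_nat)
  also have "\<dots> \<le> ennreal (e / 2)" using d by (intro ennreal_leI) simp
  finally have u\<phi>: "(\<integral>\<^sup>+x. ennreal (norm (u x - \<phi> x)) \<partial>M) \<le> ennreal (e / 2)" .
  have "(\<integral>\<^sup>+x. ennreal (norm (f x - \<phi> x)) \<partial>M) \<le>
      (\<integral>\<^sup>+x. ennreal (norm (f x - u x)) + ennreal (norm (u x - \<phi> x)) \<partial>M)"
    using norm_triangle_ineq[of "f x - u x" "u x - \<phi> x" for x]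
    by (intro nn_integral_mono) (simp add: ennreal_plus[symmetric] del: ennreal_plus)
  also have "\<dots> = (\<integral>\<^sup>+x. ennreal (norm (f x - u x)) \<partial>M) + (\<integral>\<^sup>+x. ennreal (norm (u x - \<phi> x)) \<partial>M)"
    by (rule nn_integral_add) auto
  also have "\<dots> \<le> ennreal (e / 2) + (\<integral>\<^sup>+x. ennreal (norm (f x - u x)) \<partial>M)"
    unfolding add.commute[of "\<integral>\<^sup>+x. ennreal (norm (f x - u x)) \<partial>M"] by (intro add_right_mono u\<phi>)
  also have "\<dots> < ennreal (e / 2) + ennreal (e / 2)"
    using i by (simp add: ennreal_add_left_cancel_less u_def)
  also have "\<dots> = ennreal e" using e by (simp add: ennreal_plus[symmetric] del: ennreal_plus)
  finally have lt: "(\<integral>\<^sup>+x. ennreal (norm (f x - \<phi> x)) \<partial>M) < ennreal e" .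
  have "integrable M (\<lambda>x. f x - \<phi> x)"
    using lt by (simp add: integrable_iff_bounded order_less_trans[OF _ ennreal_less_top])
  from Bochner_Integration.integrable_diff[OF \<open>integrable M f\<close> this]
  have \<phi>L: "\<phi> \<in> LP M 1" by (simp add: LP_one_iff)
  have sep: "\<phi> s = \<phi> t" if "\<phi> s \<noteq> 0" "\<phi> t \<noteq> 0" "v \<in> V" "w \<in> V" "- s + t = v - w" for s t v w
    using V(3)[of "u s" "u t" s t v w] \<phi>[OF that(1)] \<phi>[OF that(2)] that(3-5) by auto
  show thesis by (rule that[of \<phi> V]) (fact \<phi>L lt V(1) V(2) sep)+
qed

section \<open>Upper bounds of a convolution operator dominate the one of the modulus\<close>

lemma cv_nonneg: "(\<And>x. 0 \<le> f x) \<Longrightarrow> (\<And>x. 0 \<le> g x) \<Longrightarrow> 0 \<le> cv M f (g :: 'g \<Rightarrow> real) s"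
  by (auto simp: cv_def intro!: integral_nonneg_AE)

text \<open>If \<open>g\<close> lives on \<open>V + a\<close>, then the points \<open>t\<close> with \<open>g (- t + s) \<noteq> 0\<close> differ by elements of
  \<open>V - V\<close>, so that \<open>\<phi>\<close> takes at most one non-zero value on them.\<close>

lemma norm_cv_separated:
  fixes \<phi> :: "'g \<Rightarrow> 'b::{real_normed_field,euclidean_space}"
  assumes sep: "\<And>s t v w. \<phi> s \<noteq> 0 \<Longrightarrow> \<phi> t \<noteq> 0 \<Longrightarrow> v \<in> V \<Longrightarrow> w \<in> V \<Longrightarrow> - s + t = v - w \<Longrightarrow> \<phi> s = \<phi> t"
    and g: "\<And>x. 0 \<le> g x" "\<And>x. g x \<noteq> 0 \<Longrightarrow> x - a \<in> V"
    and int: "integrable M (\<lambda>t. \<phi> t * of_real (g (- t + s)))"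
  shows "cv M (\<lambda>x. norm (\<phi> x)) g s = norm (cv M \<phi> (\<lambda>x. of_real (g x)) s)"
proof -
  have "\<exists>c. \<forall>t. \<phi> t \<noteq> 0 \<longrightarrow> g (- t + s) \<noteq> 0 \<longrightarrow> \<phi> t = c"
  proof (cases "\<exists>t. \<phi> t \<noteq> 0 \<and> g (- t + s) \<noteq> 0")
    case True
    then obtain t0 where t0: "\<phi> t0 \<noteq> 0" "g (- t0 + s) \<noteq> 0" by auto
    have "\<phi> t = \<phi> t0" if t: "\<phi> t \<noteq> 0" "g (- t + s) \<noteq> 0" for t
    proof (rule sep[OF t(1) t0(1) g(2)[OF t(2)] g(2)[OF t0(2)]])
      show "- t + t0 = - t + s - a - (- t0 + s - a)"
        by (simp add: diff_conv_add_uminus minus_add add.assoc del: add_uminus_conv_diff)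
    qed
    then show ?thesis by blast
  qed blast
  then obtain c where c: "\<And>t. \<phi> t \<noteq> 0 \<Longrightarrow> g (- t + s) \<noteq> 0 \<Longrightarrow> \<phi> t = c" by blast
  have "integrable M (\<lambda>t. norm (\<phi> t * of_real (g (- t + s))))"
    using int by (rule integrable_norm)
  then have i: "integrable M (\<lambda>t. norm (\<phi> t) * g (- t + s))"
    using g(1) by (simp add: norm_mult)
  \<comment> \<open>The integrand is a nonnegative real function times a fixed vector of norm 1, so
    integration loses nothing of the norm. If \<open>c = 0\<close>, the integrand vanishes
    identically.\<close>
  have eq: "\<phi> t * of_real (g (- t + s)) = (norm (\<phi> t) * g (- t + s)) *\<^sub>R (c /\<^sub>R norm c)" for t
    using c[of t] by (cases "\<phi> t = 0 \<or> g (- t + s) = 0") (auto simp: of_real_def field_simps)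
  have "cv M \<phi> (\<lambda>x. of_real (g x)) s = cv M (\<lambda>x. norm (\<phi> x)) g s *\<^sub>R (c /\<^sub>R norm c)"
    unfolding cv_def eq using i by (rule integral_scaleR_left)
  then have n: "norm (cv M \<phi> (\<lambda>x. of_real (g x)) s) = cv M (\<lambda>x. norm (\<phi> x)) g s * norm (c /\<^sub>R norm c)"
    using cv_nonneg[of "\<lambda>x. norm (\<phi> x)" g s] g(1) by simp
  show ?thesis
  proof (cases "c = 0")
    case True
    then have z: "norm (\<phi> t) * g (- t + s) = 0" for t using c[of t] by auto
    have "cv M (\<lambda>x. norm (\<phi> x)) g s = 0" by (simp only: cv_def z Bochner_Integration.integral_zero)
    with n show ?thesis by simp
  qed (simp add: n)
qed

text \<open>The sets \<open>{y. y - x \<in> V}\<close> are the right translates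
  \<open>V + x\<close>, which are open and contain \<open>x\<close>; finitely many cover each
  compact set.\<close>

lemma sigma_bounded_translate_cover:
  fixes V :: "'g set"
  assumes A: "sigma_bounded A" and V: "open V" "0 \<in> V"
  obtains x :: "nat \<Rightarrow> 'g" where "A \<subseteq> (\<Union>i. {y. y - x i \<in> V})"
proof -
  obtain \<K> where K: "countable \<K>" "\<forall>K\<in>\<K>. compact K" "A \<subseteq> \<Union>\<K>"
    using A unfolding sigma_bounded_def by blast
  have op: "open {y. y - x \<in> V}" for x
    using open_vimage[OF V(1), of "\<lambda>y. y - x"] by (simp add: vimage_def continuous_intros)
  have "\<exists>F. finite F \<and> K \<subseteq> (\<Union>x\<in>F. {y. y - x \<in> V})" if L: "K \<in> \<K>" for K
  proof -
    have c: "compact K" using K(2) L by blast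
    have cov: "K \<subseteq> (\<Union>x\<in>K. {y. y - x \<in> V})" using V(2) by auto
    obtain F where "F \<subseteq> K" "finite F" "K \<subseteq> (\<Union>x\<in>F. {y. y - x \<in> V})"
      by (rule compactE_image[OF c op cov])
    then show ?thesis by auto
  qed
  then obtain F where F: "\<And>K. K \<in> \<K> \<Longrightarrow> finite (F K)" "\<And>K. K \<in> \<K> \<Longrightarrow> K \<subseteq> (\<Union>x\<in>F K. {y. y - x \<in> V})"
    by metis
  define X where "X = insert 0 (\<Union>K\<in>\<K>. F K)"
  have X: "countable X" "X \<noteq> {}" using K(1) F(1) by (auto simp: X_def intro: countable_finite)
  show thesis
  proof (rule that[of "from_nat_into X"])
    show "A \<subseteq> (\<Union>i. {y. y - from_nat_into X i \<in> V})"
    proof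
      fix y assume "y \<in> A"
      then obtain L where L: "L \<in> \<K>" "y \<in> L" using K(3) by auto
      then obtain x where "x \<in> F L" "y - x \<in> V" using F(2)[OF L(1)] by auto
      moreover from this L have "x \<in> X" by (auto simp: X_def)
      then obtain i where "from_nat_into X i = x"
        using from_nat_into_surj[OF X(1)] by blast
      ultimately show "y \<in> (\<Union>i. {y. y - from_nat_into X i \<in> V})" by auto
    qed
  qed
qed

text \<open>On the pieces \<open>g 1\<^bsub>A i\<^esub>\<close> of a partition into small sets, \<open>|\<phi>| \<star> g 1\<^bsub>A i\<^esub> = |\<phi> \<star> g 1\<^bsub>A i\<^esub>|\<close>,
  and the errors of replacing \<open>f\<close> by \<open>\<phi>\<close> add up to at most \<open>2 |f - \<phi>| \<star> g\<close>.\<close>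

lemma cv_norm_le_approx:
  fixes f :: "'g \<Rightarrow> 'b::{real_normed_field,euclidean_space}"
  assumes f: "f \<in> LP M 1" and p: "1 \<le> p"
    and T_add: "\<And>g h. g \<in> LP M p \<Longrightarrow> h \<in> LP M p \<Longrightarrow> (\<And>x. 0 \<le> g x) \<Longrightarrow> (\<And>x. 0 \<le> h x) \<Longrightarrow>
      AE s in M. T (\<lambda>x. g x + h x) s = T g s + T h s"
    and T_ge: "\<And>g. g \<in> LP M p \<Longrightarrow> (\<And>x. 0 \<le> g x) \<Longrightarrow>
      AE s in M. norm (cv M f (\<lambda>x. of_real (g x)) s) \<le> (T g s :: real)"
    and g: "g \<in> LP M p" "\<And>x. 0 \<le> g x"
    and \<phi>: "\<phi> \<in> LP M 1" and V: "open V" "0 \<in> V"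
    and sep: "\<And>s t v w. \<phi> s \<noteq> 0 \<Longrightarrow> \<phi> t \<noteq> 0 \<Longrightarrow> v \<in> V \<Longrightarrow> w \<in> V \<Longrightarrow> - s + t = v - w \<Longrightarrow> \<phi> s = \<phi> t"
  shows "AE s in M. cv M (\<lambda>x. norm (f x)) g s \<le> T g s + 2 * cv M (\<lambda>x. norm (f x - \<phi> x)) g s"
proof -
  have [measurable]: "f \<in> borel_measurable borel" "g \<in> borel_measurable borel" "\<phi> \<in> borel_measurable borel"
    using LP_measurable[OF f] LP_measurable[OF g(1)] LP_measurable[OF \<phi>] by simp_all
  obtain x :: "nat \<Rightarrow> 'g" where x: "{y. g y \<noteq> 0} \<subseteq> (\<Union>i. {y. y - x i \<in> V})"
    using sigma_bounded_translate_cover[OF LP_sigma_bounded[OF g(1)] V] .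
  define A where "A = disjointed (\<lambda>i. {y. y - x i \<in> V})"
  have "open {y. y - x i \<in> V}" for i
    using open_vimage[OF V(1), of "\<lambda>y. y - x i"] by (simp add: vimage_def continuous_intros)
  then have "range A \<subseteq> sets borel"
    unfolding A_def by (intro sets.range_disjointed_sets) auto
  then have Ab[measurable]: "A i \<in> sets borel" for i by auto
  have A_sub: "y - x i \<in> V" if "y \<in> A i" for y i
    using that disjointed_subset[of "\<lambda>i. {y. y - x i \<in> V}" i] by (auto simp: A_def)
  have A_disj: "A i \<inter> A j = {}" if "i \<noteq> j" for i j
    using disjoint_family_disjointed[of "\<lambda>i. {y. y - x i \<in> V}"] that by (auto simp: A_def disjoint_family_on_def)
  have A_cov: "{y. g y \<noteq> 0} \<subseteq> (\<Union>i. A i)"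
    using x UN_disjointed_eq[of "\<lambda>i. {y. y - x i \<in> V}"] by (simp add: A_def)
  define B where "B n = (\<Union>i<n. A i)" for n
  have Bb[measurable]: "B n \<in> sets borel" for n unfolding B_def by measurable
  define gi where "gi i y = indicator (A i) y * g y" for i y
  define h where "h n y = indicator (B n) y * g y" for n y
  define r where "r n y = indicator (- B n) y * g y" for n y
  have LPs: "gi i \<in> LP M p" "h n \<in> LP M p" "r n \<in> LP M p" for i n
    unfolding gi_def h_def r_def using p
    by (auto intro!: LP_indicator[OF g(1), simplified])
  have nonneg: "0 \<le> gi i y" "0 \<le> h n y" "0 \<le> r n y" for i n y
    using g(2) by (auto simp: gi_def h_def r_def)
  have h_le: "h n y \<le> g y" for n y using g(2)[of y] by (auto simp: h_def indicator_def)
  have h_Suc: "h (Suc n) = (\<lambda>y. h n y + gi n y)" for n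
  proof
    fix y
    have "y \<notin> B n" if "y \<in> A n"
    proof
      assume "y \<in> B n"
      then obtain i where "i < n" "y \<in> A i" by (auto simp: B_def)
      with that A_disj[of i n] show False by auto
    qed
    then show "h (Suc n) y = h n y + gi n y"
      by (auto simp: h_def gi_def B_def indicator_def lessThan_Suc)
  qed
  have g_split: "g = (\<lambda>y. h n y + r n y)" for n
    by (auto simp: h_def r_def indicator_def)
  let ?F = "\<lambda>x. norm (f x)" and ?D = "\<lambda>x. norm (f x - \<phi> x)"
  have fL: "?F \<in> LP M 1" "?D \<in> LP M 1" "(\<lambda>x. norm (\<phi> x)) \<in> LP M 1" "(\<lambda>x. f x - \<phi> x) \<in> LP M 1"
    using f \<phi> by (auto simp: LP_one_iff)
  have T_nonneg: "AE s in M. 0 \<le> T g' s" if "g' \<in> LP M p" "\<And>x. 0 \<le> g' x" for g'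
    using T_ge[OF that] by eventually_elim (rule order_trans[OF norm_ge_zero])
  have piece: "AE s in M. cv M ?F (gi i) s \<le> T (gi i) s + 2 * cv M ?D (gi i) s" for i
  proof -
    let ?g = "\<lambda>x. of_real (gi i x) :: 'b"
    have g'L: "?g \<in> LP M p" by (rule LP_of_real[OF LPs(1)])
    note ints = cv_powr_bound(1)[OF f g'L p] cv_powr_bound(1)[OF \<phi> g'L p]
      cv_powr_bound(1)[OF fL(1) LPs(1)[of i] p] cv_powr_bound(1)[OF fL(2) LPs(1)[of i] p]
      cv_powr_bound(1)[OF fL(3) LPs(1)[of i] p] cv_powr_bound(1)[OF fL(4) g'L p]
    show ?thesis
      using T_ge[OF LPs(1)[of i] nonneg(1)] ints
    proof eventually_elim
      case (elim s)
      have 1: "cv M (\<lambda>x. norm (\<phi> x)) (gi i) s = norm (cv M \<phi> ?g s)"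
        by (rule norm_cv_separated[OF sep, where a="x i" and V=V])
          (use elim nonneg(1) A_sub[of _ i] in \<open>auto simp: gi_def indicator_def split: if_splits\<close>)
      have 2: "cv M f ?g s = cv M (\<lambda>x. f x - \<phi> x) ?g s + cv M \<phi> ?g s"
        using elim by (simp add: cv_def left_diff_distrib)
      have 3: "norm (cv M (\<lambda>x. f x - \<phi> x) ?g s) \<le> cv M ?D (gi i) s"
        using norm_cv_le[of "\<lambda>x. f x - \<phi> x" ?g s] nonneg(1) by simp
      have "cv M ?F (gi i) s \<le> (LINT t|M. norm (\<phi> t) * gi i (- t + s) + ?D t * gi i (- t + s))"
        unfolding cv_def
      proof (rule integral_mono)
        show "?F t * gi i (- t + s) \<le> norm (\<phi> t) * gi i (- t + s) + ?D t * gi i (- t + s)" for t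
          using mult_right_mono[OF norm_triangle_sub[of "f t" "\<phi> t"] nonneg(1)[of i "- t + s"]]
          by (simp add: distrib_right)
      qed (use elim in auto)
      also have "\<dots> = cv M (\<lambda>x. norm (\<phi> x)) (gi i) s + cv M ?D (gi i) s"
        using elim by (simp add: cv_def)
      finally have 4: "cv M ?F (gi i) s \<le> cv M (\<lambda>x. norm (\<phi> x)) (gi i) s + cv M ?D (gi i) s" .
      have 5: "norm (cv M \<phi> ?g s) \<le> norm (cv M f ?g s) + norm (cv M (\<lambda>x. f x - \<phi> x) ?g s)"
        using norm_triangle_ineq4[of "cv M f ?g s" "cv M (\<lambda>x. f x - \<phi> x) ?g s"] by (simp add: 2)
      show ?case using 1 3 4 5 elim(1) by linarith
    qed
  qed
  have step: "AE s in M. cv M ?F (h n) s \<le> T (h n) s + 2 * cv M ?D (h n) s" for n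
  proof (induction n)
    case 0
    have "h 0 = (\<lambda>_. 0)" by (auto simp: h_def B_def)
    with T_nonneg[OF LPs(2) nonneg(2), of 0] show ?case by (auto simp: cv_def elim!: eventually_mono)
  next
    case (Suc n)
    show ?case
      using Suc piece[of n] T_add[OF LPs(2)[of n] LPs(1)[of n] nonneg(2) nonneg(1)]
        cv_add_right[OF fL(1) LPs(2)[of n] LPs(1)[of n] p] cv_add_right[OF fL(2) LPs(2)[of n] LPs(1)[of n] p]
      unfolding h_Suc by eventually_elim simp
  qed
  \<comment> \<open>\<open>T\<close> is only known to be finitely additive, and
    \<open>T (h n)\<close> need not converge to \<open>T g\<close>. It is bounded by
    \<open>T g\<close>, since \<open>T (r n)\<close> is nonnegative, and only the left-hand side is
    taken to the limit.\<close>
  have bound: "AE s in M. cv M ?F (h n) s \<le> T g s + 2 * cv M ?D g s" for n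
  proof -
    have "AE s in M. T g s = T (h n) s + T (r n) s"
      using T_add[OF LPs(2)[of n] LPs(3)[of n] nonneg(2) nonneg(3)] by (simp add: g_split[of n, symmetric])
    moreover have "AE s in M. cv M ?D (h n) s \<le> cv M ?D g s"
      by (rule cv_mono[OF fL(2) LPs(2) fL(2) g(1) p]) (auto simp: nonneg h_le)
    ultimately show ?thesis
      using step[of n] T_nonneg[OF LPs(3)[of n] nonneg(3)] by eventually_elim linarith
  qed
  then have "AE s in M. \<forall>n. cv M ?F (h n) s \<le> T g s + 2 * cv M ?D g s"
    by (subst AE_all_countable) auto
  then show ?thesis
    using cv_powr_bound(1)[OF fL(1) g(1) p]
  proof eventually_elim
    case (elim s)
    have "(\<lambda>n. cv M ?F (h n) s) \<longlonglongrightarrow> cv M ?F g s"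
      unfolding cv_def
    proof (rule integral_dominated_convergence[where w="\<lambda>t. ?F t * g (- t + s)"])
      have [measurable]: "h n \<in> borel_measurable borel" for n
        using LP_measurable[OF LPs(2)] by simp
      show "(\<lambda>t. ?F t * h n (- t + s)) \<in> borel_measurable M" for n by simp
      have "(\<lambda>n. h n y) \<longlonglongrightarrow> g y" for y
      proof (cases "g y = 0")
        case False
        then obtain i where i: "y \<in> A i" using A_cov by auto
        have "eventually (\<lambda>n. h n y = g y) sequentially"
          using eventually_gt_at_top[of i] proof eventually_elim
          case (elim n)
          then have "y \<in> B n" using i by (auto simp: B_def)
          then show ?case by (simp add: h_def)
        qed
        then show ?thesis by (rule tendsto_eventually)
      qed (simp add: h_def)
      then show "AE t in M. (\<lambda>n. ?F t * h n (- t + s)) \<longlonglongrightarrow> ?F t * g (- t + s)"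
        by (intro AE_I2 tendsto_mult tendsto_const)
      show "AE t in M. norm (?F t * h n (- t + s)) \<le> ?F t * g (- t + s)" for n
        using h_le nonneg(2) by (auto intro!: mult_left_mono simp: norm_mult)
    qed (use elim in auto)
    then show ?case by (rule LIMSEQ_le_const2) (use elim in auto)
  qed
qed

text \<open>Norm convergence of \<open>\<phi> n\<close> to \<open>f\<close> must become convergence
  of the error almost everywhere. With tolerance \<open>(1 / 2) ^ n\<close>, at most 1 and hence not
  increased by the power \<open>p \<ge> 1\<close>, Young's inequality makes the integrals of the
  p-th powers of the errors summable. So the series of these powers is finite almost everywhere and
  its terms tend to 0.\<close>

lemma cv_norm_le:
  fixes f :: "'g \<Rightarrow> 'b::{real_normed_field,euclidean_space}"
  assumes f: "f \<in> LP M 1" and p: "1 \<le> p"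
    and T_add: "\<And>g h. g \<in> LP M p \<Longrightarrow> h \<in> LP M p \<Longrightarrow> (\<And>x. 0 \<le> g x) \<Longrightarrow> (\<And>x. 0 \<le> h x) \<Longrightarrow>
      AE s in M. T (\<lambda>x. g x + h x) s = T g s + T h s"
    and T_ge: "\<And>g. g \<in> LP M p \<Longrightarrow> (\<And>x. 0 \<le> g x) \<Longrightarrow>
      AE s in M. norm (cv M f (\<lambda>x. of_real (g x)) s) \<le> (T g s :: real)"
    and g: "g \<in> LP M p" "\<And>x. 0 \<le> g x"
  shows "AE s in M. cv M (\<lambda>x. norm (f x)) g s \<le> T g s"
proof -
  define Q where "Q n \<phi> \<longleftrightarrow> \<phi> \<in> LP M 1 \<and> (\<integral>\<^sup>+x. ennreal (norm (f x - \<phi> x)) \<partial>M) < ennreal ((1 / 2) ^ n) \<and>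
      (AE s in M. cv M (\<lambda>x. norm (f x)) g s \<le> T g s + 2 * cv M (\<lambda>x. norm (f x - \<phi> x)) g s)"
    for n :: nat and \<phi>
  have "\<exists>\<phi>. Q n \<phi>" for n
  proof -
    have e: "0 < (1 / 2 :: real) ^ n" by simp
    obtain \<phi> V where *: "\<phi> \<in> LP M 1" "(\<integral>\<^sup>+x. ennreal (norm (f x - \<phi> x)) \<partial>M) < ennreal ((1 / 2) ^ n)"
      "open V" "0 \<in> V"
      "\<And>s t v w. \<phi> s \<noteq> 0 \<Longrightarrow> \<phi> t \<noteq> 0 \<Longrightarrow> v \<in> V \<Longrightarrow> w \<in> V \<Longrightarrow> - s + t = v - w \<Longrightarrow> \<phi> s = \<phi> t"
      by (rule approx_separated[OF f e], rule that)
    have "AE s in M. cv M (\<lambda>x. norm (f x)) g s \<le> T g s + 2 * cv M (\<lambda>x. norm (f x - \<phi> x)) g s"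
      by (rule cv_norm_le_approx[where T=T and V=V]) (fact f p T_add T_ge g *)+
    with *(1,2) have "Q n \<phi>" unfolding Q_def by (intro conjI)
    then show ?thesis by (rule exI[of "Q n"])
  qed
  then obtain \<phi> where "\<And>n. Q n (\<phi> n)" by metis
  then have \<phi>: "\<And>n. \<phi> n \<in> LP M 1"
    "\<And>n. (\<integral>\<^sup>+x. ennreal (norm (f x - \<phi> n x)) \<partial>M) < ennreal ((1 / 2) ^ n)"
    "\<And>n. AE s in M. cv M (\<lambda>x. norm (f x)) g s \<le> T g s + 2 * cv M (\<lambda>x. norm (f x - \<phi> n x)) g s"
    unfolding Q_def by simp_all
  define a where "a n s = cv M (\<lambda>x. norm (f x - \<phi> n x)) g s" for n s
  define G where "G = (LINT t|M. norm (g t) powr p)"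
  have G: "0 \<le> G" by (simp add: G_def)
  have L: "(\<lambda>x. norm (f x - \<phi> n x)) \<in> LP M 1" for n
    using f \<phi>(1)[of n] by (auto simp: LP_one_iff)
  have aL: "a n \<in> LP M p" for n
    unfolding a_def[abs_def] by (rule cv_powr_bound(2)[OF L g(1) p])
  have am[measurable]: "a n \<in> borel_measurable borel" for n using LP_measurable[OF aL] by simp
  have a_int: "(\<integral>\<^sup>+s. ennreal (norm (a n s) powr p) \<partial>M) \<le> ennreal (G * (1 / 2) ^ n)" for n
  proof -
    define c where "c = (LINT t|M. norm (norm (f t - \<phi> n t)))"
    have "ennreal c = (\<integral>\<^sup>+x. ennreal (norm (f x - \<phi> n x)) \<partial>M)"
      using L[of n] by (simp add: c_def LP_one_iff nn_integral_eq_integral)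
    then have "ennreal c \<le> ennreal ((1 / 2) ^ n)" using \<phi>(2)[of n] by simp
    then have c: "0 \<le> c" "c \<le> (1 / 2) ^ n" by (auto simp: c_def)
    have "c powr p \<le> c"
    proof (cases "c = 0")
      case False
      have "c \<le> 1" using c(2) power_le_one[of "1 / 2 :: real" n] by linarith
      then have "c powr p \<le> c powr 1" using c p False by (intro powr_mono') auto
      then show ?thesis using c by simp
    qed simp
    then have cp: "c powr p \<le> (1 / 2) ^ n" using c by linarith
    have "integrable M (\<lambda>s. norm (a n s) powr p)" using aL[of n] by (simp add: LP_def)
    then have "(\<integral>\<^sup>+s. ennreal (norm (a n s) powr p) \<partial>M) = ennreal (LINT s|M. norm (a n s) powr p)"
      by (rule nn_integral_eq_integral) simp
    also have "\<dots> \<le> ennreal (c powr p * G)"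
      using cv_powr_bound(3)[OF L g(1) p, of n] by (intro ennreal_leI) (simp add: a_def[abs_def] c_def G_def)
    also have "\<dots> \<le> ennreal (G * (1 / 2) ^ n)"
      using mult_right_mono[OF cp G] by (intro ennreal_leI) (simp add: mult.commute)
    finally show ?thesis .
  qed
  have "(\<integral>\<^sup>+s. (\<Sum>n. ennreal (norm (a n s) powr p)) \<partial>M) = (\<Sum>n. \<integral>\<^sup>+s. ennreal (norm (a n s) powr p) \<partial>M)"
    by (rule nn_integral_suminf) simp
  also have "\<dots> \<le> (\<Sum>n. ennreal (G * (1 / 2) ^ n))"
    by (intro suminf_le a_int) auto
  also have "\<dots> < \<infinity>"
    using G by (subst suminf_ennreal2) (auto intro!: summable_mult summable_geometric)
  finally have fin: "(\<integral>\<^sup>+s. (\<Sum>n. ennreal (norm (a n s) powr p)) \<partial>M) < \<infinity>" .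
  have "AE s in M. (\<Sum>n. ennreal (norm (a n s) powr p)) \<noteq> \<infinity>"
    by (rule nn_integral_PInf_AE) (use fin in auto)
  moreover have "AE s in M. \<forall>n. cv M (\<lambda>x. norm (f x)) g s \<le> T g s + 2 * a n s"
    using \<phi>(3) by (subst AE_all_countable) (auto simp: a_def)
  ultimately show ?thesis
  proof eventually_elim
    case (elim s)
    have "summable (\<lambda>n. norm (a n s) powr p)"
      using elim(1) by (intro summable_suminf_not_top) auto
    then have "(\<lambda>n. norm (a n s) powr p) \<longlonglongrightarrow> 0" by (rule summable_LIMSEQ_zero)
    then have "(\<lambda>n. (norm (a n s) powr p) powr (1 / p)) \<longlonglongrightarrow> 0 powr (1 / p)"
      using p by (intro tendsto_powr') auto
    then have "(\<lambda>n. norm (a n s)) \<longlonglongrightarrow> 0" using p by (simp add: powr_powr)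
    then have "(\<lambda>n. a n s) \<longlonglongrightarrow> 0" by (rule tendsto_norm_zero_cancel)
    then have "(\<lambda>n. T g s + 2 * a n s) \<longlonglongrightarrow> T g s + 2 * 0"
      by (intro tendsto_intros)
    then show ?case using elim(2) by (intro LIMSEQ_le_const) auto
  qed
qed

end

section \<open>Classes modulo almost everywhere equality\<close>

definition ae_class :: "'a measure \<Rightarrow> ('a \<Rightarrow> 'b::topological_space) \<Rightarrow> ('a \<Rightarrow> 'b) set" where
  "ae_class M f = {h \<in> borel_measurable M. AE x in M. h x = f x}"

lemma ae_class_self: "f \<in> borel_measurable M \<Longrightarrow> f \<in> ae_class M f"
  by (simp add: ae_class_def)

lemma ae_class_eqI:
  assumes "AE x in M. f x = g x" shows "ae_class M f = ae_class M g"
proof -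
  have "(AE x in M. h x = f x) \<longleftrightarrow> (AE x in M. h x = g x)" for h
  proof
    show "AE x in M. h x = g x" if "AE x in M. h x = f x"
      using that assms by eventually_elim simp
    show "AE x in M. h x = f x" if "AE x in M. h x = g x"
      using that assms by eventually_elim simp
  qed
  then show ?thesis by (simp add: ae_class_def)
qed

text \<open>Measurability of \<open>f\<close> makes the class non-empty; the equality of two empty
  classes would say nothing.\<close>

lemma ae_class_eqD:
  assumes "ae_class M f = ae_class M g" "f \<in> borel_measurable M" shows "AE x in M. f x = g x"
  using ae_class_self[OF assms(2)] unfolding assms(1) by (simp add: ae_class_def)

lemma ae_lift_class:
  assumes "f \<in> borel_measurable M"
  shows "ae_lift M u (ae_class M f) = ae_class M (\<lambda>x. u (f x))"
proof (intro subset_antisym subsetI)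
  fix h assume "h \<in> ae_lift M u (ae_class M f)"
  then obtain f' where "h \<in> borel_measurable M" "AE x in M. f' x = f x" "AE x in M. h x = u (f' x)"
    by (auto simp: ae_lift_def ae_class_def)
  moreover from this(2,3) have "AE x in M. h x = u (f x)" by eventually_elim simp
  ultimately show "h \<in> ae_class M (\<lambda>x. u (f x))" by (simp add: ae_class_def)
next
  fix h assume "h \<in> ae_class M (\<lambda>x. u (f x))"
  then show "h \<in> ae_lift M u (ae_class M f)"
    using ae_class_self[OF assms] by (auto simp: ae_lift_def ae_class_def[of M "\<lambda>x. u (f x)"])
qed

lemma ae_lift2_class:
  assumes "f \<in> borel_measurable M" "g \<in> borel_measurable M"
  shows "ae_lift2 M u (ae_class M f) (ae_class M g) = ae_class M (\<lambda>x. u (f x) (g x))"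
proof (intro subset_antisym subsetI)
  fix h assume "h \<in> ae_lift2 M u (ae_class M f) (ae_class M g)"
  then obtain f' g' where "h \<in> borel_measurable M" "AE x in M. f' x = f x" "AE x in M. g' x = g x"
    "AE x in M. h x = u (f' x) (g' x)"
    by (auto simp: ae_lift2_def ae_class_def)
  moreover from this(2-4) have "AE x in M. h x = u (f x) (g x)" by eventually_elim simp
  ultimately show "h \<in> ae_class M (\<lambda>x. u (f x) (g x))" by (simp add: ae_class_def)
next
  fix h assume "h \<in> ae_class M (\<lambda>x. u (f x) (g x))"
  then show "h \<in> ae_lift2 M u (ae_class M f) (ae_class M g)"
    using ae_class_self[OF assms(1)] ae_class_self[OF assms(2)]
    by (auto simp: ae_lift2_def ae_class_def[of M "\<lambda>x. u (f x) (g x)"])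
qed

lemma Lp_space_eq: "Lp_space M p = ae_class M ` LP M p"
  by (auto simp: Lp_space_def LP_def ae_class_def)

lemma ae_class_in_Lp_space: "f \<in> LP M p \<Longrightarrow> ae_class M f \<in> Lp_space M p"
  by (simp add: Lp_space_eq)

lemma Lp_spaceE:
  assumes "F \<in> Lp_space M p" obtains f where "f \<in> LP M p" "F = ae_class M f"
  using assms by (auto simp: Lp_space_eq)

lemma Lp_norm_class:
  fixes f :: "'a \<Rightarrow> 'b::{banach,second_countable_topology}"
  assumes [measurable]: "f \<in> borel_measurable M"
  shows "Lp_norm M p (ae_class M f) = (LINT x|M. norm (f x) powr p) powr (1 / p)"
proof -
  define h where "h = (SOME h. h \<in> ae_class M f)"
  have "h \<in> ae_class M f" unfolding h_def by (rule someI[of _ f]) (simp add: ae_class_self)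
  then have [measurable]: "h \<in> borel_measurable M" and "AE x in M. h x = f x" by (auto simp: ae_class_def)
  then have "(LINT x|M. norm (h x) powr p) = (LINT x|M. norm (f x) powr p)"
    by (intro integral_cong_AE) (auto elim!: eventually_mono)
  then show ?thesis by (simp add: Lp_norm_def h_def)
qed

lemma Lp_lattice_simps [simp]:
  "carrier (Lp_lattice M p) = Lp_space M p"
  "vadd (Lp_lattice M p) = ae_lift2 M (+)"
  "vzero (Lp_lattice M p) = ae_class M (\<lambda>_. 0)"
  "vscale (Lp_lattice M p) c = ae_lift M (\<lambda>y. c * y)"
  "vnorm (Lp_lattice M p) = Lp_norm M p"
  by (simp_all add: Lp_lattice_def ae_class_def)

lemma Lp_lattice_le_class:
  assumes "f \<in> borel_measurable M" "g \<in> borel_measurable M"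
  shows "ae_class M f \<sqsubseteq>\<^bsub>Lp_lattice M p\<^esub> ae_class M g \<longleftrightarrow> (AE x in M. f x \<le> g x)"
proof
  assume "ae_class M f \<sqsubseteq>\<^bsub>Lp_lattice M p\<^esub> ae_class M g"
  then obtain f' g' where "AE x in M. f' x = f x" "AE x in M. g' x = g x" "AE x in M. f' x \<le> g' x"
    by (auto simp: Lp_lattice_def ae_class_def)
  then show "AE x in M. f x \<le> g x" by eventually_elim simp
next
  assume "AE x in M. f x \<le> g x"
  then show "ae_class M f \<sqsubseteq>\<^bsub>Lp_lattice M p\<^esub> ae_class M g"
    using ae_class_self[OF assms(1)] ae_class_self[OF assms(2)] by (auto simp: Lp_lattice_def)
qed

lemma LP_max_0:
  fixes f :: "'a \<Rightarrow> real"
  assumes "f \<in> LP M p" "0 \<le> p" shows "(\<lambda>x. max (f x) 0) \<in> LP M p" "(\<lambda>x. max (- f x) 0) \<in> LP M p"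
proof -
  have [measurable]: "f \<in> borel_measurable M" using LP_measurable[OF assms(1)] .
  show "(\<lambda>x. max (f x) 0) \<in> LP M p" "(\<lambda>x. max (- f x) 0) \<in> LP M p"
    by (rule LP_bound[OF assms(1)]; use assms(2) in \<open>auto simp: max_def\<close>)+
qed

text \<open>Cutting off the negative part yields a representative that is nonnegative everywhere, as
  the estimates for functions assume.\<close>

lemma Lp_lattice_nonnegE:
  assumes F: "F \<in> Lp_space M p" "vzero (Lp_lattice M p) \<sqsubseteq>\<^bsub>Lp_lattice M p\<^esub> F" and p: "0 \<le> p"
  obtains f where "f \<in> LP M p" "\<And>x. 0 \<le> f x" "F = ae_class M f"
proof -
  obtain f where f: "f \<in> LP M p" "F = ae_class M f" using Lp_spaceE[OF F(1)] .
  have "AE x in M. 0 \<le> f x"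
    using F(2) LP_measurable[OF f(1)] by (simp add: f(2) Lp_lattice_le_class)
  then have "ae_class M f = ae_class M (\<lambda>x. max (f x) 0)"
    by (intro ae_class_eqI) (auto elim!: eventually_mono)
  with f LP_max_0(1)[OF f(1) p] show ?thesis by (intro that[of "\<lambda>x. max (f x) 0"]) auto
qed

section \<open>Suprema of classes\<close>

text \<open>The order records carry no axioms, while the supremum is a choice among all least upper
  bounds. Antisymmetry at \<open>l\<close> is the instance of uniqueness that determines the
  choice.\<close>

lemma Lattice_sup_eqI:
  assumes "l \<in> carrier L" "\<And>a. a \<in> A \<Longrightarrow> a \<sqsubseteq>\<^bsub>L\<^esub> l" "A \<subseteq> carrier L"
    and "\<And>u. u \<in> carrier L \<Longrightarrow> (\<And>a. a \<in> A \<Longrightarrow> a \<sqsubseteq>\<^bsub>L\<^esub> u) \<Longrightarrow> l \<sqsubseteq>\<^bsub>L\<^esub> u"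
    and antisym: "\<And>u. u \<in> carrier L \<Longrightarrow> l \<sqsubseteq>\<^bsub>L\<^esub> u \<Longrightarrow> u \<sqsubseteq>\<^bsub>L\<^esub> l \<Longrightarrow> u = l"
  shows "\<Squnion>\<^bsub>L\<^esub>A = l"
proof -
  have "l \<sqsubseteq>\<^bsub>L\<^esub> u" if "u \<in> Upper L A" for u
    by (rule assms(4)) (use that assms(3) in \<open>auto simp: Upper_def\<close>)
  then have least: "least L l (Upper L A)"
    using assms(1,2) by (auto simp: least_def Upper_def)
  show ?thesis
    unfolding Lattice.sup_def
  proof (rule some_equality[where P="\<lambda>x. least L x (Upper L A)"])
    show "least L l (Upper L A)" by (rule least)
    fix u assume "least L u (Upper L A)"
    with least have "u \<in> carrier L" "l \<sqsubseteq>\<^bsub>L\<^esub> u" "u \<sqsubseteq>\<^bsub>L\<^esub> l"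
      by (auto simp: least_def Upper_def)
    then show "u = l" by (rule antisym)
  qed
qed

text \<open>Serves the real modulus, with \<open>X\<close> consisting of \<open>f\<close> and
  \<open>- f\<close>, and the complex one, with an uncountable family of rotations; leastness for
  classes is therefore left as a hypothesis. \<open>L\<close> is given by carrier and order alone
  since it stands for records of different types.\<close>

lemma Sup_ae_class:
  fixes f :: "'a \<Rightarrow> 'b::{real_normed_field,euclidean_space}"
  assumes L: "carrier L = Lp_space M p" "le L = le (Lp_lattice M p)"
    and f: "f \<in> LP M p" and X: "X \<subseteq> LP M p"
    and le: "\<And>u. u \<in> X \<Longrightarrow> AE x in M. u x \<le> norm (f x)"
    and least: "\<And>h. h \<in> LP M p \<Longrightarrow> (\<And>u. u \<in> X \<Longrightarrow> AE x in M. u x \<le> h x) \<Longrightarrow> AE x in M. norm (f x) \<le> h x"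
  shows "\<Squnion>\<^bsub>L\<^esub>(ae_class M ` X) = ae_class M (\<lambda>x. norm (f x))"
proof (rule Lattice_sup_eqI)
  note fL = LP_norm[OF f]
  show "ae_class M (\<lambda>x. norm (f x)) \<in> carrier L" using L ae_class_in_Lp_space[OF fL] by simp
  show "ae_class M ` X \<subseteq> carrier L" using L X by (auto simp: Lp_space_eq)
  show "a \<sqsubseteq>\<^bsub>L\<^esub> ae_class M (\<lambda>x. norm (f x))" if "a \<in> ae_class M ` X" for a
    using that X le LP_measurable[OF fL] by (auto simp: L Lp_lattice_le_class LP_measurable subset_iff)
  show "ae_class M (\<lambda>x. norm (f x)) \<sqsubseteq>\<^bsub>L\<^esub> u"
    if u: "u \<in> carrier L" "\<And>a. a \<in> ae_class M ` X \<Longrightarrow> a \<sqsubseteq>\<^bsub>L\<^esub> u" for u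
  proof -
    obtain h where h: "h \<in> LP M p" "u = ae_class M h" using Lp_spaceE u(1) L(1) by metis
    have "AE x in M. v x \<le> h x" if v: "v \<in> X" for v
    proof -
      have vL: "v \<in> LP M p" using v X by auto
      have "ae_class M v \<sqsubseteq>\<^bsub>L\<^esub> ae_class M h" using u(2) v h(2) by blast
      then show ?thesis
        by (simp add: L Lp_lattice_le_class LP_measurable[OF vL] LP_measurable[OF h(1)])
    qed
    from least[OF h(1) this] show ?thesis
      using h LP_measurable[OF fL] by (simp add: L Lp_lattice_le_class LP_measurable)
  qed
  show "u = ae_class M (\<lambda>x. norm (f x))"
    if u: "u \<in> carrier L" "ae_class M (\<lambda>x. norm (f x)) \<sqsubseteq>\<^bsub>L\<^esub> u" "u \<sqsubseteq>\<^bsub>L\<^esub> ae_class M (\<lambda>x. norm (f x))" for u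
  proof -
    obtain h where h: "h \<in> LP M p" "u = ae_class M h" using Lp_spaceE u(1) L(1) by metis
    have "AE x in M. norm (f x) \<le> h x" "AE x in M. h x \<le> norm (f x)"
      using u(2,3) h LP_measurable[OF fL] by (simp_all add: L Lp_lattice_le_class LP_measurable)
    then have "AE x in M. h x = norm (f x)" by eventually_elim simp
    then show ?thesis unfolding h(2) by (rule ae_class_eqI)
  qed
qed

section \<open>Regular operators on real spaces of p-integrable functions\<close>

lemma linear_operator_classD:
  assumes T: "linear_operator (Lp_lattice M p) T"
  shows "T \<in> extensional (Lp_space M p)"
    and "g \<in> LP M p \<Longrightarrow> \<exists>h\<in>LP M p. T (ae_class M g) = ae_class M h"
    and "g \<in> LP M p \<Longrightarrow> h \<in> LP M p \<Longrightarrow> T (ae_class M (\<lambda>x. g x + h x)) = ae_lift2 M (+) (T (ae_class M g)) (T (ae_class M h))"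
    and "g \<in> LP M p \<Longrightarrow> T (ae_class M (\<lambda>x. c * g x)) = ae_lift M (\<lambda>y. c * y) (T (ae_class M g))"
proof -
  have T': "T \<in> Lp_space M p \<rightarrow>\<^sub>E Lp_space M p"
    "\<And>F G. F \<in> Lp_space M p \<Longrightarrow> G \<in> Lp_space M p \<Longrightarrow> T (ae_lift2 M (+) F G) = ae_lift2 M (+) (T F) (T G)"
    "\<And>c F. F \<in> Lp_space M p \<Longrightarrow> T (ae_lift M (\<lambda>y. c * y) F) = ae_lift M (\<lambda>y. c * y) (T F)"
    using T by (auto simp: linear_operator_def)
  show "T \<in> extensional (Lp_space M p)" using T'(1) by (simp add: PiE_def)
  show "\<exists>h\<in>LP M p. T (ae_class M g) = ae_class M h" if "g \<in> LP M p"
    using PiE_mem[OF T'(1) ae_class_in_Lp_space[OF that]] by (rule Lp_spaceE) blast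
  show "g \<in> LP M p \<Longrightarrow> h \<in> LP M p \<Longrightarrow> T (ae_class M (\<lambda>x. g x + h x)) = ae_lift2 M (+) (T (ae_class M g)) (T (ae_class M h))"
    using T'(2)[of "ae_class M g" "ae_class M h"] by (simp add: ae_class_in_Lp_space ae_lift2_class LP_measurable)
  show "g \<in> LP M p \<Longrightarrow> T (ae_class M (\<lambda>x. c * g x)) = ae_lift M (\<lambda>y. c * y) (T (ae_class M g))"
    using T'(3)[of "ae_class M g" c] by (simp add: ae_class_in_Lp_space ae_lift_class LP_measurable)
qed

lemma linear_operatorI:
  fixes T :: "('a \<Rightarrow> real) set \<Rightarrow> ('a \<Rightarrow> real) set"
  assumes "T \<in> extensional (Lp_space M p)"
    and T: "\<And>g. g \<in> LP M p \<Longrightarrow> t g \<in> LP M p \<and> T (ae_class M g) = ae_class M (t g)"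
    and add: "\<And>g h. g \<in> LP M p \<Longrightarrow> h \<in> LP M p \<Longrightarrow> AE x in M. t (\<lambda>x. g x + h x) x = t g x + t h x"
    and mult: "\<And>c g. g \<in> LP M p \<Longrightarrow> AE x in M. t (\<lambda>x. c * g x) x = c * t g x" and p: "0 \<le> p"
  shows "linear_operator (Lp_lattice M p) T"
  unfolding linear_operator_def Lp_lattice_simps
proof (intro conjI ballI allI)
  show "T \<in> Lp_space M p \<rightarrow>\<^sub>E Lp_space M p"
    using assms(1) T by (auto simp: PiE_def Lp_space_eq)
  fix F :: "('a \<Rightarrow> real) set" assume "F \<in> Lp_space M p"
  then obtain f where f: "f \<in> LP M p" "F = ae_class M f" by (rule Lp_spaceE)
  note Tf = T[OF f(1)]
  have tm: "t g \<in> borel_measurable M" if "g \<in> LP M p" for g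
    using T[OF that] LP_measurable by blast
  show "T (ae_lift M (\<lambda>y. c * y) F) = ae_lift M (\<lambda>y. c * y) (T F)" for c
    using T[OF LP_mult[OF f(1), of c]] Tf ae_class_eqI[OF mult[OF f(1), of c]]
    by (simp add: f(2) ae_lift_class[OF LP_measurable[OF f(1)]] ae_lift_class[OF tm[OF f(1)]])
  fix G :: "('a \<Rightarrow> real) set" assume "G \<in> Lp_space M p"
  then obtain g where g: "g \<in> LP M p" "G = ae_class M g" by (rule Lp_spaceE)
  show "T (ae_lift2 M (+) F G) = ae_lift2 M (+) (T F) (T G)"
    using T[OF LP_add[OF f(1) g(1) p]] Tf T[OF g(1)] ae_class_eqI[OF add[OF f(1) g(1)]]
    by (simp add: f(2) g(2) ae_lift2_class[OF LP_measurable[OF f(1)] LP_measurable[OF g(1)]]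
        ae_lift2_class[OF tm[OF f(1)] tm[OF g(1)]])
qed

text \<open>A choice of representatives turns \<open>T\<close> into a map on functions that is
  additive and homogeneous only up to null sets depending on the arguments. This is the form in
  which \<open>cv_norm_le\<close> takes an upper bound.\<close>

lemma linear_operator_rep:
  assumes "linear_operator (Lp_lattice M p) T" "0 \<le> p"
  obtains t where "\<And>g. g \<in> LP M p \<Longrightarrow> t g \<in> LP M p \<and> T (ae_class M g) = ae_class M (t g)"
    "\<And>g h. g \<in> LP M p \<Longrightarrow> h \<in> LP M p \<Longrightarrow> AE x in M. t (\<lambda>x. g x + h x) x = t g x + t h x"
    "\<And>c g. g \<in> LP M p \<Longrightarrow> AE x in M. t (\<lambda>x. c * g x) x = c * t g x"
proof -
  define t where "t g = (SOME h. h \<in> LP M p \<and> T (ae_class M g) = ae_class M h)" for g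
  have t: "t g \<in> LP M p \<and> T (ae_class M g) = ae_class M (t g)" if "g \<in> LP M p" for g
  proof -
    have "\<exists>h. h \<in> LP M p \<and> T (ae_class M g) = ae_class M h"
      using linear_operator_classD(2)[OF assms(1) that] by blast
    from someI_ex[OF this] show ?thesis unfolding t_def .
  qed
  have tm: "t g \<in> borel_measurable M" if "g \<in> LP M p" for g
    using t[OF that] LP_measurable by blast
  show thesis
  proof (rule that[of t])
    show "t g \<in> LP M p \<and> T (ae_class M g) = ae_class M (t g)" if "g \<in> LP M p" for g
      using t[OF that] .
    show "AE x in M. t (\<lambda>x. g x + h x) x = t g x + t h x" if g: "g \<in> LP M p" and h: "h \<in> LP M p" for g h
    proof (rule ae_class_eqD)
      show "ae_class M (t (\<lambda>x. g x + h x)) = ae_class M (\<lambda>x. t g x + t h x)"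
        using linear_operator_classD(3)[OF assms(1) g h] t[OF g] t[OF h] t[OF LP_add[OF g h assms(2)]]
        by (simp add: ae_lift2_class[OF tm[OF g] tm[OF h]])
      show "t (\<lambda>x. g x + h x) \<in> borel_measurable M" by (rule tm[OF LP_add[OF g h assms(2)]])
    qed
    show "AE x in M. t (\<lambda>x. c * g x) x = c * t g x" if g: "g \<in> LP M p" for c g
    proof (rule ae_class_eqD)
      show "ae_class M (t (\<lambda>x. c * g x)) = ae_class M (\<lambda>x. c * t g x)"
        using linear_operator_classD(4)[OF assms(1) g, of c] t[OF g] t[OF LP_mult[OF g, of c]]
        by (simp add: ae_lift_class[OF tm[OF g]])
      show "t (\<lambda>x. c * g x) \<in> borel_measurable M" by (rule tm[OF LP_mult[OF g]])
    qed
  qed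
qed

lemma regular_operator_linear:
  assumes T: "T \<in> regular_operators (Lp_lattice M p)" and p: "0 \<le> p"
  shows "linear_operator (Lp_lattice M p) T"
proof -
  obtain P Q where PQ: "linear_operator (Lp_lattice M p) P" "linear_operator (Lp_lattice M p) Q"
    "T = (\<lambda>x\<in>Lp_space M p. ae_lift2 M (+) (P x) (ae_lift M (\<lambda>y. - 1 * y) (Q x)))"
    using T by (auto simp: regular_operators_def positive_operator_def)
  obtain P' where P': "\<And>g. g \<in> LP M p \<Longrightarrow> P' g \<in> LP M p \<and> P (ae_class M g) = ae_class M (P' g)"
    "\<And>g h. g \<in> LP M p \<Longrightarrow> h \<in> LP M p \<Longrightarrow> AE x in M. P' (\<lambda>x. g x + h x) x = P' g x + P' h x"
    "\<And>c g. g \<in> LP M p \<Longrightarrow> AE x in M. P' (\<lambda>x. c * g x) x = c * P' g x"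
    by (rule linear_operator_rep[OF PQ(1) p], rule that)
  obtain Q' where Q': "\<And>g. g \<in> LP M p \<Longrightarrow> Q' g \<in> LP M p \<and> Q (ae_class M g) = ae_class M (Q' g)"
    "\<And>g h. g \<in> LP M p \<Longrightarrow> h \<in> LP M p \<Longrightarrow> AE x in M. Q' (\<lambda>x. g x + h x) x = Q' g x + Q' h x"
    "\<And>c g. g \<in> LP M p \<Longrightarrow> AE x in M. Q' (\<lambda>x. c * g x) x = c * Q' g x"
    by (rule linear_operator_rep[OF PQ(2) p], rule that)
  show ?thesis
  proof (rule linear_operatorI[where t="\<lambda>g x. P' g x + - 1 * Q' g x"])
    show "T \<in> extensional (Lp_space M p)" by (simp add: PQ(3))
    fix g :: "'a \<Rightarrow> real" assume g: "g \<in> LP M p"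
    note Pm = LP_measurable[OF conjunct1[OF P'(1)[OF g]]] and Qm = LP_measurable[OF conjunct1[OF Q'(1)[OF g]]]
    have Qm': "(\<lambda>x. - 1 * Q' g x) \<in> borel_measurable M" using Qm by simp
    have "(\<lambda>x. P' g x + - 1 * Q' g x) \<in> LP M p"
      using P'(1)[OF g] Q'(1)[OF g] by (intro LP_add LP_mult p) auto
    moreover have "T (ae_class M g) = ae_class M (\<lambda>x. P' g x + - 1 * Q' g x)"
      using P'(1)[OF g] Q'(1)[OF g] ae_class_in_Lp_space[OF g]
      unfolding PQ(3) by (simp only: restrict_apply' ae_lift_class[OF Qm] ae_lift2_class[OF Pm Qm'])
    ultimately show "(\<lambda>x. P' g x + - 1 * Q' g x) \<in> LP M p \<and> T (ae_class M g) = ae_class M (\<lambda>x. P' g x + - 1 * Q' g x)" ..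
    show "AE x in M. P' (\<lambda>x. c * g x) x + - 1 * Q' (\<lambda>x. c * g x) x = c * (P' g x + - 1 * Q' g x)" for c
      using P'(3)[OF g, of c] Q'(3)[OF g, of c] by eventually_elim (simp add: algebra_simps)
    fix h :: "'a \<Rightarrow> real" assume h: "h \<in> LP M p"
    show "AE x in M. P' (\<lambda>x. g x + h x) x + - 1 * Q' (\<lambda>x. g x + h x) x =
        P' g x + - 1 * Q' g x + (P' h x + - 1 * Q' h x)"
      using P'(2)[OF g h] Q'(2)[OF g h] by eventually_elim simp
  qed fact
qed

lemma extensional_class_eqI:
  assumes "S \<in> extensional (Lp_space M p)" "T \<in> extensional (Lp_space M p)"
    "\<And>g. g \<in> LP M p \<Longrightarrow> S (ae_class M g) = T (ae_class M g)"
  shows "S = T"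
  using assms(1,2) by (rule extensionalityI) (auto simp: Lp_space_eq assms(3))

text \<open>Operators that dominate each other agree on positive classes, and every class is the
  difference of two of these. Extensionality turns agreement on the carrier into equality.\<close>

lemma regular_order_antisym:
  assumes S: "S \<in> regular_operators (Lp_lattice M p)" and T: "T \<in> regular_operators (Lp_lattice M p)"
    and p: "0 \<le> p" and ST: "S \<sqsubseteq>\<^bsub>regular_order (Lp_lattice M p)\<^esub> T" "T \<sqsubseteq>\<^bsub>regular_order (Lp_lattice M p)\<^esub> S"
  shows "S = T"
proof -
  note lS = regular_operator_linear[OF S p] and lT = regular_operator_linear[OF T p]
  have pos: "S (ae_class M g) = T (ae_class M g)" if g: "g \<in> LP M p" "\<And>x. 0 \<le> g x" for g
  proof -
    obtain s t where st: "s \<in> LP M p" "t \<in> LP M p" "S (ae_class M g) = ae_class M s" "T (ae_class M g) = ae_class M t"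
      using linear_operator_classD(2)[OF lS g(1)] linear_operator_classD(2)[OF lT g(1)] by blast
    have "vzero (Lp_lattice M p) \<sqsubseteq>\<^bsub>Lp_lattice M p\<^esub> ae_class M g"
      using g LP_measurable[OF g(1)] by (simp add: Lp_lattice_le_class)
    then have "ae_class M s \<sqsubseteq>\<^bsub>Lp_lattice M p\<^esub> ae_class M t" "ae_class M t \<sqsubseteq>\<^bsub>Lp_lattice M p\<^esub> ae_class M s"
      using ST ae_class_in_Lp_space[OF g(1)] by (auto simp: regular_order_def st)
    then have "AE x in M. s x \<le> t x" "AE x in M. t x \<le> s x"
      using st by (simp_all add: Lp_lattice_le_class LP_measurable)
    then have "AE x in M. s x = t x" by eventually_elim simp
    then show ?thesis unfolding st by (rule ae_class_eqI)
  qed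
  show ?thesis
  proof (rule extensional_class_eqI[OF linear_operator_classD(1)[OF lS] linear_operator_classD(1)[OF lT]])
    fix g :: "'a \<Rightarrow> real" assume g: "g \<in> LP M p"
    note g1 = LP_max_0(1)[OF g p] and g2 = LP_max_0(2)[OF g p]
    have eq: "g = (\<lambda>x. max (g x) 0 + - 1 * max (- g x) 0)" by (auto simp: max_def)
    have "U (ae_class M g) = ae_lift2 M (+) (U (ae_class M (\<lambda>x. max (g x) 0)))
        (ae_lift M (\<lambda>y. - 1 * y) (U (ae_class M (\<lambda>x. max (- g x) 0))))"
      if "linear_operator (Lp_lattice M p) U" for U
      using linear_operator_classD(3)[OF that g1 LP_mult[OF g2, of "- 1"]]
        linear_operator_classD(4)[OF that g2, of "- 1"] eq by simp
    from this[OF lS] this[OF lT] show "S (ae_class M g) = T (ae_class M g)"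
      using pos[OF g1] pos[OF g2] by simp
  qed
qed

section \<open>Convolution operators on the real spaces\<close>

context haar_measure
begin

text \<open>\<open>conv\<close> imposes its condition on all pairs of representatives. Since
  \<open>cv_cong_AE\<close> holds at every \<open>s\<close>, the condition for one pair carries over
  to all others.\<close>

lemma conv_class:
  fixes f g :: "'g \<Rightarrow> 'b::{real_normed_field,euclidean_space}"
  assumes f: "f \<in> LP M 1" and g: "g \<in> LP M p" and p: "1 \<le> p"
  shows "conv M (ae_class M f) (ae_class M g) = ae_class M (cv M f g)"
proof (intro subset_antisym subsetI)
  fix h assume "h \<in> conv M (ae_class M f) (ae_class M g)"
  then have "h \<in> borel_measurable M"
    "AE s in M. integrable M (\<lambda>t. f t * g (- t + s)) \<and> h s = (LINT t|M. f t * g (- t + s))"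
    using ae_class_self[OF LP_measurable[OF f]] ae_class_self[OF LP_measurable[OF g]]
    by (auto simp: conv_def)
  then show "h \<in> ae_class M (cv M f g)"
    by (auto simp: ae_class_def cv_def elim!: eventually_mono)
next
  fix h assume "h \<in> ae_class M (cv M f g)"
  then have h: "h \<in> borel_measurable M" "AE s in M. h s = cv M f g s" by (auto simp: ae_class_def)
  have "AE s in M. integrable M (\<lambda>t. f' t * g' (- t + s)) \<and> h s = (LINT t|M. f' t * g' (- t + s))"
    if "f' \<in> ae_class M f" "g' \<in> ae_class M g" for f' g'
  proof -
    have "f \<in> borel_measurable borel" "g \<in> borel_measurable borel"
      "f' \<in> borel_measurable borel" "g' \<in> borel_measurable borel"
      "AE x in M. f' x = f x" "AE x in M. g' x = g x"
      using that LP_measurable[OF f] LP_measurable[OF g] by (auto simp: ae_class_def)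
    note cong = cv_cong_AE[OF this]
    show ?thesis
      using h(2) cv_powr_bound(1)[OF f g p] by eventually_elim (simp add: cong cv_def[symmetric])
  qed
  with h(1) show "h \<in> conv M (ae_class M f) (ae_class M g)" by (simp add: conv_def)
qed

lemma conv_operator_class:
  fixes f g :: "'g \<Rightarrow> 'b::{real_normed_field,euclidean_space}"
  assumes "f \<in> LP M 1" "g \<in> LP M p" "1 \<le> p"
  shows "conv_operator M p (ae_class M f) (ae_class M g) = ae_class M (cv M f g)"
  using assms by (simp add: conv_operator_def ae_class_in_Lp_space conv_class)

lemma conv_operator_extensional: "conv_operator M p F \<in> extensional (Lp_space M p)"
  by (simp add: conv_operator_def)

lemma conv_in_Lp_space:
  fixes F G :: "('g \<Rightarrow> 'b::{real_normed_field,euclidean_space}) set"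
  assumes "F \<in> Lp_space M 1" "G \<in> Lp_space M p" "1 \<le> p"
  shows "conv M F G \<in> Lp_space M p"
proof -
  obtain f g where "f \<in> LP M 1" "F = ae_class M f" "g \<in> LP M p" "G = ae_class M g"
    using assms by (metis Lp_spaceE)
  then show ?thesis
    using assms(3) by (simp add: conv_class ae_class_in_Lp_space cv_powr_bound(2))
qed

lemma cv_mono_left:
  fixes u v g :: "'g \<Rightarrow> real"
  assumes u: "u \<in> LP M 1" and v: "v \<in> LP M 1" and g: "g \<in> LP M p" and p: "1 \<le> p"
    and uv: "AE x in M. u x \<le> v x" and g0: "\<And>x. 0 \<le> g x"
  shows "AE s in M. cv M u g s \<le> cv M v g s"
  using cv_powr_bound(1)[OF u g p] cv_powr_bound(1)[OF v g p]
proof eventually_elim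
  case (elim s)
  then show ?case
    unfolding cv_def
    by (rule integral_mono_AE) (use uv in \<open>auto elim!: eventually_mono intro!: mult_right_mono g0\<close>)
qed

lemma conv_operator_linear:
  assumes f: "f \<in> LP M 1" and p: "1 \<le> p"
  shows "linear_operator (Lp_lattice M p) (conv_operator M p (ae_class M f))"
proof (rule linear_operatorI[where t="cv M f"])
  show "conv_operator M p (ae_class M f) \<in> extensional (Lp_space M p)"
    by (rule conv_operator_extensional)
  fix g :: "'g \<Rightarrow> real" assume g: "g \<in> LP M p"
  show "cv M f g \<in> LP M p \<and> conv_operator M p (ae_class M f) (ae_class M g) = ae_class M (cv M f g)"
    using f g p by (simp add: cv_powr_bound(2) conv_operator_class)
  show "AE x in M. cv M f (\<lambda>x. g x + h x) x = cv M f g x + cv M f h x" if "h \<in> LP M p" for h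
    by (rule cv_add_right[OF f g that p])
  show "AE x in M. cv M f (\<lambda>x. c * g x) x = c * cv M f g x" for c
    by (simp add: cv_mult_right)
qed (use p in simp)

lemma conv_operator_positive:
  fixes f :: "'g \<Rightarrow> real"
  assumes f: "f \<in> LP M 1" "\<And>x. 0 \<le> f x" and p: "1 \<le> p"
  shows "positive_operator (Lp_lattice M p) (conv_operator M p (ae_class M f))"
  unfolding positive_operator_def
proof (intro conjI ballI impI)
  fix G assume "G \<in> carrier (Lp_lattice M p)" "vzero (Lp_lattice M p) \<sqsubseteq>\<^bsub>Lp_lattice M p\<^esub> G"
  then obtain g where g: "g \<in> LP M p" "\<And>x. 0 \<le> g x" "G = ae_class M g"
    using Lp_lattice_nonnegE[of G M p] p by auto
  show "vzero (Lp_lattice M p) \<sqsubseteq>\<^bsub>Lp_lattice M p\<^esub> conv_operator M p (ae_class M f) G"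
    using f g p LP_measurable[OF cv_powr_bound(2)[OF f(1) g(1) p]]
    by (simp add: conv_operator_class Lp_lattice_le_class cv_nonneg)
qed (rule conv_operator_linear[OF f(1) p])

lemma conv_operator_add:
  fixes f g :: "'g \<Rightarrow> 'b::{real_normed_field,euclidean_space}"
  assumes f: "f \<in> LP M 1" and g: "g \<in> LP M 1" and p: "1 \<le> p"
  shows "conv_operator M p (ae_class M (\<lambda>x. f x + g x)) =
    (\<lambda>H\<in>Lp_space M p. ae_lift2 M (+) (conv_operator M p (ae_class M f) H) (conv_operator M p (ae_class M g) H))"
proof (rule extensional_class_eqI[OF conv_operator_extensional restrict_extensional])
  fix h :: "'g \<Rightarrow> 'b" assume h: "h \<in> LP M p"
  show "conv_operator M p (ae_class M (\<lambda>x. f x + g x)) (ae_class M h) =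
    (\<lambda>H\<in>Lp_space M p. ae_lift2 M (+) (conv_operator M p (ae_class M f) H) (conv_operator M p (ae_class M g) H)) (ae_class M h)"
    using LP_add[OF f g] ae_class_eqI[OF cv_add_left[OF f g h p]] f g h p
      LP_measurable[OF cv_powr_bound(2)[OF f h p]] LP_measurable[OF cv_powr_bound(2)[OF g h p]]
    by (simp add: conv_operator_class ae_class_in_Lp_space ae_lift2_class)
qed

lemma conv_operator_mult:
  fixes f :: "'g \<Rightarrow> 'b::{real_normed_field,euclidean_space}"
  assumes f: "f \<in> LP M 1" and p: "1 \<le> p"
  shows "conv_operator M p (ae_class M (\<lambda>x. c * f x)) =
    (\<lambda>H\<in>Lp_space M p. ae_lift M (\<lambda>y. c * y) (conv_operator M p (ae_class M f) H))"
proof (rule extensional_class_eqI[OF conv_operator_extensional restrict_extensional])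
  fix h :: "'g \<Rightarrow> 'b" assume h: "h \<in> LP M p"
  show "conv_operator M p (ae_class M (\<lambda>x. c * f x)) (ae_class M h) =
    (\<lambda>H\<in>Lp_space M p. ae_lift M (\<lambda>y. c * y) (conv_operator M p (ae_class M f) H)) (ae_class M h)"
    using LP_mult[OF f, of c] f h p LP_measurable[OF cv_powr_bound(2)[OF f h p]]
    by (simp add: conv_operator_class ae_class_in_Lp_space ae_lift_class cv_mult_left[abs_def])
qed

lemma conv_operator_compose:
  fixes f g :: "'g \<Rightarrow> 'b::{real_normed_field,euclidean_space}"
  assumes f: "f \<in> LP M 1" and g: "g \<in> LP M 1" and p: "1 \<le> p"
  shows "conv_operator M p (conv M (ae_class M f) (ae_class M g)) =
    compose (Lp_space M p) (conv_operator M p (ae_class M f)) (conv_operator M p (ae_class M g))"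
proof (rule extensional_class_eqI[OF conv_operator_extensional compose_extensional])
  fix h :: "'g \<Rightarrow> 'b" assume h: "h \<in> LP M p"
  note fg = cv_powr_bound(2)[OF f g order_refl] and gh = cv_powr_bound(2)[OF g h p]
  show "conv_operator M p (conv M (ae_class M f) (ae_class M g)) (ae_class M h) =
    compose (Lp_space M p) (conv_operator M p (ae_class M f)) (conv_operator M p (ae_class M g)) (ae_class M h)"
    using ae_class_eqI[OF cv_assoc[OF f g h p]] f g h p fg gh
    by (simp add: conv_class conv_operator_class compose_eq ae_class_in_Lp_space)
qed

text \<open>The positive and the negative part of \<open>f\<close> yield the two positive operators
  whose difference is required.\<close>

lemma conv_operator_regular:
  fixes f :: "'g \<Rightarrow> real"
  assumes f: "f \<in> LP M 1" and p: "1 \<le> p"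
  shows "conv_operator M p (ae_class M f) \<in> regular_operators (Lp_lattice M p)"
proof -
  let ?P = "\<lambda>x. max (f x) 0" and ?N = "\<lambda>x. max (- f x) 0"
  have PN: "?P \<in> LP M 1" "?N \<in> LP M 1" using LP_max_0[OF f] by simp_all
  have eq: "f = (\<lambda>x. ?P x + - 1 * ?N x)" by (auto simp: max_def)
  have "conv_operator M p (ae_class M f) = (\<lambda>H\<in>Lp_space M p. ae_lift2 M (+)
      (conv_operator M p (ae_class M ?P) H) (ae_lift M (\<lambda>y. - 1 * y) (conv_operator M p (ae_class M ?N) H)))"
    (is "_ = ?R")
  proof -
    have "conv_operator M p (ae_class M f) = conv_operator M p (ae_class M (\<lambda>x. ?P x + - 1 * ?N x))"
      using eq by simp
    also have "\<dots> = ?R"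
      unfolding conv_operator_add[OF PN(1) LP_mult[OF PN(2)] p] conv_operator_mult[OF PN(2) p]
      by (rule restrict_ext) (simp only: restrict_apply')
    finally show ?thesis .
  qed
  then show ?thesis
    unfolding regular_operators_def using conv_operator_positive[OF PN(1) _ p] conv_operator_positive[OF PN(2) _ p]
    by (intro CollectI exI[of _ "conv_operator M p (ae_class M ?P)"] exI[of _ "conv_operator M p (ae_class M ?N)"] conjI) simp_all
qed

text \<open>The hypothesis \<open>least\<close> says that \<open>|f \<star> g|\<close> is the supremum of the \<open>u \<star> g\<close> with \<open>u \<in> X\<close>;
  this passes from \<open>|f \<star> g|\<close> to \<open>|f| \<star> g\<close> once \<open>g\<close> is cut into small pieces.\<close>

lemma Sup_conv_operator:
  fixes f :: "'g \<Rightarrow> 'b::{real_normed_field,euclidean_space}"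
  assumes L: "carrier L = regular_operators (Lp_lattice M p)" "le L = le (regular_order (Lp_lattice M p))"
    and f: "f \<in> LP M 1" and p: "1 \<le> p" and X: "X \<subseteq> LP M 1"
    and le: "\<And>u. u \<in> X \<Longrightarrow> AE x in M. u x \<le> norm (f x)"
    and least: "\<And>g h. g \<in> LP M p \<Longrightarrow> (\<And>x. 0 \<le> g x) \<Longrightarrow> (\<And>u. u \<in> X \<Longrightarrow> AE s in M. cv M u g s \<le> h s) \<Longrightarrow>
      AE s in M. norm (cv M f (\<lambda>x. of_real (g x)) s) \<le> h s"
  shows "\<Squnion>\<^bsub>L\<^esub>((\<lambda>u. conv_operator M p (ae_class M u)) ` X) = conv_operator M p (ae_class M (\<lambda>x. norm (f x)))"
proof (rule Lattice_sup_eqI)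
  let ?E = "Lp_lattice M p"
  have p0: "0 \<le> p" using p by simp
  note fL = LP_norm[OF f]
  have leI: "conv_operator M p (ae_class M u) \<sqsubseteq>\<^bsub>L\<^esub> S"
    if u: "u \<in> LP M 1" and S: "\<And>g. g \<in> LP M p \<Longrightarrow> (\<And>x. 0 \<le> g x) \<Longrightarrow>
      \<exists>h\<in>LP M p. S (ae_class M g) = ae_class M h \<and> (AE s in M. cv M u g s \<le> h s)" for u S
    unfolding L(2) regular_order_def
  proof (simp, intro ballI impI)
    fix G assume G: "G \<in> Lp_space M p" "ae_class M (\<lambda>_. 0) \<sqsubseteq>\<^bsub>?E\<^esub> G"
    obtain g where g: "g \<in> LP M p" "\<And>x. 0 \<le> g x" "G = ae_class M g"
      by (rule Lp_lattice_nonnegE[of G M p]) (use G p0 in auto)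
    obtain h where "h \<in> LP M p" "S (ae_class M g) = ae_class M h" "AE s in M. cv M u g s \<le> h s"
      using S[OF g(1,2)] by blast
    then show "conv_operator M p (ae_class M u) G \<sqsubseteq>\<^bsub>?E\<^esub> S G"
      using LP_measurable[OF cv_powr_bound(2)[OF u g(1) p]] u g p LP_measurable[of h M p]
      by (simp add: conv_operator_class Lp_lattice_le_class)
  qed
  show "conv_operator M p (ae_class M (\<lambda>x. norm (f x))) \<in> carrier L"
    unfolding L(1) by (rule conv_operator_regular[OF fL p])
  show "(\<lambda>u. conv_operator M p (ae_class M u)) ` X \<subseteq> carrier L"
    unfolding L(1) using conv_operator_regular p X by auto
  show "a \<sqsubseteq>\<^bsub>L\<^esub> conv_operator M p (ae_class M (\<lambda>x. norm (f x)))"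
    if a: "a \<in> (\<lambda>u. conv_operator M p (ae_class M u)) ` X" for a
  proof -
    obtain u where u: "u \<in> X" "a = conv_operator M p (ae_class M u)" using a by auto
    have uL: "u \<in> LP M 1" using u X by auto
    show ?thesis
      unfolding u(2)
    proof (rule leI[OF uL])
      fix g :: "'g \<Rightarrow> real" assume g: "g \<in> LP M p" "\<And>x. 0 \<le> g x"
      show "\<exists>h\<in>LP M p. conv_operator M p (ae_class M (\<lambda>x. norm (f x))) (ae_class M g) = ae_class M h \<and>
          (AE s in M. cv M u g s \<le> h s)"
        using cv_powr_bound(2)[OF fL g(1) p] conv_operator_class[OF fL g(1) p]
          cv_mono_left[OF uL fL g(1) p le[OF u(1)] g(2)] by blast
    qed
  qed
  show "conv_operator M p (ae_class M (\<lambda>x. norm (f x))) \<sqsubseteq>\<^bsub>L\<^esub> S"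
    if S: "S \<in> carrier L" and ub: "\<And>a. a \<in> (\<lambda>u. conv_operator M p (ae_class M u)) ` X \<Longrightarrow> a \<sqsubseteq>\<^bsub>L\<^esub> S" for S
  proof -
    have lin: "linear_operator ?E S" using S L(1) p0 by (simp add: regular_operator_linear)
    obtain T where T: "\<And>g. g \<in> LP M p \<Longrightarrow> T g \<in> LP M p \<and> S (ae_class M g) = ae_class M (T g)"
      "\<And>g h. g \<in> LP M p \<Longrightarrow> h \<in> LP M p \<Longrightarrow> AE x in M. T (\<lambda>x. g x + h x) x = T g x + T h x"
      "\<And>c g. g \<in> LP M p \<Longrightarrow> AE x in M. T (\<lambda>x. c * g x) x = c * T g x"
      by (rule linear_operator_rep[OF lin p0], rule that)
    have T_ge: "AE s in M. norm (cv M f (\<lambda>x. of_real (g x)) s) \<le> T g s"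
      if g: "g \<in> LP M p" "\<And>x. 0 \<le> g x" for g
    proof (rule least[OF g])
      fix u assume u: "u \<in> X"
      have uL: "u \<in> LP M 1" using u X by auto
      have pos: "vzero ?E \<sqsubseteq>\<^bsub>?E\<^esub> ae_class M g"
        using g LP_measurable[OF g(1)] by (simp add: Lp_lattice_le_class)
      have "conv_operator M p (ae_class M u) \<sqsubseteq>\<^bsub>L\<^esub> S" by (rule ub) (use u in auto)
      then have "conv_operator M p (ae_class M u) (ae_class M g) \<sqsubseteq>\<^bsub>?E\<^esub> S (ae_class M g)"
        using pos ae_class_in_Lp_space[OF g(1)] unfolding L(2) regular_order_def by simp
      then show "AE s in M. cv M u g s \<le> T g s"
        using T(1)[OF g(1)] LP_measurable[OF cv_powr_bound(2)[OF uL g(1) p]] uL g p LP_measurable[of "T g" M p]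
        by (simp add: conv_operator_class Lp_lattice_le_class)
    qed
    show ?thesis
    proof (rule leI[OF fL])
      fix g :: "'g \<Rightarrow> real" assume g: "g \<in> LP M p" "\<And>x. 0 \<le> g x"
      have "AE s in M. cv M (\<lambda>x. norm (f x)) g s \<le> T g s"
        by (rule cv_norm_le[OF f p T(2) T_ge g])
      with T(1)[OF g(1)] show "\<exists>h\<in>LP M p. S (ae_class M g) = ae_class M h \<and> (AE s in M. cv M (\<lambda>x. norm (f x)) g s \<le> h s)"
        by blast
    qed
  qed
  show "S = conv_operator M p (ae_class M (\<lambda>x. norm (f x)))"
    if S: "S \<in> carrier L" "conv_operator M p (ae_class M (\<lambda>x. norm (f x))) \<sqsubseteq>\<^bsub>L\<^esub> S"
      "S \<sqsubseteq>\<^bsub>L\<^esub> conv_operator M p (ae_class M (\<lambda>x. norm (f x)))" for S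
    using regular_order_antisym[OF _ conv_operator_regular[OF fL p] p0] S by (simp add: L)
qed

text \<open>The set has the shape to which both \<open>modulus\<close> and
  \<open>regular_norm\<close> unfold; \<open>L\<close> is free because these take the supremum in
  different records.\<close>

lemma Sup_conv_operator_uminus:
  fixes f :: "'g \<Rightarrow> real"
  assumes L: "carrier L = regular_operators (Lp_lattice M p)" "le L = le (regular_order (Lp_lattice M p))"
    and f: "f \<in> LP M 1" and p: "1 \<le> p"
  shows "\<Squnion>\<^bsub>L\<^esub>{conv_operator M p (ae_class M f),
      \<lambda>H\<in>Lp_space M p. ae_lift M (\<lambda>y. - 1 * y) (conv_operator M p (ae_class M f) H)} =
    conv_operator M p (ae_class M (\<lambda>x. norm (f x)))"
proof -
  have "\<Squnion>\<^bsub>L\<^esub>((\<lambda>u. conv_operator M p (ae_class M u)) ` {f, \<lambda>x. - 1 * f x}) =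
      conv_operator M p (ae_class M (\<lambda>x. norm (f x)))"
  proof (rule Sup_conv_operator[OF L f p])
    show "{f, \<lambda>x. - 1 * f x} \<subseteq> LP M 1" using f LP_mult[OF f, of "- 1"] by simp
    show "AE x in M. u x \<le> norm (f x)" if "u \<in> {f, \<lambda>x. - 1 * f x}" for u
      using that by auto
    fix g h assume *: "\<And>u. u \<in> {f, \<lambda>x. - 1 * f x} \<Longrightarrow> AE s in M. cv M u g s \<le> h s"
    have "AE s in M. cv M f g s \<le> h s" "AE s in M. cv M (\<lambda>x. - 1 * f x) g s \<le> h s"
      by (rule *; simp)+
    then show "AE s in M. norm (cv M f (\<lambda>x. of_real (g x)) s) \<le> h s"
      unfolding cv_mult_left by eventually_elim (simp add: abs_le_iff)
  qed
  then show ?thesis by (simp only: image_insert image_empty conv_operator_mult[OF f p])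
qed

section \<open>Norm bounds and the homomorphism over the reals\<close>

lemma operator_norm_conv_le:
  fixes f :: "'g \<Rightarrow> real"
  assumes f: "f \<in> LP M 1" and p: "1 \<le> p"
  shows "operator_norm (Lp_lattice M p) (conv_operator M p (ae_class M f)) \<le> (LINT x|M. norm (f x))"
  unfolding operator_norm_def
proof (rule cSUP_least)
  \<comment> \<open>The zero class shows that the unit ball is non-empty, as the bound on a real
    supremum requires.\<close>
  have 0: "(\<lambda>_. 0 :: real) \<in> LP M p" by (simp add: LP_def)
  have "vnorm (Lp_lattice M p) (ae_class M (\<lambda>_. 0)) \<le> 1" by (simp add: Lp_norm_class)
  with ae_class_in_Lp_space[OF 0] show "{x \<in> carrier (Lp_lattice M p). vnorm (Lp_lattice M p) x \<le> 1} \<noteq> {}"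
    by auto
  fix G assume "G \<in> {x \<in> carrier (Lp_lattice M p). vnorm (Lp_lattice M p) x \<le> 1}"
  then have G: "G \<in> Lp_space M p" "Lp_norm M p G \<le> 1" by simp_all
  obtain g where g: "g \<in> LP M p" "G = ae_class M g" using Lp_spaceE[OF G(1)] .
  define C where "C = (LINT x|M. norm (f x))"
  define D where "D = (LINT x|M. norm (g x) powr p)"
  have CD: "0 \<le> C" "0 \<le> D" by (auto simp: C_def D_def)
  have D1: "D powr (1 / p) \<le> 1" using G(2) LP_measurable[OF g(1)] by (simp add: g(2) Lp_norm_class D_def)
  note L = cv_powr_bound(2)[OF f g(1) p]
  have "Lp_norm M p (conv_operator M p (ae_class M f) G) = (LINT x|M. norm (cv M f g x) powr p) powr (1 / p)"
    using LP_measurable[OF L] f g p by (simp add: conv_operator_class Lp_norm_class)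
  also have "\<dots> \<le> (C powr p * D) powr (1 / p)"
    using cv_powr_bound(3)[OF f g(1) p] p by (intro powr_mono2) (auto simp: C_def D_def)
  also have "\<dots> = C * D powr (1 / p)"
    using CD p by (simp add: powr_mult powr_powr)
  also have "\<dots> \<le> C" using CD D1 by (simp add: mult_left_le)
  finally show "vnorm (Lp_lattice M p) (conv_operator M p (ae_class M f) G) \<le> (LINT x|M. norm (f x))"
    by (simp add: C_def)
qed

text \<open>The regular norm is the operator norm of the modulus, which is convolution with
  \<open>|f|\<close>; and \<open>|f|\<close> has the same integral norm as \<open>f\<close>.\<close>

lemma regular_norm_conv_le:
  fixes f :: "'g \<Rightarrow> real"
  assumes f: "f \<in> LP M 1" and p: "1 \<le> p"
  shows "regular_norm (Lp_lattice M p) (conv_operator M p (ae_class M f)) \<le> (LINT x|M. norm (f x))"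
proof -
  have "regular_norm (Lp_lattice M p) (conv_operator M p (ae_class M f)) =
      operator_norm (Lp_lattice M p) (conv_operator M p (ae_class M (\<lambda>x. norm (f x))))"
    unfolding regular_norm_def Lp_lattice_simps
    by (subst Sup_conv_operator_uminus[OF _ _ f p]) (simp_all add: regular_order_def)
  also have "\<dots> \<le> (LINT x|M. norm (f x))"
    using operator_norm_conv_le[OF LP_norm[OF f] p] by simp
  finally show ?thesis .
qed

lemma L1_algebra_simps [simp]:
  "carrier (L1_algebra M) = Lp_space M 1"
  "le (L1_algebra M) = le (Lp_lattice M 1)"
  "vadd (L1_algebra M) = ae_lift2 M (+)"
  "vscale (L1_algebra M) c = ae_lift M (\<lambda>y. c * y)"
  "vnorm (L1_algebra M) = Lp_norm M 1"
  "amult (L1_algebra M) = conv M"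
  by (simp_all add: L1_algebra_def normed_lattice.defs normed_lattice_algebra.defs Lp_lattice_def)

lemma regular_algebra_simps [simp]:
  "carrier (regular_algebra E) = regular_operators E"
  "le (regular_algebra E) = le (regular_order E)"
  "vadd (regular_algebra E) S T = (\<lambda>x\<in>carrier E. vadd E (S x) (T x))"
  "vscale (regular_algebra E) c T = (\<lambda>x\<in>carrier E. vscale E c (T x))"
  "vnorm (regular_algebra E) = regular_norm E"
  "amult (regular_algebra E) = compose (carrier E)"
  by (simp_all add: regular_algebra_def regular_lattice_def regular_order_def normed_lattice.defs normed_lattice_algebra.defs)

lemma Lp_norm_1_class:
  fixes f :: "'g \<Rightarrow> 'b::{banach,second_countable_topology}"
  assumes "f \<in> LP M 1"
  shows "Lp_norm M 1 (ae_class M f) = (LINT x|M. norm (f x))"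
  unfolding Lp_norm_class[OF LP_measurable[OF assms]] by simp

lemma modulus_L1:
  fixes f :: "'g \<Rightarrow> real"
  assumes f: "f \<in> LP M 1"
  shows "modulus (L1_algebra M) (ae_class M f) = ae_class M (\<lambda>x. norm (f x))"
proof -
  have "\<Squnion>\<^bsub>L1_algebra M\<^esub>(ae_class M ` {f, \<lambda>x. - 1 * f x}) = ae_class M (\<lambda>x. norm (f x))"
  proof (rule Sup_ae_class[OF _ _ f])
    show "{f, \<lambda>x. - 1 * f x} \<subseteq> LP M 1" using f LP_mult[OF f, of "- 1"] by simp
    show "AE x in M. u x \<le> norm (f x)" if "u \<in> {f, \<lambda>x. - 1 * f x}" for u
      using that by auto
    fix h assume *: "\<And>u. u \<in> {f, \<lambda>x. - 1 * f x} \<Longrightarrow> AE x in M. u x \<le> h x"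
    have "AE x in M. f x \<le> h x" "AE x in M. - 1 * f x \<le> h x" by (rule *; simp)+
    then show "AE x in M. norm (f x) \<le> h x" by eventually_elim (simp add: abs_le_iff)
  qed simp_all
  moreover have "modulus (L1_algebra M) (ae_class M f) = \<Squnion>\<^bsub>L1_algebra M\<^esub>{ae_class M f, ae_class M (\<lambda>x. - 1 * f x)}"
    unfolding modulus_def L1_algebra_simps ae_lift_class[OF LP_measurable[OF f]] ..
  ultimately show ?thesis by simp
qed

lemma class_diff:
  fixes f g :: "'g \<Rightarrow> 'b::{real_normed_field,euclidean_space}"
  assumes "f \<in> LP M 1" "g \<in> LP M 1"
  shows "ae_lift2 M (+) (ae_class M f) (ae_lift M (\<lambda>y. - 1 * y) (ae_class M g)) = ae_class M (\<lambda>x. f x + - 1 * g x)"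
    and "(\<lambda>x. f x + - 1 * g x) \<in> LP M 1"
proof -
  note L = LP_mult[OF assms(2), of "- 1"]
  show "ae_lift2 M (+) (ae_class M f) (ae_lift M (\<lambda>y. - 1 * y) (ae_class M g)) = ae_class M (\<lambda>x. f x + - 1 * g x)"
    unfolding ae_lift_class[OF LP_measurable[OF assms(2)]]
    by (rule ae_lift2_class[OF LP_measurable[OF assms(1)] LP_measurable[OF L]])
  show "(\<lambda>x. f x + - 1 * g x) \<in> LP M 1" by (rule LP_add[OF assms(1) L]) simp
qed

text \<open>The left-hand side, with its nested restrictions, is what the differences in
  \<open>vdist\<close> and \<open>cdist\<close> unfold to.\<close>

lemma conv_operator_diff:
  fixes f g :: "'g \<Rightarrow> 'b::{real_normed_field,euclidean_space}"
  assumes f: "f \<in> LP M 1" and g: "g \<in> LP M 1" and p: "1 \<le> p"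
  shows "(\<lambda>H\<in>Lp_space M p. ae_lift2 M (+) (conv_operator M p (ae_class M f) H)
      ((\<lambda>H\<in>Lp_space M p. ae_lift M (\<lambda>y. - 1 * y) (conv_operator M p (ae_class M g) H)) H)) =
    conv_operator M p (ae_class M (\<lambda>x. f x + - 1 * g x))"
  by (simp only: conv_operator_add[OF f LP_mult[OF g] p] conv_operator_mult[OF g p])

lemma bla_hom_conv_operator:
  assumes p: "1 \<le> p"
  shows "bla_hom (L1_algebra M) (regular_algebra (Lp_lattice M p)) (conv_operator M p)"
  unfolding bla_hom_def L1_algebra_simps regular_algebra_simps Lp_lattice_simps
proof (intro conjI ballI allI)
  show "conv_operator M p \<in> Lp_space M 1 \<rightarrow> regular_operators (Lp_lattice M p)"
    using conv_operator_regular[OF _ p] by (auto simp: Lp_space_eq)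
  show "dist_continuous_on (Lp_space M 1) (vdist (L1_algebra M)) (vdist (regular_algebra (Lp_lattice M p))) (conv_operator M p)"
    unfolding dist_continuous_on_def
  proof (intro ballI allI impI)
    fix F :: "('g \<Rightarrow> real) set" and e :: real assume F: "F \<in> Lp_space M 1" and e: "0 < e"
    obtain f where f: "f \<in> LP M 1" "F = ae_class M f" using Lp_spaceE[OF F] .
    show "\<exists>d>0. \<forall>G\<in>Lp_space M 1. vdist (L1_algebra M) G F < d \<longrightarrow>
        vdist (regular_algebra (Lp_lattice M p)) (conv_operator M p G) (conv_operator M p F) < e"
    \<comment> \<open>The map is contractive, so \<epsilon> itself serves as \<delta>.\<close>
    proof (intro exI[of _ e] conjI e ballI impI)
      fix G assume G: "G \<in> Lp_space M 1" and dist: "vdist (L1_algebra M) G F < e"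
      obtain g where g: "g \<in> LP M 1" "G = ae_class M g" using Lp_spaceE[OF G] .
      note gf = class_diff[OF g(1) f(1)]
      have "vdist (regular_algebra (Lp_lattice M p)) (conv_operator M p G) (conv_operator M p F) =
          regular_norm (Lp_lattice M p) (conv_operator M p (ae_class M (\<lambda>x. g x + - 1 * f x)))"
        unfolding vdist_def regular_algebra_simps Lp_lattice_simps f(2) g(2)
        by (simp only: conv_operator_diff[OF g(1) f(1) p])
      also have "\<dots> \<le> vdist (L1_algebra M) G F"
        unfolding vdist_def L1_algebra_simps f(2) g(2) gf(1) Lp_norm_1_class[OF gf(2)]
        by (rule regular_norm_conv_le[OF gf(2) p])
      finally show "vdist (regular_algebra (Lp_lattice M p)) (conv_operator M p G) (conv_operator M p F) < e"
        using dist by simp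
    qed
  qed
  fix F :: "('g \<Rightarrow> real) set" assume F: "F \<in> Lp_space M 1"
  then obtain f where f: "f \<in> LP M 1" "F = ae_class M f" by (rule Lp_spaceE)
  note fm = LP_measurable[OF f(1)]
  show "conv_operator M p (ae_lift M (\<lambda>y. c * y) F) = (\<lambda>x\<in>Lp_space M p. ae_lift M (\<lambda>y. c * y) (conv_operator M p F x))" for c
    unfolding f(2) ae_lift_class[OF fm] by (rule conv_operator_mult[OF f(1) p])
  show "modulus (regular_algebra (Lp_lattice M p)) (conv_operator M p F) = conv_operator M p (modulus (L1_algebra M) F)"
    unfolding f(2) modulus_L1[OF f(1)]
    unfolding modulus_def regular_algebra_simps Lp_lattice_simps
    by (rule Sup_conv_operator_uminus[OF _ _ f(1) p]) simp_all
  fix G :: "('g \<Rightarrow> real) set" assume G: "G \<in> Lp_space M 1"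
  then obtain g where g: "g \<in> LP M 1" "G = ae_class M g" by (rule Lp_spaceE)
  note gm = LP_measurable[OF g(1)]
  show "conv_operator M p (ae_lift2 M (+) F G) = (\<lambda>x\<in>Lp_space M p. ae_lift2 M (+) (conv_operator M p F x) (conv_operator M p G x))"
    unfolding f(2) g(2) ae_lift2_class[OF fm gm] by (rule conv_operator_add[OF f(1) g(1) p])
  show "conv_operator M p (conv M F G) = compose (Lp_space M p) (conv_operator M p F) (conv_operator M p G)"
    unfolding f(2) g(2) by (rule conv_operator_compose[OF f(1) g(1) p])
qed

end

section \<open>Injectivity\<close>

context haar_measure
begin

lemma conv_operator_inj:
  fixes f g :: "'g \<Rightarrow> 'b::{real_normed_field,euclidean_space}"
  assumes f: "f \<in> LP M 1" and g: "g \<in> LP M 1" and p: "1 \<le> p"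
    and eq: "conv_operator M p (ae_class M f) = conv_operator M p (ae_class M g)"
  shows "ae_class M f = ae_class M g"
proof (rule ae_class_eqI)
  define d where "d x = f x + - 1 * g x" for x
  have d: "d \<in> LP M 1" unfolding d_def[abs_def] by (rule class_diff(2)[OF f g])
  have zero: "AE s in M. cv M d h s = 0" if h: "h \<in> LP M p" for h :: "'g \<Rightarrow> 'b"
  proof -
    have "ae_class M (cv M f h) = ae_class M (cv M g h)"
      using conv_operator_class[OF f h p] conv_operator_class[OF g h p] by (simp add: eq)
    from ae_class_eqD[OF this LP_measurable[OF cv_powr_bound(2)[OF f h p]]]
    show ?thesis
      using cv_add_left[OF f LP_mult[OF g] h p, of "- 1"]
    proof eventually_elim
      case (elim s)
      have "cv M (\<lambda>x. - 1 * g x) h s = - 1 * cv M g h s" by (rule cv_mult_left)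
      with elim show ?case by (simp add: d_def[abs_def])
    qed
  qed
  obtain V W :: "'g set" where V: "compact V" "open W" "0 \<in> W" "W \<subseteq> V"
    using symmetric_compact_neighbourhood by metis
  have Vb[measurable]: "V \<in> sets borel" using V(1) by (rule borel_compact)
  have Vfin: "emeasure M V < \<infinity>" by (rule emeasure_compact_less_top[OF V(1)])
  \<comment> \<open>The test function for \<open>|d|\<close>: compactness of \<open>V\<close> makes
    its integral finite, and the open set \<open>W\<close> inside \<open>V\<close> makes it
    non-zero.\<close>
  define k :: "'g \<Rightarrow> real" where "k = indicator V"
  have k0: "0 \<le> k x" for x by (simp add: k_def)
  have "(\<lambda>x. norm (k x) powr q) = k" if "0 < q" for q using that by (auto simp: k_def indicator_def)
  moreover have "integrable M k" unfolding k_def using Vfin by (intro integrable_real_indicator) auto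
  ultimately have k: "k \<in> LP M q" if "0 < q" for q
    using that by (simp add: LP_def)
  have nd: "(\<lambda>x. norm (d x)) \<in> LP M 1" by (rule LP_norm[OF d])
  have kp: "k \<in> LP M p" using p by (intro k) simp
  have "AE s in M. cv M (\<lambda>x. norm (d x)) k s \<le> 0"
  \<comment> \<open>All convolutions with \<open>d\<close> vanish, so \<open>T = 0\<close> is an
    upper bound and must dominate the convolution with \<open>|d|\<close> as well.\<close>
  proof (rule cv_norm_le[OF d p _ _ kp k0, where T="\<lambda>_ _. 0"])
    show "AE s in M. norm (cv M d (\<lambda>x. of_real (h x)) s) \<le> 0" if "h \<in> LP M p" for h
      using zero[OF LP_of_real[OF that]] by eventually_elim simp
  qed simp
  then have "AE s in M. (\<integral>\<^sup>+t. ennreal (norm (d t)) * ennreal (k (- t + s)) \<partial>M) = 0"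
    using cv_powr_bound(1)[OF nd kp p]
  proof eventually_elim
    case (elim s)
    then have "cv M (\<lambda>x. norm (d x)) k s = 0"
      using cv_nonneg[of "\<lambda>x. norm (d x)" k s] k0 by simp
    moreover have "(\<integral>\<^sup>+t. ennreal (norm (d t) * k (- t + s)) \<partial>M) = ennreal (cv M (\<lambda>x. norm (d x)) k s)"
      using elim k0 unfolding cv_def by (intro nn_integral_eq_integral) auto
    ultimately show ?case using k0 by (simp add: ennreal_mult)
  qed
  then have "(\<integral>\<^sup>+s. \<integral>\<^sup>+t. ennreal (norm (d t)) * ennreal (k (- t + s)) \<partial>M \<partial>M) = (\<integral>\<^sup>+s. 0 \<partial>M)"
    by (rule nn_integral_cong_AE)
  have dm: "d \<in> borel_measurable borel" using LP_measurable[OF d] by simp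
  have "(\<integral>\<^sup>+s. \<integral>\<^sup>+t. ennreal (norm (d t)) * ennreal (k (- t + s)) \<partial>M \<partial>M) =
      (\<integral>\<^sup>+t. ennreal (norm (d t)) \<partial>M) * (\<integral>\<^sup>+t. ennreal (k t) \<partial>M)"
  proof (rule nn_integral_convolution(1))
    show "(\<lambda>x. ennreal (norm (d x))) \<in> borel_measurable borel" using dm by simp
    show "(\<lambda>x. ennreal (k x)) \<in> borel_measurable borel" by (simp add: k_def)
    show "sigma_bounded {x. ennreal (norm (d x)) \<noteq> 0}" using LP_sigma_bounded[OF d] by simp
    show "sigma_bounded {x. ennreal (k x) \<noteq> 0}"
      by (rule sigma_bounded_subset[OF sigma_bounded_compact[OF V(1)]]) (auto simp: k_def indicator_def)
  qed
  also have "(\<integral>\<^sup>+t. ennreal (k t) \<partial>M) = emeasure M V"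
    unfolding k_def ennreal_indicator by simp
  finally have "(\<integral>\<^sup>+t. ennreal (norm (d t)) \<partial>M) * emeasure M V = 0"
    using \<open>_ = (\<integral>\<^sup>+s. 0 \<partial>M)\<close> by simp
  moreover have "W \<noteq> {}" using V(3) by blast
  then have "emeasure M V \<noteq> 0"
    using emeasure_open_pos[OF V(2)] emeasure_mono[OF V(4), of M] by auto
  ultimately have "(\<integral>\<^sup>+t. ennreal (norm (d t)) \<partial>M) = 0" by simp
  then have "AE t in M. ennreal (norm (d t)) = 0"
    using dm by (subst (asm) nn_integral_0_iff_AE) auto
  then show "AE t in M. f t = g t" by eventually_elim (simp add: d_def)
qed

lemma inj_on_conv_operator:
  assumes "1 \<le> p"
  shows "inj_on (conv_operator M p) (Lp_space M 1 :: ('g \<Rightarrow> 'b::{real_normed_field,euclidean_space}) set set)"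
proof (rule inj_onI)
  fix F G :: "('g \<Rightarrow> 'b) set"
  assume "F \<in> Lp_space M 1" "G \<in> Lp_space M 1" and eq: "conv_operator M p F = conv_operator M p G"
  then obtain f g where fg: "f \<in> LP M 1" "F = ae_class M f" "g \<in> LP M 1" "G = ae_class M g"
    by (metis Lp_spaceE)
  show "F = G"
    using conv_operator_inj[OF fg(1,3) assms] eq unfolding fg(2,4) by blast
qed

end

section \<open>Complex scalars\<close>

lemma LP_Re: "f \<in> LP M p \<Longrightarrow> 0 \<le> p \<Longrightarrow> (\<lambda>x. Re (f x)) \<in> LP M p"
  and LP_Im: "f \<in> LP M p \<Longrightarrow> 0 \<le> p \<Longrightarrow> (\<lambda>x. Im (f x)) \<in> LP M p"
proof -
  assume f: "f \<in> LP M p" and p: "0 \<le> p"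
  have *: "(\<lambda>x. norm (f x)) \<in> LP M p" by (rule LP_norm[OF f])
  have fm[measurable]: "f \<in> borel_measurable M" by (rule LP_measurable[OF f])
  show "(\<lambda>x. Re (f x)) \<in> LP M p" by (rule LP_bound[OF * _ _ p]) (auto simp: abs_Re_le_cmod)
  show "(\<lambda>x. Im (f x)) \<in> LP M p" by (rule LP_bound[OF * _ _ p]) (auto simp: abs_Im_le_cmod)
qed

lemma complex_rotation_le_norm: "cos \<theta> * Re z + sin \<theta> * Im z \<le> norm z"
proof -
  have "cos \<theta> * Re z + sin \<theta> * Im z = Re (cis (- \<theta>) * z)" by (simp add: cis.code)
  also have "\<dots> \<le> norm z" using complex_Re_le_cmod[of "cis (- \<theta>) * z"] by (simp add: norm_mult)
  finally show ?thesis .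
qed

lemma complex_rotation_eq_norm: "\<exists>\<theta>. cos \<theta> * Re z + sin \<theta> * Im z = norm z"
proof (intro exI)
  have "Re z = norm z * cos (Arg z)" "Im z = norm z * sin (Arg z)"
    by (metis Re_rcis rcis_cmod_Arg, metis Im_rcis rcis_cmod_Arg)
  then have "cos (Arg z) * Re z + sin (Arg z) * Im z = norm z * ((cos (Arg z))\<^sup>2 + (sin (Arg z))\<^sup>2)"
    by (metis (no_types) distrib_left mult.left_commute power2_eq_square)
  then show "cos (Arg z) * Re z + sin (Arg z) * Im z = norm z" by simp
qed

text \<open>Each angle comes with its own null set, so only countably many may be combined: rational
  angles suffice by continuity in \<open>\<theta>\<close>. Since these leave
  \<open>{0..2 * pi}\<close>, the hypothesis is extended by periodicity beforehand.\<close>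

lemma AE_norm_le_of_rotations:
  fixes z :: "'a \<Rightarrow> complex"
  assumes le: "\<And>\<theta>. \<theta> \<in> {0..2 * pi} \<Longrightarrow> AE x in M. cos \<theta> * Re (z x) + sin \<theta> * Im (z x) \<le> h x"
  shows "AE x in M. norm (z x) \<le> h x"
proof -
  have "AE x in M. cos \<theta> * Re (z x) + sin \<theta> * Im (z x) \<le> h x" for \<theta>
  proof -
    obtain t where "0 \<le> t" "t < 2 * pi" "cos \<theta> = cos t" "sin \<theta> = sin t"
      using sincos_total_2pi[of "cos \<theta>" "sin \<theta>"] by (metis sin_cos_squared_add2)
    with le[of t] show ?thesis by simp
  qed
  then have "AE x in M. \<forall>\<theta>\<in>\<rat>. cos \<theta> * Re (z x) + sin \<theta> * Im (z x) \<le> h x"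
    by (subst AE_ball_countable) (auto simp: countable_rat)
  then show ?thesis
  proof eventually_elim
    case (elim x)
    let ?S = "{\<theta>. cos \<theta> * Re (z x) + sin \<theta> * Im (z x) \<le> h x}"
    have "closed ?S" by (intro closed_Collect_le continuous_intros)
    moreover have "\<rat> \<subseteq> ?S" using elim by auto
    ultimately have "closure \<rat> \<subseteq> ?S" by (intro closure_minimal)
    then have "\<theta> \<in> ?S" for \<theta> using Rats_closure_real by auto
    then show ?case using complex_rotation_eq_norm[of "z x"] by (metis mem_Collect_eq)
  qed
qed

lemma complex_Lp_simps [simp]:
  "carrier (complex_Lp M p) = Lp_space M p"
  "cadd (complex_Lp M p) = ae_lift2 M (+)"
  "cscale (complex_Lp M p) c = ae_lift M (\<lambda>y. c * y)"
  "re_part (complex_Lp M p) = ae_lift M Re"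
  "im_part (complex_Lp M p) = ae_lift M Im"
  "inj_real (complex_Lp M p) = ae_lift M complex_of_real"
  "real_lattice (complex_Lp M p) = Lp_lattice M p"
  by (simp_all add: complex_Lp_def)

lemma complex_L1_algebra_simps [simp]:
  "carrier (complex_L1_algebra M) = Lp_space M 1"
  "cadd (complex_L1_algebra M) = ae_lift2 M (+)"
  "cscale (complex_L1_algebra M) c = ae_lift M (\<lambda>y. c * y)"
  "re_part (complex_L1_algebra M) = ae_lift M Re"
  "im_part (complex_L1_algebra M) = ae_lift M Im"
  "inj_real (complex_L1_algebra M) = ae_lift M complex_of_real"
  "real_lattice (complex_L1_algebra M) = Lp_lattice M 1"
  "cmult (complex_L1_algebra M) = conv M"
  by (simp_all add: complex_L1_algebra_def complex_Lp_def complexified.defs complexified_algebra.defs)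

lemma complex_regular_algebra_simps [simp]:
  "carrier (complex_regular_algebra Z) = complex_regular_operators Z"
  "cadd (complex_regular_algebra Z) S T = (\<lambda>z\<in>carrier Z. cadd Z (S z) (T z))"
  "cscale (complex_regular_algebra Z) c T = (\<lambda>z\<in>carrier Z. cscale Z c (T z))"
  "re_part (complex_regular_algebra Z) T = (\<lambda>x\<in>carrier (real_lattice Z). re_part Z (T (inj_real Z x)))"
  "im_part (complex_regular_algebra Z) T = (\<lambda>x\<in>carrier (real_lattice Z). im_part Z (T (inj_real Z x)))"
  "inj_real (complex_regular_algebra Z) = complexify_operator Z"
  "real_lattice (complex_regular_algebra Z) = regular_lattice (real_lattice Z)"
  "cmult (complex_regular_algebra Z) = compose (carrier Z)"
  by (simp_all add: complex_regular_algebra_def)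

lemma regular_lattice_simps [simp]:
  "carrier (regular_lattice E) = regular_operators E"
  "le (regular_lattice E) = le (regular_order E)"
  "vadd (regular_lattice E) S T = (\<lambda>x\<in>carrier E. vadd E (S x) (T x))"
  "vscale (regular_lattice E) c T = (\<lambda>x\<in>carrier E. vscale E c (T x))"
  "vnorm (regular_lattice E) = regular_norm E"
  by (simp_all add: regular_lattice_def regular_order_def)

context haar_measure
begin

section \<open>Real and imaginary parts of a convolution operator\<close>

text \<open>The four real convolutions are grouped as \<open>S\<^sub>1 + \<i> S\<^sub>2\<close>
  applied to \<open>Re g + \<i> Im g\<close>, matching \<open>complexify_operator\<close> and
  \<open>complex_regular_operators\<close>.\<close>

lemma cv_complex:
  fixes f g :: "'g \<Rightarrow> complex"
  assumes f: "f \<in> LP M 1" and g: "g \<in> LP M p" and p: "1 \<le> p"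
  shows "AE s in M. cv M f g s =
    of_real (cv M (\<lambda>x. Re (f x)) (\<lambda>x. Re (g x)) s) + \<i> * of_real (cv M (\<lambda>x. Re (f x)) (\<lambda>x. Im (g x)) s) +
    \<i> * (of_real (cv M (\<lambda>x. Im (f x)) (\<lambda>x. Re (g x)) s) + \<i> * of_real (cv M (\<lambda>x. Im (f x)) (\<lambda>x. Im (g x)) s))"
proof -
  have p0: "0 \<le> p" "(0::real) \<le> 1" using p by simp_all
  note F = LP_Re[OF f p0(2)] LP_Im[OF f p0(2)] and G = LP_Re[OF g p0(1)] LP_Im[OF g p0(1)]
  show ?thesis
    using cv_powr_bound(1)[OF f g p] cv_powr_bound(1)[OF F(1) G(1) p] cv_powr_bound(1)[OF F(1) G(2) p]
      cv_powr_bound(1)[OF F(2) G(1) p] cv_powr_bound(1)[OF F(2) G(2) p]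
  proof eventually_elim
    case (elim s)
    have "Re (cv M f g s) = (LINT t|M. Re (f t * g (- t + s)))"
      "Im (cv M f g s) = (LINT t|M. Im (f t * g (- t + s)))"
      using elim(1) by (simp_all only: cv_def integral_Re integral_Im)
    then show ?case using elim(2-5) by (intro complex_eqI) (simp_all add: cv_def)
  qed
qed

lemma complexify_conv_operator_class:
  fixes u :: "'g \<Rightarrow> real" and g :: "'g \<Rightarrow> complex"
  assumes u: "u \<in> LP M 1" and g: "g \<in> LP M p" and p: "1 \<le> p"
  shows "complexify_operator (complex_Lp M p) (conv_operator M p (ae_class M u)) (ae_class M g) =
    ae_class M (\<lambda>s. of_real (cv M u (\<lambda>x. Re (g x)) s) + \<i> * of_real (cv M u (\<lambda>x. Im (g x)) s))"
    and "(\<lambda>s. complex_of_real (cv M u (\<lambda>x. Re (g x)) s) + \<i> * of_real (cv M u (\<lambda>x. Im (g x)) s)) \<in> borel_measurable M"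
proof -
  have p0: "0 \<le> p" using p by simp
  note gm = LP_measurable[OF g] and G = LP_Re[OF g p0] LP_Im[OF g p0]
  note C = LP_measurable[OF cv_powr_bound(2)[OF u G(1) p]] LP_measurable[OF cv_powr_bound(2)[OF u G(2) p]]
  have C': "(\<lambda>s. complex_of_real (cv M u (\<lambda>x. Re (g x)) s)) \<in> borel_measurable M"
    "(\<lambda>s. complex_of_real (cv M u (\<lambda>x. Im (g x)) s)) \<in> borel_measurable M"
    "(\<lambda>s. \<i> * complex_of_real (cv M u (\<lambda>x. Im (g x)) s)) \<in> borel_measurable M"
    using C by simp_all
  show "complexify_operator (complex_Lp M p) (conv_operator M p (ae_class M u)) (ae_class M g) =
    ae_class M (\<lambda>s. of_real (cv M u (\<lambda>x. Re (g x)) s) + \<i> * of_real (cv M u (\<lambda>x. Im (g x)) s))"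
    unfolding complexify_operator_def complex_Lp_simps restrict_apply'[OF ae_class_in_Lp_space[OF g]]
      ae_lift_class[OF gm] conv_operator_class[OF u G(1) p] conv_operator_class[OF u G(2) p]
      ae_lift_class[OF C(1)] ae_lift_class[OF C(2)] ae_lift_class[OF C'(2)] ae_lift2_class[OF C'(1,3)] ..
  show "(\<lambda>s. complex_of_real (cv M u (\<lambda>x. Re (g x)) s) + \<i> * of_real (cv M u (\<lambda>x. Im (g x)) s)) \<in> borel_measurable M"
    by (rule borel_measurable_add[OF C'(1,3)])
qed

lemma conv_operator_complex_regular:
  fixes f :: "'g \<Rightarrow> complex"
  assumes f: "f \<in> LP M 1" and p: "1 \<le> p"
  shows "conv_operator M p (ae_class M f) \<in> complex_regular_operators (complex_Lp M p)"
proof -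
  have F: "(\<lambda>x. Re (f x)) \<in> LP M 1" "(\<lambda>x. Im (f x)) \<in> LP M 1"
    using LP_Re[OF f] LP_Im[OF f] by simp_all
  define S1 where "S1 = conv_operator M p (ae_class M (\<lambda>x. Re (f x)))"
  define S2 where "S2 = conv_operator M p (ae_class M (\<lambda>x. Im (f x)))"
  have "conv_operator M p (ae_class M f) = (\<lambda>z\<in>Lp_space M p. ae_lift2 M (+)
      (complexify_operator (complex_Lp M p) S1 z)
      (ae_lift M (\<lambda>y. \<i> * y) (complexify_operator (complex_Lp M p) S2 z)))" (is "_ = ?R")
  proof (rule extensional_class_eqI[OF conv_operator_extensional restrict_extensional])
    fix g :: "'g \<Rightarrow> complex" assume g: "g \<in> LP M p"
    note C1 = complexify_conv_operator_class[OF F(1) g p] and C2 = complexify_conv_operator_class[OF F(2) g p]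
    have C2': "(\<lambda>s. \<i> * (complex_of_real (cv M (\<lambda>x. Im (f x)) (\<lambda>x. Re (g x)) s) +
        \<i> * of_real (cv M (\<lambda>x. Im (f x)) (\<lambda>x. Im (g x)) s))) \<in> borel_measurable M"
      by (rule borel_measurable_times[OF borel_measurable_const C2(2)])
    show "conv_operator M p (ae_class M f) (ae_class M g) = ?R (ae_class M g)"
      unfolding restrict_apply'[OF ae_class_in_Lp_space[OF g]] S1_def S2_def C1(1) C2(1)
        ae_lift_class[OF C2(2)] ae_lift2_class[OF C1(2) C2'] conv_operator_class[OF f g p]
      by (rule ae_class_eqI[OF cv_complex[OF f g p]])
  qed
  moreover have "S1 \<in> regular_operators (Lp_lattice M p)" "S2 \<in> regular_operators (Lp_lattice M p)"
    unfolding S1_def S2_def by (rule conv_operator_regular[OF F(1) p], rule conv_operator_regular[OF F(2) p])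
  ultimately show ?thesis
    unfolding complex_regular_operators_def complex_Lp_simps by blast
qed

lemma cv_of_real_right:
  fixes f :: "'g \<Rightarrow> complex" and g :: "'g \<Rightarrow> real"
  assumes f: "f \<in> LP M 1" and g: "g \<in> LP M p" and p: "1 \<le> p"
  shows "AE s in M. Re (cv M f (\<lambda>x. of_real (g x)) s) = cv M (\<lambda>x. Re (f x)) g s \<and>
    Im (cv M f (\<lambda>x. of_real (g x)) s) = cv M (\<lambda>x. Im (f x)) g s"
  using cv_complex[OF f LP_of_real[OF g] p] by eventually_elim (simp add: cv_def)

text \<open>The left-hand sides are \<open>re_part\<close> and \<open>im_part\<close> of the complex
  regular algebra in unfolded form; convolving with a real function separates the two parts of
  \<open>f\<close>.\<close>

lemma re_im_part_conv_operator:
  fixes f :: "'g \<Rightarrow> complex"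
  assumes f: "f \<in> LP M 1" and p: "1 \<le> p"
  shows "(\<lambda>x\<in>Lp_space M p. ae_lift M Re (conv_operator M p (ae_class M f) (ae_lift M complex_of_real x))) =
      conv_operator M p (ae_class M (\<lambda>x. Re (f x)))"
    and "(\<lambda>x\<in>Lp_space M p. ae_lift M Im (conv_operator M p (ae_class M f) (ae_lift M complex_of_real x))) =
      conv_operator M p (ae_class M (\<lambda>x. Im (f x)))"
proof -
  have F: "(\<lambda>x. Re (f x)) \<in> LP M 1" "(\<lambda>x. Im (f x)) \<in> LP M 1"
    using LP_Re[OF f] LP_Im[OF f] by simp_all
  have *: "(\<lambda>x\<in>Lp_space M p. ae_lift M R (conv_operator M p (ae_class M f) (ae_lift M complex_of_real x))) (ae_class M g) =
      ae_class M (\<lambda>s. R (cv M f (\<lambda>x. of_real (g x)) s))"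
    if g: "g \<in> LP M p" for g and R :: "complex \<Rightarrow> real"
    unfolding restrict_apply'[OF ae_class_in_Lp_space[OF g]] ae_lift_class[OF LP_measurable[OF g]]
      conv_operator_class[OF f LP_of_real[OF g] p]
    by (rule ae_lift_class[OF LP_measurable[OF cv_powr_bound(2)[OF f LP_of_real[OF g] p]]])
  show "(\<lambda>x\<in>Lp_space M p. ae_lift M Re (conv_operator M p (ae_class M f) (ae_lift M complex_of_real x))) =
      conv_operator M p (ae_class M (\<lambda>x. Re (f x)))"
  proof (rule extensional_class_eqI[OF restrict_extensional conv_operator_extensional])
    fix g :: "'g \<Rightarrow> real" assume g: "g \<in> LP M p"
    show "(\<lambda>x\<in>Lp_space M p. ae_lift M Re (conv_operator M p (ae_class M f) (ae_lift M complex_of_real x))) (ae_class M g) =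
        conv_operator M p (ae_class M (\<lambda>x. Re (f x))) (ae_class M g)"
      unfolding *[OF g] conv_operator_class[OF F(1) g p]
      using cv_of_real_right[OF f g p] by (intro ae_class_eqI) (auto elim!: eventually_mono)
  qed
  show "(\<lambda>x\<in>Lp_space M p. ae_lift M Im (conv_operator M p (ae_class M f) (ae_lift M complex_of_real x))) =
      conv_operator M p (ae_class M (\<lambda>x. Im (f x)))"
  proof (rule extensional_class_eqI[OF restrict_extensional conv_operator_extensional])
    fix g :: "'g \<Rightarrow> real" assume g: "g \<in> LP M p"
    show "(\<lambda>x\<in>Lp_space M p. ae_lift M Im (conv_operator M p (ae_class M f) (ae_lift M complex_of_real x))) (ae_class M g) =
        conv_operator M p (ae_class M (\<lambda>x. Im (f x))) (ae_class M g)"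
      unfolding *[OF g] conv_operator_class[OF F(2) g p]
      using cv_of_real_right[OF f g p] by (intro ae_class_eqI) (auto elim!: eventually_mono)
  qed
qed

section \<open>Complex moduli and the homomorphism over the complex numbers\<close>

text \<open>The third function is the real part of \<open>cis (- \<theta>) * f x\<close>.\<close>

lemma LP_rotation:
  fixes f :: "'g \<Rightarrow> complex"
  assumes f: "f \<in> LP M 1"
  shows "(\<lambda>x. cos \<theta> * Re (f x)) \<in> LP M 1" "(\<lambda>x. sin \<theta> * Im (f x)) \<in> LP M 1"
    "(\<lambda>x. cos \<theta> * Re (f x) + sin \<theta> * Im (f x)) \<in> LP M 1"
proof -
  show 1: "(\<lambda>x. cos \<theta> * Re (f x)) \<in> LP M 1" by (rule LP_mult[OF LP_Re[OF f]]) simp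
  show 2: "(\<lambda>x. sin \<theta> * Im (f x)) \<in> LP M 1" by (rule LP_mult[OF LP_Im[OF f]]) simp
  show "(\<lambda>x. cos \<theta> * Re (f x) + sin \<theta> * Im (f x)) \<in> LP M 1" by (rule LP_add[OF 1 2]) simp
qed

lemma cmodulus_complex_L1:
  fixes f :: "'g \<Rightarrow> complex"
  assumes f: "f \<in> LP M 1"
  shows "cmodulus (complex_L1_algebra M) (ae_class M f) = ae_class M (\<lambda>x. norm (f x))"
proof -
  let ?u = "\<lambda>\<theta> x. cos \<theta> * Re (f x) + sin \<theta> * Im (f x)"
  note F = LP_measurable[OF LP_Re[OF f]] LP_measurable[OF LP_Im[OF f]]
  have "ae_lift2 M (+) (ae_lift M (\<lambda>y. cos \<theta> * y) (ae_lift M Re (ae_class M f)))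
      (ae_lift M (\<lambda>y. sin \<theta> * y) (ae_lift M Im (ae_class M f))) = ae_class M (?u \<theta>)" for \<theta>
    using F unfolding ae_lift_class[OF LP_measurable[OF f]]
    by (simp only: ae_lift_class ae_lift2_class LP_measurable[OF LP_rotation(1)[OF f]] LP_measurable[OF LP_rotation(2)[OF f]] zero_le_one)
  then have "cmodulus (complex_L1_algebra M) (ae_class M f) = \<Squnion>\<^bsub>Lp_lattice M 1\<^esub>(ae_class M ` (?u ` {0..2 * pi}))"
    by (simp only: cmodulus_def Let_def complex_L1_algebra_simps Lp_lattice_simps image_image)
  also have "\<dots> = ae_class M (\<lambda>x. norm (f x))"
  proof (rule Sup_ae_class[OF _ refl f])
    show "?u ` {0..2 * pi} \<subseteq> LP M 1" using LP_rotation(3)[OF f] by auto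
    show "AE x in M. u x \<le> norm (f x)" if "u \<in> ?u ` {0..2 * pi}" for u
      using that complex_rotation_le_norm by auto
    show "AE x in M. norm (f x) \<le> h x"
      if "\<And>u. u \<in> ?u ` {0..2 * pi} \<Longrightarrow> AE x in M. u x \<le> h x" for h
      by (rule AE_norm_le_of_rotations) (rule that, rule imageI)
  qed simp
  finally show ?thesis .
qed

text \<open>The operator at angle \<open>\<theta>\<close> is convolution with the real part of
  \<open>cis (- \<theta>) * f x\<close>, so \<open>Sup_conv_operator\<close> applies to this family.
  Its leastness condition is \<open>AE_norm_le_of_rotations\<close> for \<open>f \<star> g\<close>
  with \<open>g\<close> real.\<close>

lemma cmodulus_conv_operator:
  fixes f :: "'g \<Rightarrow> complex"
  assumes f: "f \<in> LP M 1" and p: "1 \<le> p"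
  shows "cmodulus (complex_regular_algebra (complex_Lp M p)) (conv_operator M p (ae_class M f)) =
    conv_operator M p (ae_class M (\<lambda>x. norm (f x)))"
proof -
  let ?u = "\<lambda>\<theta> x. cos \<theta> * Re (f x) + sin \<theta> * Im (f x)"
  let ?L = "regular_lattice (Lp_lattice M p)"
  have F: "(\<lambda>x. Re (f x)) \<in> LP M 1" "(\<lambda>x. Im (f x)) \<in> LP M 1"
    using LP_Re[OF f] LP_Im[OF f] by simp_all
  have "vadd ?L (vscale ?L (cos \<theta>) (conv_operator M p (ae_class M (\<lambda>x. Re (f x)))))
      (vscale ?L (sin \<theta>) (conv_operator M p (ae_class M (\<lambda>x. Im (f x))))) =
      conv_operator M p (ae_class M (?u \<theta>))" for \<theta>
    by (simp only: regular_lattice_simps Lp_lattice_simps conv_operator_mult[OF F(1) p, symmetric]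
        conv_operator_mult[OF F(2) p, symmetric] conv_operator_add[OF LP_rotation(1,2)[OF f] p])
  then have "cmodulus (complex_regular_algebra (complex_Lp M p)) (conv_operator M p (ae_class M f)) =
      \<Squnion>\<^bsub>?L\<^esub>((\<lambda>u. conv_operator M p (ae_class M u)) ` (?u ` {0..2 * pi}))"
    by (simp only: cmodulus_def Let_def complex_regular_algebra_simps complex_Lp_simps Lp_lattice_simps
        re_im_part_conv_operator[OF f p] image_image)
  also have "\<dots> = conv_operator M p (ae_class M (\<lambda>x. norm (f x)))"
  proof (rule Sup_conv_operator[OF _ _ f p])
    show "?u ` {0..2 * pi} \<subseteq> LP M 1" using LP_rotation(3)[OF f] by auto
    show "AE x in M. u x \<le> norm (f x)" if "u \<in> ?u ` {0..2 * pi}" for u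
      using that complex_rotation_le_norm by auto
    show "AE s in M. norm (cv M f (\<lambda>x. of_real (g x)) s) \<le> h s"
      if g: "g \<in> LP M p" and le: "\<And>u. u \<in> ?u ` {0..2 * pi} \<Longrightarrow> AE s in M. cv M u g s \<le> h s" for g h
    proof (rule AE_norm_le_of_rotations)
      fix \<theta> :: real assume "\<theta> \<in> {0..2 * pi}"
      then have "AE s in M. cv M (?u \<theta>) g s \<le> h s" by (intro le imageI)
      then show "AE s in M. cos \<theta> * Re (cv M f (\<lambda>x. of_real (g x)) s) + sin \<theta> * Im (cv M f (\<lambda>x. of_real (g x)) s) \<le> h s"
        using cv_add_left[OF LP_rotation(1)[OF f, of \<theta>] LP_rotation(2)[OF f, of \<theta>] g p] cv_of_real_right[OF f g p]
        unfolding cv_mult_left by eventually_elim simp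
    qed
  qed simp_all
  finally show ?thesis .
qed

text \<open>Makes the last clause of \<open>complex_bla_hom\<close> meaningful on both sides:
  embedding the operator of a real function gives the operator of the embedded function.\<close>

lemma complexify_conv_operator:
  fixes u :: "'g \<Rightarrow> real"
  assumes u: "u \<in> LP M 1" and p: "1 \<le> p"
  shows "complexify_operator (complex_Lp M p) (conv_operator M p (ae_class M u)) =
    conv_operator M p (ae_class M (\<lambda>x. complex_of_real (u x)))"
proof (rule extensional_class_eqI[OF _ conv_operator_extensional])
  show "complexify_operator (complex_Lp M p) (conv_operator M p (ae_class M u)) \<in> extensional (Lp_space M p)"
    by (simp add: complexify_operator_def)
  fix g :: "'g \<Rightarrow> complex" assume g: "g \<in> LP M p"
  show "complexify_operator (complex_Lp M p) (conv_operator M p (ae_class M u)) (ae_class M g) =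
      conv_operator M p (ae_class M (\<lambda>x. complex_of_real (u x))) (ae_class M g)"
    unfolding complexify_conv_operator_class(1)[OF u g p] conv_operator_class[OF LP_of_real[OF u] g p]
    using cv_complex[OF LP_of_real[OF u] g p]
    by (intro ae_class_eqI) (auto elim!: eventually_mono simp: cv_def)
qed

lemma complex_bla_hom_conv_operator:
  assumes p: "1 \<le> p"
  shows "complex_bla_hom (complex_L1_algebra M) (complex_regular_algebra (complex_Lp M p)) (conv_operator M p)"
  unfolding complex_bla_hom_def complex_L1_algebra_simps complex_regular_algebra_simps complex_Lp_simps
proof (intro conjI ballI allI)
  show "conv_operator M p \<in> Lp_space M 1 \<rightarrow> complex_regular_operators (complex_Lp M p)"
    using conv_operator_complex_regular[OF _ p] by (auto simp: Lp_space_eq)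
  show "dist_continuous_on (Lp_space M 1) (cdist (complex_L1_algebra M))
      (cdist (complex_regular_algebra (complex_Lp M p))) (conv_operator M p)"
    unfolding dist_continuous_on_def
  proof (intro ballI allI impI)
    fix F :: "('g \<Rightarrow> complex) set" and e :: real assume F: "F \<in> Lp_space M 1" and e: "0 < e"
    obtain f where f: "f \<in> LP M 1" "F = ae_class M f" using Lp_spaceE[OF F] .
    show "\<exists>d>0. \<forall>G\<in>Lp_space M 1. cdist (complex_L1_algebra M) G F < d \<longrightarrow>
        cdist (complex_regular_algebra (complex_Lp M p)) (conv_operator M p G) (conv_operator M p F) < e"
    proof (intro exI[of _ e] conjI e ballI impI)
      fix G assume G: "G \<in> Lp_space M 1" and dist: "cdist (complex_L1_algebra M) G F < e"
      obtain g where g: "g \<in> LP M 1" "G = ae_class M g" using Lp_spaceE[OF G] .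
      note gf = class_diff[OF g(1) f(1)]
      have "cdist (complex_regular_algebra (complex_Lp M p)) (conv_operator M p G) (conv_operator M p F) =
          regular_norm (Lp_lattice M p) (conv_operator M p (ae_class M (\<lambda>x. norm (g x + - 1 * f x))))"
        unfolding cdist_def cnorm_def complex_regular_algebra_simps complex_Lp_simps f(2) g(2)
        by (simp only: conv_operator_diff[OF g(1) f(1) p] cmodulus_conv_operator[OF gf(2) p] regular_lattice_simps)
      also have "\<dots> \<le> cdist (complex_L1_algebra M) G F"
        unfolding cdist_def cnorm_def complex_L1_algebra_simps f(2) g(2) gf(1) cmodulus_complex_L1[OF gf(2)]
          Lp_lattice_simps Lp_norm_1_class[OF LP_norm[OF gf(2)]]
        by (rule regular_norm_conv_le[OF LP_norm[OF gf(2)] p])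
      finally show "cdist (complex_regular_algebra (complex_Lp M p)) (conv_operator M p G) (conv_operator M p F) < e"
        using dist by simp
    qed
  qed
  fix F :: "('g \<Rightarrow> complex) set" assume F: "F \<in> Lp_space M 1"
  then obtain f where f: "f \<in> LP M 1" "F = ae_class M f" by (rule Lp_spaceE)
  note fm = LP_measurable[OF f(1)]
  show "conv_operator M p (ae_lift M (\<lambda>y. c * y) F) = (\<lambda>x\<in>Lp_space M p. ae_lift M (\<lambda>y. c * y) (conv_operator M p F x))" for c
    unfolding f(2) ae_lift_class[OF fm] by (rule conv_operator_mult[OF f(1) p])
  show "complexify_operator (complex_Lp M p) (cmodulus (complex_regular_algebra (complex_Lp M p)) (conv_operator M p F)) =
      conv_operator M p (ae_lift M complex_of_real (cmodulus (complex_L1_algebra M) F))"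
    unfolding f(2) cmodulus_complex_L1[OF f(1)] cmodulus_conv_operator[OF f(1) p]
      ae_lift_class[OF LP_measurable[OF LP_norm[OF f(1)]]]
    by (rule complexify_conv_operator[OF LP_norm[OF f(1)] p])
  fix G :: "('g \<Rightarrow> complex) set" assume G: "G \<in> Lp_space M 1"
  then obtain g where g: "g \<in> LP M 1" "G = ae_class M g" by (rule Lp_spaceE)
  note gm = LP_measurable[OF g(1)]
  show "conv_operator M p (ae_lift2 M (+) F G) = (\<lambda>x\<in>Lp_space M p. ae_lift2 M (+) (conv_operator M p F x) (conv_operator M p G x))"
    unfolding f(2) g(2) ae_lift2_class[OF fm gm] by (rule conv_operator_add[OF f(1) g(1) p])
  show "conv_operator M p (conv M F G) = compose (Lp_space M p) (conv_operator M p F) (conv_operator M p G)"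
    unfolding f(2) g(2) by (rule conv_operator_compose[OF f(1) g(1) p])
qed

end

theorem corollary11p4:
  fixes M :: "'g::{topological_group_add,t2_space} measure" and p :: real
  assumes "locally_compact_space (euclidean :: 'g topology)"
    and "left_haar_measure M"
    and "1 \<le> p"
  shows
    "((\<forall>F\<in>Lp_space M 1. \<forall>G\<in>Lp_space M p. conv M F G \<in> (Lp_space M p :: ('g \<Rightarrow> real) set set)) \<and>
      (\<forall>F\<in>Lp_space M 1. conv_operator M p F \<in> regular_operators (Lp_lattice M p)) \<and>
      bla_hom (L1_algebra M) (regular_algebra (Lp_lattice M p)) (conv_operator M p) \<and>
      inj_on (conv_operator M p) (carrier (L1_algebra M)))
     \<and>
     ((\<forall>F\<in>Lp_space M 1. \<forall>G\<in>Lp_space M p. conv M F G \<in> (Lp_space M p :: ('g \<Rightarrow> complex) set set)) \<and>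
      (\<forall>F\<in>Lp_space M 1. conv_operator M p F \<in> complex_regular_operators (complex_Lp M p)) \<and>
      complex_bla_hom (complex_L1_algebra M) (complex_regular_algebra (complex_Lp M p))
        (conv_operator M p) \<and>
      inj_on (conv_operator M p) (carrier (complex_L1_algebra M)))"
proof -
  interpret haar_measure M by (unfold_locales) (rule assms(1,2))+
  show ?thesis
  proof (intro conjI ballI)
    show "conv_operator M p F \<in> regular_operators (Lp_lattice M p)" if "F \<in> Lp_space M 1" for F
      using that conv_operator_regular[OF _ assms(3)] by (auto simp: Lp_space_eq)
    show "conv_operator M p F \<in> complex_regular_operators (complex_Lp M p)" if "F \<in> Lp_space M 1" for F
      using that conv_operator_complex_regular[OF _ assms(3)] by (auto simp: Lp_space_eq)
  qed (simp_all add: conv_in_Lp_space inj_on_conv_operator bla_hom_conv_operator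
      complex_bla_hom_conv_operator assms(3))
qed

end
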